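(* Let $r>0$, $s\ge0$ be constants, and suppose that, for each $n$, $\theta\in\mathbb{R}^p$, $\eta\in\mathbb{R}^q$ (with $\theta,\eta,p,q$ allowed to depend on $n$) satisfy $$\frac{2\|\theta\|\|\eta\|}{\sqrt{\|\theta\|^2+\|\eta\|^2}}=\sqrt{2r\log n},\qquad \frac{\big|\|\theta\|^2-\|\eta\|^2\big|}{\sqrt{\|\theta\|^2+\|\eta\|^2}}=\sqrt{2s\log n}.$$ Consider testing $H_0:\ell(z,\sigma)=0$ against $H_1:\ell(z,\sigma)>0$. If $r+s-\sqrt s\sqrt{r+s}<\frac12$, then $\liminf_{n\to\infty}R_n^{\rm exact}(\theta,\eta)>0$. If $r+s-\sqrt s\sqrt{r+s}>\frac12$, then the test $\dot\psi$ defined in the context satisfies $\lim_{n\to\infty}R_n^{\rm exact}(\dot\psi,\theta,\eta)=0$.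
   Context: Model: for $z,\sigma\in\{-1,1\}^n$, $P^{(n)}_{(\theta,\eta,z,\sigma)}$ is the joint law of independent $X_i\sim N(z_i\theta,I_p)$, $Y_i\sim N(\sigma_i\eta,I_q)$, $i\in[n]$. Write $a\wedge b=\min(a,b)$ and $\ell(z,\sigma)=\big(\frac1n\sum_i\mathbf 1\{z_i\ne\sigma_i\}\big)\wedge\big(\frac1n\sum_i\mathbf 1\{z_i\ne-\sigma_i\}\big)$. For a test $\psi$ (measurable function of the data with values in $[0,1]$; $P\psi$ denotes expectation), $$R_n^{\rm exact}(\psi,\theta,\eta)=\sup_{z\in\{-1,1\}^n,\ \sigma\in\{z,-z\}}P^{(n)}_{(\theta,\eta,z,\sigma)}\psi+\sup_{z,\sigma\in\{-1,1\}^n:\,\ell(z,\sigma)>0}P^{(n)}_{(\theta,\eta,z,\sigma)}(1-\psi),$$ and $R_n^{\rm exact}(\theta,\eta)=\inf_\psi R_n^{\rm exact}(\psi,\theta,\eta)$. Test: let $S_{(r,s)}(t)=\mathbb P\big(|\sqrt rU+\sqrt sV|-\sqrt{r+s}|V|>t\big)$, where $(U,V)\sim\frac12N(0,1)\otimes N(-\sqrt{2(r+s)\log n},1)+\frac12N(0,1)\otimes N(\sqrt{2(r+s)\log n},1)$. Let $C^-(X_i,Y_i,\theta,\eta)=|\theta^TX_i-\eta^TY_i|-|\theta^TX_i+\eta^TY_i|$ and $C^+(X_i,Y_i,\theta,\eta)=|\theta^TX_i+\eta^TY_i|-|\theta^TX_i-\eta^TY_i|$, and $$\dot T_n^{\pm}=\sup_{t\in\mathbb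 R}\frac{\left|\sum_{i=1}^n\mathbf 1\{C^{\pm}(X_i,Y_i,\theta,\eta)>t\sqrt{2\log n}\}-nS_{(r,s)}(t)\right|}{\sqrt{nS_{(r,s)}(t)(1-S_{(r,s)}(t))}}.$$ Then $\dot\psi=\mathbf 1\{\dot T_n^-\wedge\dot T_n^+>\sqrt{2(1+\delta)\log\log n}\}$, where $\delta>0$ is an arbitrary fixed constant. *)

theory Defs
  imports "HOL-Probability.Probability"
begin

text \<open>
  The dimensions vary with the sample size, so a vector of length \<open>d\<close> is a function
  \<open>nat \<Rightarrow> real\<close> read on \<open>{..<d}\<close>.  One data set is a function on \<open>{..<n}\<close> whose
  \<open>i\<close>-th value is the pair \<open>(X\<^sub>i, Y\<^sub>i)\<close>.
\<close>

type_synonym rvec = "nat \<Rightarrow> real"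
type_synonym sample = "nat \<Rightarrow> rvec \<times> rvec"

definition gauss :: "real \<Rightarrow> real measure" where
  "gauss m = density lborel (normal_density m 1)"

text \<open>\<open>N(\<mu>, I\<^sub>d)\<close>: the coordinates are independent with unit variance.\<close>

definition gauss_vec :: "nat \<Rightarrow> rvec \<Rightarrow> rvec measure" where
  "gauss_vec d \<mu> = (\<Pi>\<^sub>M j\<in>{..<d}. gauss (\<mu> j))"

definition data_law :: "nat \<Rightarrow> nat \<Rightarrow> nat \<Rightarrow> rvec \<Rightarrow> rvec \<Rightarrow> rvec \<Rightarrow> rvec \<Rightarrow> sample measure" where
  "data_law n p q \<theta> \<eta> z \<sigma> =
     (\<Pi>\<^sub>M i\<in>{..<n}. gauss_vec p (\<lambda>j. z i * \<theta> j) \<Otimes>\<^sub>M gauss_vec q (\<lambda>j. \<sigma> i * \<eta> j))"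

definition data_space :: "nat \<Rightarrow> nat \<Rightarrow> nat \<Rightarrow> sample measure" where
  "data_space n p q =
     (\<Pi>\<^sub>M i\<in>{..<n}. (\<Pi>\<^sub>M j\<in>{..<p}. borel) \<Otimes>\<^sub>M (\<Pi>\<^sub>M j\<in>{..<q}. borel))"

definition tests :: "nat \<Rightarrow> nat \<Rightarrow> nat \<Rightarrow> (sample \<Rightarrow> real) set" where
  "tests n p q = {\<psi> \<in> borel_measurable (data_space n p q).
     \<forall>\<omega>\<in>space (data_space n p q). 0 \<le> \<psi> \<omega> \<and> \<psi> \<omega> \<le> 1}"

definition labels :: "nat \<Rightarrow> rvec set" where
  "labels n = ({..<n} \<rightarrow>\<^sub>E {-1, 1})"

text \<open>Negation that keeps the default value outside \<open>{..<n}\<close>, hence maps \<open>labels n\<close> to itself.\<close>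

definition neg_labels :: "nat \<Rightarrow> rvec \<Rightarrow> rvec" where
  "neg_labels n z = (\<lambda>i\<in>{..<n}. - z i)"

definition label_loss :: "nat \<Rightarrow> rvec \<Rightarrow> rvec \<Rightarrow> real" where
  "label_loss n z \<sigma> =
     min ((1 / real n) * (\<Sum>i<n. of_bool (z i \<noteq> \<sigma> i)))
         ((1 / real n) * (\<Sum>i<n. of_bool (z i \<noteq> - \<sigma> i)))"

text \<open>
  The index set of the second supremum is nonempty exactly for \<open>n \<ge> 2\<close>; the values for
  smaller \<open>n\<close> carry no meaning.
\<close>

definition exact_risk_of ::
    "nat \<Rightarrow> nat \<Rightarrow> nat \<Rightarrow> rvec \<Rightarrow> rvec \<Rightarrow> (sample \<Rightarrow> real) \<Rightarrow> real" where
  "exact_risk_of n p q \<theta> \<eta> \<psi> =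
     (SUP (z, \<sigma>) \<in> {(z, \<sigma>). z \<in> labels n \<and> \<sigma> \<in> {z, neg_labels n z}}.
        integral\<^sup>L (data_law n p q \<theta> \<eta> z \<sigma>) \<psi>) +
     (SUP (z, \<sigma>) \<in> {(z, \<sigma>). z \<in> labels n \<and> \<sigma> \<in> labels n \<and> label_loss n z \<sigma> > 0}.
        integral\<^sup>L (data_law n p q \<theta> \<eta> z \<sigma>) (\<lambda>\<omega>. 1 - \<psi> \<omega>))"

definition exact_risk :: "nat \<Rightarrow> nat \<Rightarrow> nat \<Rightarrow> rvec \<Rightarrow> rvec \<Rightarrow> real" where
  "exact_risk n p q \<theta> \<eta> = (INF \<psi> \<in> tests n p q. exact_risk_of n p q \<theta> \<eta> \<psi>)"

text \<open>
  \<open>S\<^bsub>(r,s)\<^esub>(t)\<close>, which depends on \<open>n\<close> through the means of the two components; the law of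
  \<open>(U, V)\<close> is their equal-weight mixture.
\<close>

definition null_survival :: "nat \<Rightarrow> real \<Rightarrow> real \<Rightarrow> real \<Rightarrow> real" where
  "null_survival n r s t =
     (let m = sqrt (2 * (r + s) * ln (real n));
          E = {(u, v). \<bar>sqrt r * u + sqrt s * v\<bar> - sqrt (r + s) * \<bar>v\<bar> > t}
      in (1 / 2) * measure (gauss 0 \<Otimes>\<^sub>M gauss (- m)) E +
         (1 / 2) * measure (gauss 0 \<Otimes>\<^sub>M gauss m) E)"

definition dotp :: "nat \<Rightarrow> rvec \<Rightarrow> rvec \<Rightarrow> real" where
  "dotp d x y = (\<Sum>j<d. x j * y j)"

definition C_minus :: "nat \<Rightarrow> nat \<Rightarrow> rvec \<Rightarrow> rvec \<Rightarrow> rvec \<times> rvec \<Rightarrow> real" where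
  "C_minus p q \<theta> \<eta> = (\<lambda>(x, y).
     \<bar>dotp p \<theta> x - dotp q \<eta> y\<bar> - \<bar>dotp p \<theta> x + dotp q \<eta> y\<bar>)"

definition C_plus :: "nat \<Rightarrow> nat \<Rightarrow> rvec \<Rightarrow> rvec \<Rightarrow> rvec \<times> rvec \<Rightarrow> real" where
  "C_plus p q \<theta> \<eta> = (\<lambda>(x, y).
     \<bar>dotp p \<theta> x + dotp q \<eta> y\<bar> - \<bar>dotp p \<theta> x - dotp q \<eta> y\<bar>)"

definition HC_stat ::
    "nat \<Rightarrow> real \<Rightarrow> real \<Rightarrow> (rvec \<times> rvec \<Rightarrow> real) \<Rightarrow> sample \<Rightarrow> ereal" where
  "HC_stat n r s C \<omega> = (SUP t::real. ereal
     (\<bar>(\<Sum>i<n. of_bool (C (\<omega> i) > t * sqrt (2 * ln (real n)))) - real n * null_survival n r s t\<bar> /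
      sqrt (real n * null_survival n r s t * (1 - null_survival n r s t))))"

definition HC_test ::
    "nat \<Rightarrow> nat \<Rightarrow> nat \<Rightarrow> real \<Rightarrow> real \<Rightarrow> real \<Rightarrow> rvec \<Rightarrow> rvec \<Rightarrow> sample \<Rightarrow> real" where
  "HC_test n p q r s \<delta> \<theta> \<eta> \<omega> = of_bool
     (min (HC_stat n r s (C_minus p q \<theta> \<eta>) \<omega>) (HC_stat n r s (C_plus p q \<theta> \<eta>) \<omega>)
        > ereal (sqrt (2 * (1 + \<delta>) * ln (ln (real n)))))"

end

theory Submission
  imports Defs "HOL-Real_Asymp.Real_Asymp"
begin

text \<open>
  The per-pair statistic \<open>C_minus\<close> is, up to \<open>ln 2\<close>, the log-likelihood ratio of opposite
  labels against equal labels. With \<open>l\<^sup>2 = 2 * ln n\<close> and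
  \<open>\<rho> = r + s - sqrt s * sqrt (r + s)\<close>, a pair with opposite labels has \<open>C_minus\<close> concentrated
  at \<open>\<rho> * l\<^sup>2\<close> with fluctuations of order \<open>l\<close> (\<open>flipped_concentration\<close>), so its likelihood
  ratio is about \<open>n powr (2 * \<rho>)\<close>. Among \<open>n\<close> pairs with equal labels the largest likelihood
  ratio is at most of order \<open>n\<close>, because the probability to exceed \<open>x\<close> is at most \<open>1 / x\<close>.
  Hence a single mismatch stands out if \<open>2 * \<rho> > 1\<close> and is hidden if \<open>2 * \<rho> < 1\<close>.

  If \<open>\<rho> < 1 / 2\<close>, uniformly random agreeing labels are compared with the same labels after
  one random flip (\<open>mixture_lower_bound\<close>). The likelihood ratio is an average of \<open>n\<close>
  independent likelihood ratios of mean one. Truncated at \<open>n\<close>, they keep a mean of at least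
  three quarters for large \<open>n\<close> (\<open>truncated_mean_large\<close>), and an exponential bound shows that
  the average is at least one quarter with probability at least \<open>1 - exp (- 1 / 8)\<close> under the
  first prior; the risk of every test is therefore bounded below.

  If \<open>\<rho> > 1 / 2\<close>, look at the higher criticism statistic at a threshold slightly below
  \<open>\<rho> * l\<close>. There the expected number of exceedances under the null law is a negative power of
  \<open>n\<close> (\<open>S_tail\<close>), while one mismatched pair produces an exceedance, so the statistic is
  polynomially large (\<open>type_II_bound\<close>). An alternative contains both a pair with equal and a
  pair with opposite labels, so both statistics are large. Under the null hypothesis one of
  them is the supremum of a standardised empirical process of \<open>n\<close> independent variables with
  survival function \<open>null_survival\<close> (\<open>null_law\<close>, a rotation of the plane), and it remains to
  show that this supremum is at most \<open>sqrt (2 * (1 + \<delta>) * ln (ln n))\<close> with probability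
  tending to one. The count of a set divided by its mass is a martingale along a shrinking
  chain of sets. Doob's inequality with a sharp exponential moment controls a block of masses
  within a factor \<open>1 + \<epsilon>\<close> (\<open>doob_chain\<close>, \<open>hc_block\<close>), and there are only about \<open>ln n\<close> such
  blocks (\<open>hc_chain_half\<close>), each failing with probability \<open>(ln n) powr (- c)\<close> for some
  \<open>c > 1\<close>.
\<close>

section \<open>A maximal inequality for counts along a chain of events\<close>

lemma exp_le_quadratic:
  fixes x :: real assumes "\<bar>x\<bar> \<le> 1"
  shows "exp x \<le> 1 + x + x\<^sup>2 / 2 * (1 + \<bar>x\<bar>)"
proof -
  obtain t where t: "\<bar>t\<bar> \<le> \<bar>x\<bar>" "exp x = (\<Sum>m<3. x ^ m / fact m) + exp t / fact 3 * x ^ 3"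
    using Maclaurin_exp_le[of x 3] by blast
  have "exp t \<le> exp 1" using t(1) assms by simp
  then have e: "exp t \<le> 3" using exp_le by linarith
  have "exp t / fact 3 * x ^ 3 \<le> \<bar>exp t / fact 3 * x ^ 3\<bar>" by (rule abs_ge_self)
  also have "\<dots> = exp t / 6 * \<bar>x\<bar>^3" by (simp add: abs_mult power_abs fact_numeral)
  also have "\<dots> \<le> 3 / 6 * \<bar>x\<bar>^3" using e by (intro mult_right_mono) auto
  also have "\<dots> = x\<^sup>2 / 2 * \<bar>x\<bar>" by (simp add: power3_eq_cube power2_eq_square)
  finally show ?thesis unfolding t(2)
    by (simp add: numeral_eq_Suc algebra_simps)
qed

text \<open>
  The variance factor \<open>u * (1 - u)\<close>, rather than the Poisson bound \<open>u\<close>, is what lets one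
  exponential estimate serve the whole range of \<open>u\<close> up to one half with the sharp constant:
  expand the exponential of the centred variable to second order and use that it is at most
  \<open>\<bar>g\<bar>\<close> in absolute value.
\<close>
lemma bernoulli_mgf_bound:
  fixes u g :: real assumes "0 \<le> u" "u \<le> 1" "\<bar>g\<bar> \<le> 1"
  shows "exp (- g * u) * (1 - u + u * exp g) \<le> exp (u * (1 - u) * (g\<^sup>2 / 2 * (1 + \<bar>g\<bar>)))"
proof -
  have q: "exp (g * x) \<le> 1 + g * x + x\<^sup>2 * (g\<^sup>2 / 2 * (1 + \<bar>g\<bar>))" if "\<bar>x\<bar> \<le> 1" for x
  proof -
    have b: "\<bar>g * x\<bar> \<le> \<bar>g\<bar>" using that by (simp add: abs_mult mult_left_le)
    have "exp (g * x) \<le> 1 + g * x + (g*x)\<^sup>2 / 2 * (1 + \<bar>g * x\<bar>)"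
      using b assms by (intro exp_le_quadratic) auto
    also have "\<dots> \<le> 1 + g * x + (g*x)\<^sup>2 / 2 * (1 + \<bar>g\<bar>)"
      using b by (intro add_left_mono mult_left_mono) auto
    finally show ?thesis by (simp add: power_mult_distrib algebra_simps)
  qed
  define Q where "Q = g\<^sup>2 / 2 * (1 + \<bar>g\<bar>)"
  have "exp (- g * u) * (1 - u + u * exp g) = (1 - u) * exp (g * (- u)) + u * exp (g * (1 - u))"
    by (simp add: algebra_simps exp_diff exp_minus field_simps)
  also have "\<dots> \<le> (1 - u) * (1 + g * (-u) + (-u)\<^sup>2 * Q)
       + u * (1 + g * (1 - u) + (1-u)\<^sup>2 * Q)"
    using assms by (intro add_mono mult_left_mono q[folded Q_def]) auto
  also have "\<dots> = 1 + u * (1 - u) * Q"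
    by (simp add: power2_eq_square algebra_simps)
  also have "\<dots> \<le> exp (u * (1 - u) * Q)"
    by (rule exp_ge_add_one_self)
  finally show ?thesis unfolding Q_def .
qed

text \<open>
  A conditional Jensen inequality in product form. The weight \<open>H\<close> cannot see where a
  coordinate lies inside \<open>B\<close>, so conditionally on \<open>H\<close> each coordinate in \<open>B\<close> is still
  distributed as \<open>M\<close> restricted to \<open>B\<close>; replacing \<open>f\<close> by \<open>g\<close> there, one coordinate after the
  other, can only increase the integral. This plays the role of conditional expectations
  given the indicators of the larger sets of a chain.
\<close>
lemma nn_integral_PiM_redistribute:
  fixes f g :: "'a \<Rightarrow> ennreal"
  assumes M: "prob_space M" and I: "finite I" and B: "B \<in> sets M"
    and f: "f \<in> borel_measurable M" and g: "g \<in> borel_measurable M"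
    and fg: "\<And>x. x \<in> space M \<Longrightarrow> x \<notin> B \<Longrightarrow> f x = g x"
    and le: "(\<integral>\<^sup>+x. indicator B x * f x \<partial>M) \<le> (\<integral>\<^sup>+x. indicator B x * g x \<partial>M)"
    and H: "H \<in> borel_measurable (PiM I (\<lambda>_. M))"
    and inv: "\<And>\<omega> \<omega>'. \<omega> \<in> space (PiM I (\<lambda>_. M)) \<Longrightarrow> \<omega>' \<in> space (PiM I (\<lambda>_. M)) \<Longrightarrow>
        (\<And>i. i \<in> I \<Longrightarrow> \<omega> i = \<omega>' i \<or> \<omega> i \<in> B \<and> \<omega>' i \<in> B) \<Longrightarrow> H \<omega> = (H \<omega>' :: ennreal)"
  shows "(\<integral>\<^sup>+\<omega>. H \<omega> * (\<Prod>i\<in>I. f (\<omega> i)) \<partial>PiM I (\<lambda>_. M))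
       \<le> (\<integral>\<^sup>+\<omega>. H \<omega> * (\<Prod>i\<in>I. g (\<omega> i)) \<partial>PiM I (\<lambda>_. M))"
  using I H inv
proof (induction I arbitrary: H rule: finite_induct)
  case empty then show ?case by simp
next
  case (insert i I)
  note [measurable] = f g B insert.prems(1)
  interpret M: prob_space M by fact
  interpret P: product_sigma_finite "\<lambda>_. M" by standard
  interpret PP: product_prob_space "\<lambda>_. M" I by standard
  have upd: "(\<lambda>z. (fst z)(i := snd z)) \<in> PiM I (\<lambda>_. M) \<Otimes>\<^sub>M M \<rightarrow>\<^sub>M PiM (insert i I) (\<lambda>_. M)"
    using measurable_add_dim[of i I "\<lambda>_. M"] by (simp add: case_prod_beta')
  have updy: "(\<lambda>x. x(i := y)) \<in> PiM I (\<lambda>_. M) \<rightarrow>\<^sub>M PiM (insert i I) (\<lambda>_. M)" if "y \<in> space M" for y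
    using measurable_compose[OF measurable_Pair2'[OF that] upd, unfolded fst_conv snd_conv] measurable_compose[of "\<lambda>x. (x,y)", OF _ upd] that by simp
  have updx: "(\<lambda>y. x(i := y)) \<in> M \<rightarrow>\<^sub>M PiM (insert i I) (\<lambda>_. M)" if "x \<in> space (PiM I (\<lambda>_. M))" for x
    using measurable_component_update[OF that insert(2)] .
  have Hm: "(\<lambda>z. H ((fst z)(i := snd z))) \<in> borel_measurable (PiM I (\<lambda>_. M) \<Otimes>\<^sub>M M)"
    using measurable_compose[OF upd insert.prems(1)] .
  note [measurable] = Hm
  have pe: "(\<Prod>j\<in>I. k ((x(i := y)) j)) = (\<Prod>j\<in>I. k (x j))" for k :: "'a \<Rightarrow> ennreal" and x y
    using insert(2) by (intro prod.cong) auto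
  have step1: "(\<integral>\<^sup>+x. H (x(i := y)) * (\<Prod>j\<in>I. f (x j)) \<partial>PiM I (\<lambda>_. M))
      \<le> (\<integral>\<^sup>+x. H (x(i := y)) * (\<Prod>j\<in>I. g (x j)) \<partial>PiM I (\<lambda>_. M))" if y: "y \<in> space M" for y
  proof (rule insert.IH)
    show "(\<lambda>x. H (x(i := y))) \<in> borel_measurable (PiM I (\<lambda>_. M))"
      using measurable_compose[OF updy[OF y] insert.prems(1)] .
    fix x x' assume x: "x \<in> space (PiM I (\<lambda>_. M))" and x': "x' \<in> space (PiM I (\<lambda>_. M))"
      and e: "\<And>j. j \<in> I \<Longrightarrow> x j = x' j \<or> x j \<in> B \<and> x' j \<in> B"
    show "H (x(i := y)) = H (x'(i := y))"
      using measurable_space[OF updy[OF y] x] measurable_space[OF updy[OF y] x']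
      by (rule insert.prems(2)) (use e in auto)
  qed
  have step2: "(\<integral>\<^sup>+y. H (x(i := y)) * f y \<partial>M) \<le> (\<integral>\<^sup>+y. H (x(i := y)) * g y \<partial>M)"
    if x: "x \<in> space (PiM I (\<lambda>_. M))" for x
  proof -
    define h where "h y = H (x(i := y))" for y
    have [measurable]: "h \<in> borel_measurable M"
      unfolding h_def using measurable_compose[OF updx[OF x] insert.prems(1)] .
    obtain c where c: "\<And>y. y \<in> B \<Longrightarrow> h y = c"
    proof (cases "B = {}")
      case False
      then obtain y0 where y0: "y0 \<in> B" by auto
      have sp: "y \<in> space M" if "y \<in> B" for y using that B sets.sets_into_space by blast
      show ?thesis
      proof (rule that[of "h y0"])
        fix y assume y: "y \<in> B"
        show "h y = h y0" unfolding h_def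
          using measurable_space[OF updx[OF x] sp[OF y]] measurable_space[OF updx[OF x] sp[OF y0]]
          by (rule insert.prems(2)) (use y y0 in auto)
      qed
    qed (use that in auto)
    have split: "(\<integral>\<^sup>+y. h y * k y \<partial>M) = c * (\<integral>\<^sup>+y. indicator B y * k y \<partial>M) + (\<integral>\<^sup>+y. indicator (space M - B) y * (h y * k y) \<partial>M)"
      if [measurable]: "k \<in> borel_measurable M" for k
    proof -
      have "(\<integral>\<^sup>+y. h y * k y \<partial>M) = (\<integral>\<^sup>+y. c * (indicator B y * k y) + indicator (space M - B) y * (h y * k y) \<partial>M)"
        by (intro nn_integral_cong) (auto simp: c split: split_indicator)
      also have "\<dots> = c * (\<integral>\<^sup>+y. indicator B y * k y \<partial>M) + (\<integral>\<^sup>+y. indicator (space M - B) y * (h y * k y) \<partial>M)"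
        by (subst nn_integral_add) (auto simp: nn_integral_cmult)
      finally show ?thesis .
    qed
    have "(\<integral>\<^sup>+y. indicator (space M - B) y * (h y * f y) \<partial>M) = (\<integral>\<^sup>+y. indicator (space M - B) y * (h y * g y) \<partial>M)"
      by (intro nn_integral_cong) (auto simp: fg split: split_indicator)
    then have "(\<integral>\<^sup>+y. h y * f y \<partial>M) \<le> (\<integral>\<^sup>+y. h y * g y \<partial>M)"
      unfolding split[OF f] split[OF g] using le by (auto intro!: add_mono mult_left_mono)
    then show ?thesis by (simp add: h_def)
  qed
  have mm: "(\<lambda>\<omega>. H \<omega> * (\<Prod>j\<in>insert i I. k (\<omega> j))) \<in> borel_measurable (PiM (insert i I) (\<lambda>_. M))"
    if [measurable]: "k \<in> borel_measurable M" for k by measurable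
  have "(\<integral>\<^sup>+\<omega>. H \<omega> * (\<Prod>j\<in>insert i I. f (\<omega> j)) \<partial>PiM (insert i I) (\<lambda>_. M))
      = (\<integral>\<^sup>+y. (\<integral>\<^sup>+x. f y * (H (x(i := y)) * (\<Prod>j\<in>I. f (x j))) \<partial>PiM I (\<lambda>_. M)) \<partial>M)"
    by (subst P.product_nn_integral_insert_rev[OF insert(1,2) mm[OF f]])
       (simp add: insert(1,2) pe mult.left_commute mult.commute mult.assoc fun_upd_same del: fun_upd_apply)
  also have "\<dots> = (\<integral>\<^sup>+y. f y * (\<integral>\<^sup>+x. (H (x(i := y)) * (\<Prod>j\<in>I. f (x j))) \<partial>PiM I (\<lambda>_. M)) \<partial>M)"
    by (intro nn_integral_cong nn_integral_cmult) (use measurable_compose[OF updy insert.prems(1)] in measurable)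
  also have "\<dots> \<le> (\<integral>\<^sup>+y. f y * (\<integral>\<^sup>+x. (H (x(i := y)) * (\<Prod>j\<in>I. g (x j))) \<partial>PiM I (\<lambda>_. M)) \<partial>M)"
    by (intro nn_integral_mono mult_left_mono step1) auto
  also have "\<dots> = (\<integral>\<^sup>+y. (\<integral>\<^sup>+x. f y * (H (x(i := y)) * (\<Prod>j\<in>I. g (x j))) \<partial>PiM I (\<lambda>_. M)) \<partial>M)"
    by (intro nn_integral_cong nn_integral_cmult[symmetric]) (use measurable_compose[OF updy insert.prems(1)] in measurable)
  also have "\<dots> = (\<integral>\<^sup>+x. (\<integral>\<^sup>+y. f y * (H (x(i := y)) * (\<Prod>j\<in>I. g (x j))) \<partial>M) \<partial>PiM I (\<lambda>_. M))"
    by (rule pair_sigma_finite.Fubini'[symmetric])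
       (auto intro!: pair_sigma_finite.intro M.sigma_finite_measure PP.sigma_finite_measure simp: case_prod_beta')
  also have "\<dots> = (\<integral>\<^sup>+x. (\<Prod>j\<in>I. g (x j)) * (\<integral>\<^sup>+y. (H (x(i := y)) * f y) \<partial>M) \<partial>PiM I (\<lambda>_. M))"
    by (intro nn_integral_cong, subst nn_integral_cmult[symmetric])
       (use measurable_compose[OF updx insert.prems(1)] in \<open>auto simp: ac_simps\<close>)
  also have "\<dots> \<le> (\<integral>\<^sup>+x. (\<Prod>j\<in>I. g (x j)) * (\<integral>\<^sup>+y. (H (x(i := y)) * g y) \<partial>M) \<partial>PiM I (\<lambda>_. M))"
    by (intro nn_integral_mono mult_left_mono step2) auto
  also have "\<dots> = (\<integral>\<^sup>+x. (\<integral>\<^sup>+y. g y * (H (x(i := y)) * (\<Prod>j\<in>I. g (x j))) \<partial>M) \<partial>PiM I (\<lambda>_. M))"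
    by (intro nn_integral_cong, subst nn_integral_cmult[symmetric])
       (use measurable_compose[OF updx insert.prems(1)] in \<open>auto simp: ac_simps\<close>)
  also have "\<dots> = (\<integral>\<^sup>+\<omega>. H \<omega> * (\<Prod>j\<in>insert i I. g (\<omega> j)) \<partial>PiM (insert i I) (\<lambda>_. M))"
    by (subst P.product_nn_integral_insert[OF insert(1,2) mm[OF g]])
       (simp add: insert(1,2) pe mult.left_commute mult.commute mult.assoc fun_upd_same del: fun_upd_apply)
  finally show ?case .
qed


lemma prob_PiM_const: "prob_space M \<Longrightarrow> prob_space (PiM I (\<lambda>_. M))"
  by (rule prob_space_PiM)

definition hits :: "nat \<Rightarrow> 'a set \<Rightarrow> (nat \<Rightarrow> 'a) \<Rightarrow> real" where
  "hits n A \<omega> = (\<Sum>i<n. indicator A (\<omega> i))"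

lemma hits_measurable [measurable]:
  "A \<in> sets M \<Longrightarrow> hits n A \<in> borel_measurable (PiM {..<n} (\<lambda>_. M))"
  unfolding hits_def[abs_def]
  by (intro borel_measurable_sum measurable_compose[OF measurable_component_singleton borel_measurable_indicator]) auto

lemma exp_hits: "ennreal (exp (c * hits n A \<omega>)) = (\<Prod>i<n. ennreal (exp (c * indicator A (\<omega> i))))"
  unfolding hits_def sum_distrib_left exp_sum[OF finite_lessThan] by (subst prod_ennreal) auto

lemma nn_integral_exp_hits:
  assumes "prob_space M" and [measurable]: "A \<in> sets M"
  shows "(\<integral>\<^sup>+\<omega>. ennreal (exp (c * hits n A \<omega>)) \<partial>PiM {..<n} (\<lambda>_. M))
     = ennreal ((1 - measure M A + measure M A * exp c) ^ n)"
proof -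
  interpret M: prob_space M by fact
  interpret P: product_sigma_finite "\<lambda>_. M" by standard
  have "(\<integral>\<^sup>+x. ennreal (exp (c * indicator A x)) \<partial>M)
      = (\<integral>\<^sup>+x. ennreal (exp c) * indicator A x + indicator (space M - A) x \<partial>M)"
    by (intro nn_integral_cong) (auto split: split_indicator)
  also have "\<dots> = ennreal (exp c) * emeasure M A + emeasure M (space M - A)"
    by (subst nn_integral_add) (auto simp: nn_integral_cmult)
  also have "\<dots> = ennreal (1 - measure M A + measure M A * exp c)"
  proof -
    have "ennreal (exp c * measure M A + (1 - measure M A)) = ennreal (exp c) * emeasure M A + emeasure M (space M - A)"
      by (subst ennreal_plus) (auto simp: M.emeasure_eq_measure M.prob_compl ennreal_mult)
    then show ?thesis by (simp add: algebra_simps)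
  qed
  finally have e: "(\<integral>\<^sup>+x. ennreal (exp (c * indicator A x)) \<partial>M) = ennreal (1 - measure M A + measure M A * exp c)" .
  have "(\<integral>\<^sup>+\<omega>. (\<Prod>i<n. ennreal (exp (c * indicator A (\<omega> i)))) \<partial>PiM {..<n} (\<lambda>_. M))
      = (\<Prod>i<n. \<integral>\<^sup>+x. ennreal (exp (c * indicator A x)) \<partial>M)"
    by (rule P.product_nn_integral_prod) auto
  also have "\<dots> = ennreal (1 - measure M A + measure M A * exp c) ^ n"
    unfolding e prod_constant card_lessThan ..
  also have "\<dots> = ennreal ((1 - measure M A + measure M A * exp c) ^ n)"
    by (rule ennreal_power) (auto intro: add_nonneg_nonneg)
  finally show ?thesis unfolding exp_hits .
qed

text \<open>
  Jensen's inequality for a point of a set of mass \<open>v\<close> that falls into a subset of mass \<open>u\<close>: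
  the count of the subset divided by \<open>u\<close> has the same conditional mean as the count of the
  larger set divided by \<open>v\<close>.
\<close>
lemma exp_jensen_ratio:
  fixes u v c :: real assumes "0 < u" "u \<le> v"
  shows "v * exp (c / v) \<le> (v - u) + u * exp (c / u)"
proof -
  have "exp ((1 - u / v) *\<^sub>R 0 + (u / v) *\<^sub>R (c / u)) \<le> (1 - u / v) * exp 0 + (u / v) * exp (c / u)"
    using assms by (intro convex_onD[OF exp_convex]) auto
  then have "exp (c / v) \<le> (1 - u / v) + (u / v) * exp (c / u)"
    using assms by simp
  then have "v * exp (c / v) \<le> v * ((1 - u / v) + (u / v) * exp (c / u))"
    using assms by (intro mult_left_mono) auto
  also have "\<dots> = (v - u) + u * exp (c / u)" using assms by (simp add: field_simps)
  finally show ?thesis .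
qed

text \<open>
  As \<open>A t\<close> shrinks, \<open>hits n (A t) \<omega> / measure M (A t)\<close> is a martingale, so its exponential is
  a submartingale and this is Doob's maximal inequality with the event kept inside the last
  expectation. The induction adds the index of the smallest set last; the event for the
  earlier indices depends only on sets containing \<open>A b'\<close>, as the redistribution lemma needs.
\<close>
lemma doob_chain:
  fixes A :: "real \<Rightarrow> 'a set" and n :: nat and c y :: real
  assumes M: "prob_space M" and A: "\<And>t. A t \<in> sets M" "antimono A"
    and T: "finite T" "\<And>t. t \<in> T \<Longrightarrow> t \<le> b" and b: "measure M (A b) > 0"
  defines "P \<equiv> PiM {..<n} (\<lambda>_. M)"
  defines "E \<equiv> {\<omega> \<in> space P. \<exists>t\<in>T. c * (hits n (A t) \<omega> / measure M (A t)) \<ge> y}"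
  shows "ennreal (exp y) * emeasure P E
     \<le> (\<integral>\<^sup>+\<omega>. indicator E \<omega> * ennreal (exp (c / measure M (A b) * hits n (A b) \<omega>)) \<partial>P)"
  using T b unfolding E_def
proof (induction T arbitrary: b rule: finite_linorder_max_induct)
  case empty
  then show ?case by simp
next
  case (insert b' T)
  interpret M: prob_space M by fact
  note A(1)[measurable]
  have P[measurable]: "hits n (A t) \<in> borel_measurable P" for t
    unfolding P_def by measurable
  define F where "F T = {\<omega> \<in> space P. \<exists>t\<in>T. c * (hits n (A t) \<omega> / measure M (A t)) \<ge> y}" for T
  have [measurable]: "F S \<in> sets P" if "finite S" for S
    unfolding F_def using that by measurable
  have [measurable]: "F T \<in> sets P" "F (insert b' T) \<in> sets P" using insert(1) by auto
  have bb: "b' \<le> b" using insert.prems by auto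
  have sub: "A b \<subseteq> A b'" using A(2) bb by (auto simp: antimono_def)
  have le: "measure M (A b) \<le> measure M (A b')" by (rule M.finite_measure_mono[OF sub]) simp
  define u where "u = measure M (A b)"
  define v where "v = measure M (A b')"
  have uv: "0 < u" "u \<le> v" using le insert.prems by (auto simp: u_def v_def)
  have FF: "F T \<subseteq> F (insert b' T)" by (auto simp: F_def)
  have ih: "ennreal (exp y) * emeasure P (F T) \<le> (\<integral>\<^sup>+\<omega>. indicator (F T) \<omega> * ennreal (exp (c / v * hits n (A b') \<omega>)) \<partial>P)"
    unfolding F_def v_def by (rule insert.IH) (use insert(2) uv in \<open>auto simp: v_def intro: less_imp_le\<close>)
  \<comment> \<open>On the part of the event that \<open>b'\<close> adds, the exponential at \<open>b'\<close> is at least \<open>exp y\<close>.\<close>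
  have "ennreal (exp y) * emeasure P (F (insert b' T))
      = ennreal (exp y) * emeasure P (F T) + ennreal (exp y) * emeasure P (F (insert b' T) - F T)"
    by (subst distrib_left[symmetric], subst plus_emeasure) (use FF in \<open>auto simp: Un_absorb1\<close>)
  also have "\<dots> \<le> (\<integral>\<^sup>+\<omega>. indicator (F T) \<omega> * ennreal (exp (c / v * hits n (A b') \<omega>)) \<partial>P)
       + (\<integral>\<^sup>+\<omega>. indicator (F (insert b' T) - F T) \<omega> * ennreal (exp (c / v * hits n (A b') \<omega>)) \<partial>P)"
  proof (intro add_mono ih)
    have "ennreal (exp y) * emeasure P (F (insert b' T) - F T)
       = (\<integral>\<^sup>+\<omega>. indicator (F (insert b' T) - F T) \<omega> * ennreal (exp y) \<partial>P)"
      by (subst nn_integral_multc) (auto simp: mult.commute)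
    also have "\<dots> \<le> (\<integral>\<^sup>+\<omega>. indicator (F (insert b' T) - F T) \<omega> * ennreal (exp (c / v * hits n (A b') \<omega>)) \<partial>P)"
      by (intro nn_integral_mono) (auto simp: F_def v_def split: split_indicator)
    finally show "ennreal (exp y) * emeasure P (F (insert b' T) - F T)
       \<le> (\<integral>\<^sup>+\<omega>. indicator (F (insert b' T) - F T) \<omega> * ennreal (exp (c / v * hits n (A b') \<omega>)) \<partial>P)" .
  qed
  also have "\<dots> = (\<integral>\<^sup>+\<omega>. indicator (F (insert b' T)) \<omega> * ennreal (exp (c / v * hits n (A b') \<omega>)) \<partial>P)"
    by (subst nn_integral_add[symmetric]) (use FF in \<open>auto intro!: nn_integral_cong split: split_indicator\<close>)
  also have "\<dots> \<le> (\<integral>\<^sup>+\<omega>. indicator (F (insert b' T)) \<omega> * ennreal (exp (c / u * hits n (A b) \<omega>)) \<partial>P)"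
    unfolding exp_hits P_def
  proof (rule nn_integral_PiM_redistribute[OF M, where B = "A b'"])
    show "indicator (F (insert b' T)) \<in> borel_measurable (PiM {..<n} (\<lambda>_. M))"
      unfolding P_def[symmetric] by measurable
    have "(\<integral>\<^sup>+x. indicator (A b') x * ennreal (exp (c / v * indicator (A b') x)) \<partial>M)
        = (\<integral>\<^sup>+x. ennreal (exp (c / v)) * indicator (A b') x \<partial>M)"
      by (intro nn_integral_cong) (auto split: split_indicator)
    also have "\<dots> = ennreal (v * exp (c / v))"
      by (subst nn_integral_cmult) (simp_all add: M.emeasure_eq_measure v_def ennreal_mult mult.commute)
    also have "\<dots> \<le> ennreal ((v - u) + u * exp (c / u))"
      using exp_jensen_ratio[OF uv] by (rule ennreal_leI)
    also have "\<dots> = emeasure M (A b' - A b) + ennreal (exp (c / u)) * emeasure M (A b)"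
    proof -
      have "emeasure M (A b' - A b) = ennreal (v - u)"
        using sub by (simp add: M.emeasure_eq_measure M.finite_measure_Diff u_def v_def)
      then show ?thesis using uv
        by (subst ennreal_plus) (auto simp: M.emeasure_eq_measure u_def[symmetric] ennreal_mult mult.commute)
    qed
    also have "\<dots> = (\<integral>\<^sup>+x. indicator (A b' - A b) x + ennreal (exp (c / u)) * indicator (A b) x \<partial>M)"
      by (subst nn_integral_add) (auto simp: nn_integral_cmult)
    also have "\<dots> = (\<integral>\<^sup>+x. indicator (A b') x * ennreal (exp (c / u * indicator (A b) x)) \<partial>M)"
      by (intro nn_integral_cong) (use sub in \<open>auto split: split_indicator\<close>)
    finally show "(\<integral>\<^sup>+x. indicator (A b') x * ennreal (exp (c / v * indicator (A b') x)) \<partial>M)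
      \<le> (\<integral>\<^sup>+x. indicator (A b') x * ennreal (exp (c / u * indicator (A b) x)) \<partial>M)" .
  next
    fix \<omega> \<omega>' assume sp: "\<omega> \<in> space (PiM {..<n} (\<lambda>_. M))" "\<omega>' \<in> space (PiM {..<n} (\<lambda>_. M))"
      and e: "\<And>i. i \<in> {..<n} \<Longrightarrow> \<omega> i = \<omega>' i \<or> \<omega> i \<in> A b' \<and> \<omega>' i \<in> A b'"
    have "hits n (A t) \<omega> = hits n (A t) \<omega>'" if t: "t \<in> insert b' T" for t
    proof -
      have "A b' \<subseteq> A t" using A(2) t insert(2) by (auto simp: antimono_def intro: less_imp_le)
      then have "indicator (A t) (\<omega> i) = (indicator (A t) (\<omega>' i) :: real)" if "i \<in> {..<n}" for i
        using e[OF that] by (auto simp: indicator_def)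
      then show ?thesis unfolding hits_def by (rule sum.cong[OF refl])
    qed
    then show "indicator (F (insert b' T)) \<omega> = (indicator (F (insert b' T)) \<omega>' :: ennreal)"
      using sp by (auto simp: F_def P_def split: split_indicator)
  qed (use sub in \<open>auto simp: indicator_def\<close>)
  finally show ?case unfolding F_def u_def .
qed

lemma doob_chain_prob:
  fixes A :: "real \<Rightarrow> 'a set" and n :: nat and c y :: real
  assumes M: "prob_space M" and A: "\<And>t. A t \<in> sets M" "antimono A"
    and T: "finite T" "\<And>t. t \<in> T \<Longrightarrow> t \<le> b" and b: "measure M (A b) > 0"
  defines "P \<equiv> PiM {..<n} (\<lambda>_. M)"
  shows "measure P {\<omega> \<in> space P. \<exists>t\<in>T. c * (hits n (A t) \<omega> / measure M (A t)) \<ge> y}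
     \<le> exp (- y) * (1 - measure M (A b) + measure M (A b) * exp (c / measure M (A b))) ^ n"
proof -
  interpret M: prob_space M by fact
  interpret P: prob_space P unfolding P_def by (rule prob_PiM_const[OF M])
  define E where "E = {\<omega> \<in> space P. \<exists>t\<in>T. c * (hits n (A t) \<omega> / measure M (A t)) \<ge> y}"
  have nn: "0 \<le> 1 - measure M (A b) + measure M (A b) * exp (c / measure M (A b))"
    by (intro add_nonneg_nonneg mult_nonneg_nonneg) auto
  have "ennreal (exp y * measure P E) = ennreal (exp y) * emeasure P E"
    by (simp add: P.emeasure_eq_measure ennreal_mult)
  also have "\<dots> \<le> (\<integral>\<^sup>+\<omega>. indicator E \<omega> * ennreal (exp (c / measure M (A b) * hits n (A b) \<omega>)) \<partial>P)"
    unfolding E_def P_def by (rule doob_chain[OF M A T b])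
  also have "\<dots> \<le> (\<integral>\<^sup>+\<omega>. ennreal (exp (c / measure M (A b) * hits n (A b) \<omega>)) \<partial>P)"
    by (intro nn_integral_mono) (auto split: split_indicator)
  also have "\<dots> = ennreal ((1 - measure M (A b) + measure M (A b) * exp (c / measure M (A b))) ^ n)"
    unfolding P_def by (rule nn_integral_exp_hits[OF M A(1)])
  finally have "exp y * measure P E \<le> (1 - measure M (A b) + measure M (A b) * exp (c / measure M (A b))) ^ n"
    using nn by (simp add: ennreal_le_iff)
  then show ?thesis unfolding E_def by (simp add: exp_minus field_simps)
qed

section \<open>Deviations on one block of a chain\<close>

text \<open>
  On a block of sets whose masses lie in \<open>{a..b}\<close> the standardised deviation exceeds \<open>lam\<close>
  only if the martingale \<open>hits / mass\<close> deviates from \<open>n\<close> by \<open>lam * sqrt (n * (1 - b) / b)\<close>,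
  the smallest of the boundaries in the block. Doob's inequality moves the question to the
  smallest set, and \<open>g\<close> is the exponential parameter, measured in units of \<open>1 / a\<close>. The two
  signs of the deviation cost the factor 2.
\<close>
lemma hc_block:
  fixes A :: "real \<Rightarrow> 'a set" and n :: nat and a b g lam :: real
  assumes M: "prob_space M" and A: "\<And>t. A t \<in> sets M" "antimono A"
    and T: "finite T" "\<And>t. t \<in> T \<Longrightarrow> a \<le> measure M (A t) \<and> measure M (A t) \<le> b"
    and ab: "0 < a" "b < 1" and g: "0 < g" "g \<le> 1" and lam: "0 \<le> lam"
  defines "P \<equiv> PiM {..<n} (\<lambda>_. M)"
  shows "measure P {\<omega> \<in> space P. \<exists>t\<in>T. lam * sqrt (n * measure M (A t) * (1 - measure M (A t)))
             < \<bar>hits n (A t) \<omega> - n * measure M (A t)\<bar>}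
     \<le> 2 * exp (n * a * (1 - a) * (g\<^sup>2 / 2 * (1 + g)) - g * lam * (a * sqrt (n * (1 - b) / b)))"
    (is "measure P ?E \<le> 2 * ?R")
proof (cases "T = {}")
  case False
  interpret M: prob_space M by fact
  interpret P: prob_space P unfolding P_def by (rule prob_PiM_const[OF M])
  note A(1)[measurable]
  have [measurable]: "hits n (A t) \<in> borel_measurable P" for t
    unfolding P_def by measurable
  define u where "u t = measure M (A t)" for t
  have u: "a \<le> u t" "u t \<le> b" "0 < u t" "u t < 1" if "t \<in> T" for t
    using T(2)[OF that] ab by (auto simp: u_def)
  define h where "h = lam * sqrt (n * (1 - b) / b)"
  define \<beta> where "\<beta> = Max T"
  have \<beta>: "\<beta> \<in> T" "\<And>t. t \<in> T \<Longrightarrow> t \<le> \<beta>" using T(1) False by (auto simp: \<beta>_def)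
  define v where "v = u \<beta>"
  have v: "a \<le> v" "v \<le> b" "0 < v" "v < 1" using u[OF \<beta>(1)] by (auto simp: v_def)
  \<comment> \<open>The sign of the deviation is \<open>s\<close>; after division by the mass both signs become upper exceedances.\<close>
  define E where "E s = {\<omega> \<in> space P. \<exists>t\<in>T. s * g * a * (hits n (A t) \<omega> / u t) \<ge> g * a * (s * n + h)}" for s :: real
  have [measurable]: "E s \<in> sets P" for s unfolding E_def using T(1) by measurable
  have bound: "measure P (E s) \<le> ?R" if s: "\<bar>s\<bar> = 1" for s
  proof -
    \<comment> \<open>The exponent per point of the smallest set; \<open>a \<le> v\<close> keeps it within the range of the moment bound.\<close>
    define k where "k = s * g * a / v"
    have s2: "s\<^sup>2 = 1" using s by (metis power2_abs one_power2)
    have kabs: "\<bar>k\<bar> = g * (a / v)" using s g ab v by (simp add: k_def abs_mult)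
    have "a / v \<le> 1" using v by simp
    then have kg: "\<bar>k\<bar> \<le> g" unfolding kabs using g mult_left_le[of "a / v" g] by simp
    have k1: "\<bar>k\<bar> \<le> 1" using kg g by linarith
    have "measure P (E s) \<le> exp (- (g * a * (s * n + h))) * (1 - v + v * exp (s * g * a / v)) ^ n"
      unfolding E_def P_def v_def u_def
      using doob_chain_prob[OF M A T(1) \<beta>(2), of n "g * a * (s * n + h)" "s * g * a"] v
      by (simp add: u_def v_def)
    also have "\<dots> = exp (- g * a * h) * (exp (- k * v) * (1 - v + v * exp k)) ^ n"
    proof -
      have kv: "k * v = s * g * a" using v by (simp add: k_def)
      have "exp (- (g * a * (s * n + h))) = exp (- g * a * h) * exp (- k * v) ^ n"
        by (simp add: kv exp_of_nat_mult[symmetric] exp_add[symmetric] algebra_simps)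
      then show ?thesis by (simp add: k_def power_mult_distrib)
    qed
    also have "\<dots> \<le> exp (- g * a * h) * exp (v * (1 - v) * (k\<^sup>2 / 2 * (1 + \<bar>k\<bar>))) ^ n"
      using v k1 by (intro mult_left_mono power_mono bernoulli_mgf_bound mult_nonneg_nonneg add_nonneg_nonneg) auto
    also have "\<dots> = exp (n * (v * (1 - v) * (k\<^sup>2 / 2 * (1 + \<bar>k\<bar>))) - g * a * h)"
      by (simp only: exp_of_nat_mult[symmetric] exp_add[symmetric]) (simp add: algebra_simps)
    also have "\<dots> \<le> ?R"
    proof -
      have "v * (1 - v) * k\<^sup>2 = g\<^sup>2 * (a\<^sup>2 * (1 - v) / v)"
        using v s2 by (simp add: k_def power_mult_distrib power_divide) (simp add: power2_eq_square field_simps)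
      also have "a\<^sup>2 * (1 - v) / v \<le> a * (1 - a)"
      proof -
        have "a * (1 - v) \<le> v * (1 - a)" using v by (simp add: algebra_simps)
        then have "a * (a * (1 - v)) \<le> a * (v * (1 - a))" using ab by (intro mult_left_mono) auto
        then show ?thesis using v by (simp add: field_simps power2_eq_square)
      qed
      finally have 1: "v * (1 - v) * k\<^sup>2 \<le> g\<^sup>2 * (a * (1 - a))" by (simp add: mult_left_mono)
      have "v * (1 - v) * k\<^sup>2 * (1 + \<bar>k\<bar>) \<le> g\<^sup>2 * (a * (1 - a)) * (1 + g)"
        by (rule mult_mono[OF 1]) (use kg g ab v in auto)
      then have e0: "n * (v * (1 - v) * k\<^sup>2 * (1 + \<bar>k\<bar>)) \<le> n * (g\<^sup>2 * (a * (1 - a)) * (1 + g))"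
        by (intro mult_left_mono) auto
      have e1: "n * (v * (1 - v) * (k\<^sup>2 / 2 * (1 + \<bar>k\<bar>))) = n * (v * (1 - v) * k\<^sup>2 * (1 + \<bar>k\<bar>)) / 2"
        by (simp only: times_divide_eq_right times_divide_eq_left mult.assoc)
      have e2: "n * a * (1 - a) * (g\<^sup>2 / 2 * (1 + g)) = n * (g\<^sup>2 * (a * (1 - a)) * (1 + g)) / 2"
        by (simp add: mult.left_commute mult.commute)
      have e3: "g * a * h = g * lam * (a * sqrt (n * (1 - b) / b))"
        unfolding h_def by (simp only: mult.assoc mult.left_commute)
      show ?thesis unfolding e1 e2 e3 using e0 by simp
    qed
    finally show ?thesis .
  qed
  have "?E \<subseteq> E 1 \<union> E (-1)"
  proof
    fix \<omega> assume "\<omega> \<in> ?E"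
    then obtain t where t: "t \<in> T" and w: "\<omega> \<in> space P"
      and l: "lam * sqrt (n * u t * (1 - u t)) < \<bar>hits n (A t) \<omega> - n * u t\<bar>"
      by (auto simp: u_def)
    define U where "U = u t"
    have U: "0 < U" "U < 1" "U \<le> b" using u[OF t] by (auto simp: U_def)
    define N where "N = hits n (A t) \<omega>"
    have "(1 - b) / b * U\<^sup>2 \<le> U * (1 - U)"
    proof -
      have "(1 - b) * U \<le> b * (1 - U)" using U by (simp add: algebra_simps)
      then have "U * ((1 - b) * U) \<le> U * (b * (1 - U))" using U by (intro mult_left_mono) auto
      then show ?thesis using U by (simp add: field_simps power2_eq_square)
    qed
    then have "n * ((1 - b) / b * U\<^sup>2) \<le> n * (U * (1 - U))" by (intro mult_left_mono) auto
    then have "sqrt (n * (1 - b) / b * U\<^sup>2) \<le> sqrt (n * U * (1 - U))"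
      by (intro real_sqrt_le_mono) (simp add: ac_simps)
    then have "sqrt (n * (1 - b) / b) * U \<le> sqrt (n * U * (1 - U))"
      using U by (simp only: real_sqrt_mult real_sqrt_abs abs_of_pos)
    then have "h * U \<le> lam * sqrt (n * U * (1 - U))"
      unfolding h_def using lam by (simp add: mult_left_mono mult.assoc)
    with l have "h * U < \<bar>N - n * U\<bar>" by (simp add: U_def N_def)
    then have "h * U \<le> 1 * (N - n * U) \<or> h * U \<le> (-1) * (N - n * U)"
      by (cases "0 \<le> N - n * U") auto
    then obtain s :: real where s: "s = 1 \<or> s = -1" "h * U \<le> s * (N - n * U)" by blast
    have "s * n + h \<le> s * (N / U)" using s(2) U by (simp add: field_simps)
    then have "g * a * (s * n + h) \<le> g * a * (s * (N / U))"
      using g ab by (intro mult_left_mono) auto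
    then have "\<omega> \<in> E s" unfolding E_def using t w by (auto simp: U_def N_def ac_simps)
    then show "\<omega> \<in> E 1 \<union> E (-1)" using s(1) by auto
  qed
  then have "measure P ?E \<le> measure P (E 1 \<union> E (-1))" by (intro P.finite_measure_mono) auto
  also have "\<dots> \<le> measure P (E 1) + measure P (E (-1))" by (intro measure_Un_le) auto
  also have "\<dots> \<le> ?R + ?R" by (intro add_mono bound) auto
  finally show ?thesis by simp
qed simp

lemma hits_nonneg: "0 \<le> hits n A \<omega>"
  unfolding hits_def by (intro sum_nonneg) auto

lemma hits_mono: "A \<subseteq> B \<Longrightarrow> hits n A \<omega> \<le> hits n B \<omega>"
  unfolding hits_def by (intro sum_mono) (auto simp: indicator_def)

lemma nn_integral_hits:
  assumes "prob_space M" and [measurable]: "A \<in> sets M"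
  shows "(\<integral>\<^sup>+\<omega>. ennreal (hits n A \<omega>) \<partial>PiM {..<n} (\<lambda>_. M)) = ennreal (n * measure M A)"
proof -
  interpret M: prob_space M by fact
  interpret P: product_prob_space "\<lambda>_. M" "{..<n}" by standard
  have "(\<integral>\<^sup>+\<omega>. ennreal (hits n A \<omega>) \<partial>PiM {..<n} (\<lambda>_. M))
     = (\<integral>\<^sup>+\<omega>. (\<Sum>i<n. indicator A (\<omega> i)) \<partial>PiM {..<n} (\<lambda>_. M))"
    unfolding hits_def by (intro nn_integral_cong) (simp flip: sum_ennreal ennreal_indicator)
  also have "\<dots> = (\<Sum>i<n. \<integral>\<^sup>+\<omega>. indicator A (\<omega> i) \<partial>PiM {..<n} (\<lambda>_. M))"
    by (rule nn_integral_sum) (auto intro!: measurable_compose[OF measurable_component_singleton borel_measurable_indicator])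
  also have "\<dots> = (\<Sum>i<n. emeasure M A)"
  proof (rule sum.cong[OF refl])
    fix i assume i: "i \<in> {..<n}"
    have "emeasure M A = emeasure (distr (PiM {..<n} (\<lambda>_. M)) M (\<lambda>\<omega>. \<omega> i)) A"
      using P.PiM_component[OF i] by simp
    also have "\<dots> = (\<integral>\<^sup>+x. indicator A x \<partial>distr (PiM {..<n} (\<lambda>_. M)) M (\<lambda>\<omega>. \<omega> i))"
      by simp
    also have "\<dots> = (\<integral>\<^sup>+\<omega>. indicator A (\<omega> i) \<partial>PiM {..<n} (\<lambda>_. M))"
      by (rule nn_integral_distr) (use i in auto)
    finally show "(\<integral>\<^sup>+\<omega>. indicator A (\<omega> i) \<partial>PiM {..<n} (\<lambda>_. M)) = emeasure M A" ..
  qed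
  also have "\<dots> = ennreal (n * measure M A)"
    by (simp add: M.emeasure_eq_measure ennreal_mult ennreal_of_nat_eq_real_of_nat)
  finally show ?thesis .
qed

text \<open>
  The largest of these sets expects at most \<open>1 / lam\<close> points. If it contains none, every
  deviation in the chain equals \<open>n\<close> times the mass, which is below its boundary.
\<close>
lemma hc_tiny:
  fixes A :: "real \<Rightarrow> 'a set" and n :: nat and lam :: real
  assumes M: "prob_space M" and A: "\<And>t. A t \<in> sets M" "antimono A"
    and T: "finite T" "\<And>t. t \<in> T \<Longrightarrow> n * measure M (A t) \<le> 1 / lam"
    and lam: "2 \<le> lam" and n: "1 \<le> n"
  defines "P \<equiv> PiM {..<n} (\<lambda>_. M)"
  shows "measure P {\<omega> \<in> space P. \<exists>t\<in>T. lam * sqrt (n * measure M (A t) * (1 - measure M (A t)))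
             < \<bar>hits n (A t) \<omega> - n * measure M (A t)\<bar>} \<le> 1 / lam"
    (is "measure P ?E \<le> _")
proof (cases "T = {}")
  case True then show ?thesis using lam by simp
next
  case False
  interpret M: prob_space M by fact
  interpret P: prob_space P unfolding P_def by (rule prob_PiM_const[OF M])
  note A(1)[measurable]
  have [measurable]: "hits n (A t) \<in> borel_measurable P" for t
    unfolding P_def by measurable
  define \<beta> where "\<beta> = Min T"
  have \<beta>: "\<beta> \<in> T" "\<And>t. t \<in> T \<Longrightarrow> \<beta> \<le> t" using T(1) False by (auto simp: \<beta>_def)
  have "?E \<subseteq> {\<omega> \<in> space P. 1 \<le> hits n (A \<beta>) \<omega>}"
  proof
    fix \<omega> assume "\<omega> \<in> ?E"
    then obtain t where t: "t \<in> T" and w: "\<omega> \<in> space P"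
      and l: "lam * sqrt (n * measure M (A t) * (1 - measure M (A t))) < \<bar>hits n (A t) \<omega> - n * measure M (A t)\<bar>"
      by auto
    define u where "u = measure M (A t)"
    have u: "0 \<le> u" "n * u \<le> 1 / lam" using T(2)[OF t] by (auto simp: u_def)
    have l2: "1 / lam \<le> 1 / 2" using lam by (simp add: field_simps)
    have "u \<le> n * u" using n u(1) by (simp add: mult_le_cancel_right1)
    then have u2: "u \<le> 1/2" using u l2 by linarith
    have "n * u \<le> lam * sqrt (n * u * (1 - u))"
    proof -
      have "lam\<^sup>2 * (1 - u) \<ge> 2\<^sup>2 * (1/2)" using lam u2 by (intro mult_mono power_mono) auto
      then have "n * u \<le> lam\<^sup>2 * (1 - u)" using u l2 by simp
      then have "(n * u) * (n * u) \<le> (n * u) * (lam\<^sup>2 * (1 - u))" using u by (intro mult_left_mono) auto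
      then have "(n * u)\<^sup>2 \<le> lam\<^sup>2 * (n * u * (1 - u))" by (simp add: power2_eq_square ac_simps)
      then have "sqrt ((n * u)\<^sup>2) \<le> sqrt (lam\<^sup>2 * (n * u * (1 - u)))" by (rule real_sqrt_le_mono)
      then show ?thesis using u lam by (simp only: real_sqrt_mult real_sqrt_abs)
    qed
    with l have "hits n (A t) \<omega> \<noteq> 0" using u by (auto simp: u_def)
    moreover have "hits n (A t) \<omega> \<le> hits n (A \<beta>) \<omega>"
      using A(2) \<beta>(2)[OF t] by (intro hits_mono) (auto simp: antimono_def)
    ultimately have "hits n (A \<beta>) \<omega> > 0" using hits_nonneg[of n "A t" \<omega>] by linarith
    then obtain i where "i < n" "\<omega> i \<in> A \<beta>"
      unfolding hits_def by (metis indicator_simps(2) lessThan_iff order_less_irrefl sum.neutral)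
    then have "1 \<le> hits n (A \<beta>) \<omega>"
      unfolding hits_def by (subst sum.remove[of _ i]) (auto intro!: sum_nonneg)
    then show "\<omega> \<in> {\<omega> \<in> space P. 1 \<le> hits n (A \<beta>) \<omega>}" using w by auto
  qed
  then have "measure P ?E \<le> measure P {\<omega> \<in> space P. 1 \<le> hits n (A \<beta>) \<omega>}"
    by (intro P.finite_measure_mono) auto
  also have "\<dots> \<le> n * measure M (A \<beta>)"
  proof -
    have "emeasure P {\<omega> \<in> space P. 1 \<le> hits n (A \<beta>) \<omega>} \<le> (\<integral>\<^sup>+\<omega>. ennreal (hits n (A \<beta>) \<omega>) \<partial>P)"
    proof -
      have "emeasure P {\<omega> \<in> space P. 1 \<le> hits n (A \<beta>) \<omega>}
          = (\<integral>\<^sup>+\<omega>. indicator {\<omega> \<in> space P. 1 \<le> hits n (A \<beta>) \<omega>} \<omega> \<partial>P)"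
        by simp
      also have "\<dots> \<le> (\<integral>\<^sup>+\<omega>. ennreal (hits n (A \<beta>) \<omega>) \<partial>P)"
        by (intro nn_integral_mono) (auto split: split_indicator simp flip: ennreal_1 intro!: ennreal_leI)
      finally show ?thesis .
    qed
    also have "\<dots> = ennreal (n * measure M (A \<beta>))"
      unfolding P_def by (rule nn_integral_hits[OF M A(1)])
    finally show ?thesis by (simp add: P.emeasure_eq_measure)
  qed
  also have "\<dots> \<le> 1 / lam" using T(2)[OF \<beta>(1)] .
  finally show ?thesis .
qed

section \<open>The standardised empirical process\<close>

text \<open>
  Counts the blocks of a geometric grid.
\<close>
lemma card_powers_below:
  fixes q X :: real assumes "1 < q" "1 \<le> X"
  shows "finite {j. q ^ j < X}" "real (card {j. q ^ j < X}) \<le> ln X / ln q + 1"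
proof -
  have sub: "{j. q ^ j < X} \<subseteq> {..nat \<lfloor>ln X / ln q\<rfloor>}"
  proof
    fix j assume "j \<in> {j. q ^ j < X}"
    then have "ln (q ^ j) < ln X" using assms by (subst ln_less_cancel_iff) auto
    then have "real j * ln q < ln X" using assms by (simp add: ln_realpow)
    then have "real j < ln X / ln q" using assms by (simp add: field_simps)
    then show "j \<in> {..nat \<lfloor>ln X / ln q\<rfloor>}" by (simp add: le_nat_floor)
  qed
  show "finite {j. q ^ j < X}" using finite_subset[OF sub] by simp
  have "real (card {j. q ^ j < X}) \<le> real (card {..nat \<lfloor>ln X / ln q\<rfloor>})"
    using card_mono[OF _ sub] by simp
  also have "\<dots> \<le> ln X / ln q + 1"
    using assms by (simp add: ge_one_powr_ge_zero)
  finally show "real (card {j. q ^ j < X}) \<le> ln X / ln q + 1" .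
qed

text \<open>
  The three terms bound, in this order, the sets expecting less than \<open>1 / lam\<close> points, the
  blocks where the Gaussian tail with the sharp exponent \<open>lam\<^sup>2 / 2\<close> is available (about
  \<open>ln n\<close> of them), and the blocks expecting fewer than about \<open>lam ^ 4\<close> points, where the tail
  is only Poissonian but where there are only of order \<open>ln lam\<close> blocks.
\<close>
definition hc_half_err :: "real \<Rightarrow> real \<Rightarrow> real \<Rightarrow> real" where
  "hc_half_err \<epsilon> n lam = 1 / lam
     + (ln (lam * n) / ln (1 + \<epsilon>) + 1) * (2 * exp (- (lam\<^sup>2 * ((1 - \<epsilon>) / (1 + \<epsilon>)) / 2 * (1 - 1 / lam))))
     + (ln (2 * lam ^ 5) / ln (1 + \<epsilon>) + 1) * (2 * exp (- (sqrt lam / 8)))"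

text \<open>
  The masses are cut along the grid \<open>x j = (1 + \<epsilon>) ^ j / (lam * n)\<close>. The number of blocks is
  logarithmic in \<open>n\<close>, and a block of relative width \<open>\<epsilon>\<close> loses only the factor
  \<open>(1 - \<epsilon>) / (1 + \<epsilon>)\<close> in the exponent. This is why \<open>sqrt (2 * ln (ln n))\<close> is the right order
  of the supremum: one block exceeds \<open>lam\<close> with probability about \<open>exp (- lam\<^sup>2 / 2)\<close>.
\<close>
lemma hc_chain_half:
  fixes A :: "real \<Rightarrow> 'a set" and n :: nat and lam \<epsilon> :: real
  assumes M: "prob_space M" and A: "\<And>t. A t \<in> sets M" "antimono A"
    and T: "finite T" "\<And>t. t \<in> T \<Longrightarrow> measure M (A t) \<le> 1 / 2"
    and lam: "2 \<le> lam" and n: "1 \<le> n" and \<epsilon>: "0 < \<epsilon>" "\<epsilon> \<le> 1 / 2"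
  defines "P \<equiv> PiM {..<n} (\<lambda>_. M)"
  shows "measure P {\<omega> \<in> space P. \<exists>t\<in>T. lam * sqrt (n * measure M (A t) * (1 - measure M (A t)))
             < \<bar>hits n (A t) \<omega> - n * measure M (A t)\<bar>} \<le> hc_half_err \<epsilon> n lam"
proof -
  interpret M: prob_space M by fact
  interpret P: prob_space P unfolding P_def by (rule prob_PiM_const[OF M])
  note A(1)[measurable]
  have [measurable]: "hits n (A t) \<in> borel_measurable P" for t
    unfolding P_def by measurable
  define u where "u t = measure M (A t)" for t
  define E where "E S = {\<omega> \<in> space P. \<exists>t\<in>S. lam * sqrt (n * u t * (1 - u t))
             < \<bar>hits n (A t) \<omega> - n * u t\<bar>}" for S
  have Em [measurable]: "E S \<in> sets P" if "finite S" for S unfolding E_def using that by measurable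
  define x where "x j = (1 + \<epsilon>) ^ j / (lam * n)" for j
  have x0: "0 < x j" for j using \<epsilon> lam n by (auto simp: x_def)
  have xS: "x (Suc j) = (1 + \<epsilon>) * x j" for j by (simp add: x_def)
  define w where "w = sqrt ((1 - \<epsilon>) / (1 + \<epsilon>))"
  have w2: "w\<^sup>2 = (1 - \<epsilon>) / (1 + \<epsilon>)" using \<epsilon> by (simp add: w_def)
  have w1: "w \<le> 1" unfolding w_def using \<epsilon> by simp
  have w12: "1 / 2 \<le> w" unfolding w_def by (rule real_le_rsqrt) (use \<epsilon> in \<open>simp add: field_simps power2_eq_square\<close>)
  have w0: "0 < w" using w12 by linarith
  define S0 where "S0 = {t\<in>T. n * u t \<le> 1 / lam}"
  \<comment> \<open>\<open>E (S j)\<close> is an exceedance within block \<open>j\<close>; only blocks starting below one half occur.\<close>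
  define S where "S j = {t\<in>T. x j \<le> u t \<and> u t \<le> x (Suc j)}" for j
  have fin: "finite S0" "finite (S j)" for j using T(1) by (auto simp: S0_def S_def)
  define J where "J = {j. x j \<le> 1/2}"
  define JB where "JB = {j. (1+\<epsilon>)^j < 2 * lam^5}"
  have J_sub: "J \<subseteq> {j. (1+\<epsilon>)^j < lam * n}"
  proof
    fix j assume "j \<in> J"
    then have "(1+\<epsilon>)^j \<le> lam * n / 2" using lam n by (simp add: J_def x_def field_simps)
    moreover have "0 < lam * n" using lam n by simp
    ultimately show "j \<in> {j. (1+\<epsilon>)^j < lam * n}" by simp
  qed
  have lamn: "1 \<le> lam * n" using lam n by (metis mult_mono' mult_1 of_nat_1 of_nat_le_iff one_le_numeral order_trans zero_le_one)
  have lam5: "1 \<le> 2 * lam^5"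
  proof -
    have "1 \<le> lam ^ 5" using lam by (intro one_le_power) auto
    then show ?thesis by linarith
  qed
  note cJ = card_powers_below[of "1+\<epsilon>" "lam * n", OF _ lamn]
  note cB = card_powers_below[of "1+\<epsilon>" "2 * lam^5", OF _ lam5]
  have finJ: "finite J" using cJ(1) J_sub \<epsilon> by (auto intro: finite_subset)
  have cardJ: "real (card J) \<le> ln (lam * n) / ln (1+\<epsilon>) + 1"
    using card_mono[OF cJ(1) J_sub] cJ(2) \<epsilon> by linarith
  have finB: "finite JB" and cardB: "real (card JB) \<le> ln (2 * lam^5) / ln (1+\<epsilon>) + 1"
    using cB \<epsilon> by (auto simp: JB_def)
  define pA where "pA = 2 * exp (- (lam\<^sup>2 * ((1 - \<epsilon>) / (1 + \<epsilon>)) / 2 * (1 - 1 / lam)))"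
  define pB where "pB = 2 * exp (- (sqrt lam / 8))"
  have block: "measure P (E (S j)) \<le> pA + (if j \<in> JB then pB else 0)" if j: "j \<in> J" for j
  proof -
    define a where "a = x j"
    have a: "0 < a" "a \<le> 1/2" using j x0 by (auto simp: a_def J_def)
    define b where "b = (1 + \<epsilon>) * a"
    have "b \<le> (1 + 1/2) * (1/2)" unfolding b_def using a \<epsilon> by (intro mult_mono) auto
    then have b: "b < 1" by simp
    have b0: "0 < b" using a \<epsilon> by (simp add: b_def)
    define v where "v = n * a * (1 - a)"
    have v0: "0 < v" using a n by (simp add: v_def)
    have key: "w * sqrt v \<le> a * sqrt (n * (1 - b) / b)"
    proof -
      have e: "(1 - \<epsilon>) * (1 - a) \<le> 1 - b" unfolding b_def
        using a \<epsilon> by (simp add: algebra_simps)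
      have "(1 - \<epsilon>) / (1 + \<epsilon>) * v = n * a * ((1 - \<epsilon>) * (1 - a)) / (1 + \<epsilon>)"
        by (simp add: v_def)
      also have "\<dots> \<le> n * a * (1 - b) / (1 + \<epsilon>)"
        using e a \<epsilon> by (intro divide_right_mono mult_left_mono) auto
      also have "\<dots> = a\<^sup>2 * (n * (1 - b) / b)" using a \<epsilon> by (simp add: b_def power2_eq_square)
      finally have "sqrt (w\<^sup>2 * v) \<le> sqrt (a\<^sup>2 * (n * (1 - b) / b))" unfolding w2 by (rule real_sqrt_le_mono)
      then show ?thesis using w0 a by (simp only: real_sqrt_mult real_sqrt_abs abs_of_pos)
    qed
    have gen: "measure P (E (S j)) \<le> 2 * exp (v * (g\<^sup>2 / 2 * (1 + g)) - g * lam * (w * sqrt v))" if g: "0 < g" "g \<le> 1" for g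
    proof -
      have "measure P (E (S j)) \<le> 2 * exp (n * a * (1 - a) * (g\<^sup>2 / 2 * (1 + g)) - g * lam * (a * sqrt (n * (1 - b) / b)))"
        unfolding E_def P_def u_def
        by (rule hc_block[OF M A fin(2)]) (use a b g lam in \<open>auto simp: S_def u_def a_def b_def xS\<close>)
      also have "\<dots> \<le> 2 * exp (v * (g\<^sup>2 / 2 * (1 + g)) - g * lam * (w * sqrt v))"
        unfolding v_def[symmetric] using key g lam by (auto intro!: mult_left_mono)
      finally show ?thesis .
    qed
    show ?thesis
    proof (cases "v \<ge> lam ^ 4")
      case True
      have sv: "lam\<^sup>2 \<le> sqrt v" using True by (intro real_le_rsqrt) (simp add: power_mult[symmetric])
      \<comment> \<open>The minimiser of \<open>v * g\<^sup>2 / 2 - g * lam * w * sqrt v\<close>.\<close>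
      define g where "g = lam * w / sqrt v"
      have sv0: "0 < sqrt v" using v0 by simp
      have "lam * w \<le> lam * 1" using lam w1 by (intro mult_left_mono) auto
      then have "g \<le> lam / sqrt v" unfolding g_def using sv0 by (simp add: divide_right_mono)
      also have "\<dots> \<le> lam / lam\<^sup>2" using sv lam sv0 by (intro divide_left_mono) auto
      finally have gl: "g \<le> 1 / lam" using lam by (simp add: power2_eq_square)
      have l1: "1 / lam \<le> 1" using lam by simp
      have "0 < g" using w0 lam sv0 by (simp add: g_def)
      moreover have "g \<le> 1" using gl l1 by linarith
      ultimately have g: "0 < g" "g \<le> 1" by auto
      have "v * g\<^sup>2 = lam\<^sup>2 * w\<^sup>2" using v0 by (simp add: g_def power_divide power_mult_distrib)
      moreover have "g * lam * (w * sqrt v) = lam\<^sup>2 * w\<^sup>2" using v0 by (simp add: g_def power2_eq_square)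
      ultimately have "v * (g\<^sup>2 / 2 * (1 + g)) - g * lam * (w * sqrt v) = - (lam\<^sup>2 * w\<^sup>2 / 2 * (1 - g))"
        by (simp add: algebra_simps) (simp add: field_simps)
      also have "\<dots> \<le> - (lam\<^sup>2 * w\<^sup>2 / 2 * (1 - 1 / lam))" using gl by (auto intro!: mult_left_mono)
      finally have "measure P (E (S j)) \<le> pA"
        using gen[OF g] unfolding pA_def w2 by (meson exp_le_cancel_iff mult_left_mono order_trans zero_le_numeral)
      moreover have "0 \<le> pB" by (simp add: pB_def)
      ultimately show ?thesis by auto
    next
      case False
      have "n * a * (1/2) \<le> v" unfolding v_def using a by (intro mult_left_mono) auto
      then have "n * a < 2 * lam^4" using False by linarith
      then have "lam * (n * a) < lam * (2 * lam^4)" using lam by (intro mult_strict_left_mono) auto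
      also have "lam * (n * a) = (1 + \<epsilon>) ^ j" using lam n by (simp add: a_def x_def)
      finally have jB: "j \<in> JB" by (simp add: JB_def numeral_eq_Suc)
      have "1 \<le> (1 + \<epsilon>) ^ j" using \<epsilon> by (intro one_le_power) auto
      then have "1 / lam \<le> n * a" using lam n by (simp add: a_def x_def field_simps)
      then have vl: "1 / (2 * lam) \<le> v" using \<open>n * a * (1/2) \<le> v\<close> by simp
      \<comment> \<open>Half the Gaussian minimiser, capped at one because the moment bound holds only up to there.\<close>
      define g where "g = min 1 (lam * w / (2 * sqrt v))"
      have sv0: "0 < sqrt v" using v0 by simp
      have g: "0 < g" "g \<le> 1" using lam w0 sv0 by (auto simp: g_def)
      have "g \<le> lam * w / (2 * sqrt v)" by (simp add: g_def)
      then have "2 * g * sqrt v \<le> lam * w" using sv0 by (simp add: field_simps)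
      then have "g * sqrt v * (2 * g * sqrt v) \<le> g * sqrt v * (lam * w)"
        using g sv0 by (intro mult_left_mono) auto
      then have gv: "v * g\<^sup>2 \<le> g * lam * (w * sqrt v) / 2"
      proof -
        have A: "g * sqrt v * (2 * g * sqrt v) = 2 * (g * g) * (sqrt v * sqrt v)" by (simp only: ac_simps)
        have B: "sqrt v * sqrt v = v" using v0 by simp
        have C: "g * sqrt v * (lam * w) = g * lam * (w * sqrt v)" by (simp only: ac_simps)
        show ?thesis using \<open>g * sqrt v * (2 * g * sqrt v) \<le> g * sqrt v * (lam * w)\<close>
          unfolding A B C by (simp add: power2_eq_square mult.commute)
      qed
      have "v * (g\<^sup>2 / 2 * (1 + g)) \<le> v * g\<^sup>2"
        using g v0 by (auto intro!: mult_left_mono simp: mult_left_le)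
      then have "v * (g\<^sup>2 / 2 * (1 + g)) - g * lam * (w * sqrt v) \<le> - (g * lam * (w * sqrt v) / 2)"
        using gv by linarith
      moreover have "g * lam * (w * sqrt v) / 2 \<ge> sqrt lam / 8"
      proof (cases "g = 1")
        case True
        have "sqrt (lam / 4) \<le> sqrt (lam\<^sup>2 * v)"
        proof (rule real_sqrt_le_mono)
          have "lam\<^sup>2 * (1 / (2 * lam)) \<le> lam\<^sup>2 * v" using vl by (intro mult_left_mono) auto
          then show "lam / 4 \<le> lam\<^sup>2 * v" using lam by (simp add: power2_eq_square)
        qed
        then have "sqrt lam / 2 \<le> lam * sqrt v" using lam by (simp add: real_sqrt_mult real_sqrt_divide)
        then have "(1/2) * (sqrt lam / 2) \<le> w * (lam * sqrt v)" using w12 lam by (intro mult_mono) auto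
        then show ?thesis using True by (simp add: ac_simps)
      next
        case False
        then have "g = lam * w / (2 * sqrt v)" by (auto simp: g_def min_def split: if_splits)
        then have e: "g * lam * (w * sqrt v) / 2 = lam\<^sup>2 * w\<^sup>2 / 4" using sv0 by (simp add: power2_eq_square)
        have "2 * sqrt lam \<le> lam\<^sup>2"
        proof -
          have "sqrt lam \<le> lam" using lam by (intro real_le_lsqrt) (auto simp: power2_eq_square)
          then have "2 * sqrt lam \<le> lam * lam" using lam by (intro mult_mono) auto
          then show ?thesis by (simp add: power2_eq_square)
        qed
        moreover have "(1/2)\<^sup>2 \<le> w\<^sup>2" using w12 by (intro power_mono) auto
        then have "lam\<^sup>2 * (1/2)\<^sup>2 \<le> lam\<^sup>2 * w\<^sup>2" by (intro mult_left_mono) auto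
        ultimately show ?thesis unfolding e by (simp add: power2_eq_square)
      qed
      ultimately have "v * (g\<^sup>2 / 2 * (1 + g)) - g * lam * (w * sqrt v) \<le> - (sqrt lam / 8)" by linarith
      then have "measure P (E (S j)) \<le> pB"
        using gen[OF g] unfolding pB_def by (meson exp_le_cancel_iff mult_left_mono order_trans zero_le_numeral)
      moreover have "0 \<le> pA" by (simp add: pA_def)
      ultimately show ?thesis using jB by simp
    qed
  qed
  have cover: "E T \<subseteq> E S0 \<union> (\<Union>j\<in>J. E (S j))"
  proof
    fix \<omega> assume "\<omega> \<in> E T"
    then obtain t where t: "t \<in> T" "\<omega> \<in> E {t}" by (auto simp: E_def)
    have u2: "u t \<le> 1/2" using T(2)[OF t(1)] by (simp add: u_def)
    show "\<omega> \<in> E S0 \<union> (\<Union>j\<in>J. E (S j))"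
    proof (cases "n * u t \<le> 1 / lam")
      case True
      then show ?thesis using t by (auto simp: E_def S0_def)
    next
      case False
      have x0u: "x 0 \<le> u t" using False lam n by (simp add: x_def field_simps)
      define K where "K = {j. x j \<le> u t}"
      have "K \<subseteq> J" using u2 by (auto simp: K_def J_def)
      then have fK: "finite K" using finJ by (rule finite_subset)
      have "0 \<in> K" using x0u by (simp add: K_def)
      define j where "j = Max K"
      have jK: "j \<in> K" unfolding j_def using fK \<open>0 \<in> K\<close> by (intro Max_in) auto
      have "Suc j \<notin> K"
        using Max_ge[OF fK, of "Suc j"] by (auto simp: j_def)
      then have "t \<in> S j" using jK t(1) by (auto simp: K_def S_def)
      then show ?thesis using jK \<open>K \<subseteq> J\<close> t(2) by (auto simp: E_def)
    qed
  qed
  have tiny: "measure P (E S0) \<le> 1 / lam"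
    unfolding E_def P_def u_def by (rule hc_tiny[OF M A fin(1) _ lam n]) (auto simp: S0_def u_def)
  have "measure P (E T) \<le> measure P (E S0 \<union> (\<Union>j\<in>J. E (S j)))"
    by (rule P.finite_measure_mono[OF cover]) (use fin finJ in auto)
  also have "\<dots> \<le> measure P (E S0) + measure P (\<Union>j\<in>J. E (S j))"
    by (rule measure_Un_le) (use fin finJ in auto)
  also have "\<dots> \<le> 1 / lam + (\<Sum>j\<in>J. measure P (E (S j)))"
    by (intro add_mono tiny measure_UNION_le) (use fin finJ in auto)
  also have "\<dots> \<le> 1 / lam + (\<Sum>j\<in>J. pA + (if j \<in> JB then pB else 0))"
    by (intro add_left_mono sum_mono block)
  also have "\<dots> = 1 / lam + (card J * pA + card (J \<inter> JB) * pB)"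
    using finJ by (simp add: sum.distrib sum.If_cases Int_def)
  also have "\<dots> \<le> 1 / lam + ((ln (lam * n) / ln (1+\<epsilon>) + 1) * pA + (ln (2 * lam^5) / ln (1+\<epsilon>) + 1) * pB)"
  proof (intro add_left_mono add_mono mult_right_mono)
    show "0 \<le> pA" "0 \<le> pB" by (auto simp: pA_def pB_def)
    show "real (card J) \<le> ln (lam * n) / ln (1+\<epsilon>) + 1" by (rule cardJ)
    have "card (J \<inter> JB) \<le> card JB" by (rule card_mono[OF finB]) auto
    then show "real (card (J \<inter> JB)) \<le> ln (2 * lam^5) / ln (1+\<epsilon>) + 1" using cardB by linarith
  qed
  also have "\<dots> = hc_half_err \<epsilon> n lam"
    by (simp add: hc_half_err_def pA_def pB_def)
  finally show ?thesis by (simp add: E_def u_def)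
qed

text \<open>
  Half-lines of mass above one half are handled through their complements: these have the
  same deviation and the same variance, and they form a decreasing chain after reversing the
  index.
\<close>
lemma hc_empirical_finite:
  fixes Q :: "real measure" and n :: nat and lam \<epsilon> :: real
  assumes Q: "prob_space Q" and s: "sets Q = sets borel" and T: "finite T"
    and lam: "2 \<le> lam" and n: "1 \<le> n" and \<epsilon>: "0 < \<epsilon>" "\<epsilon> \<le> 1 / 2"
  defines "P \<equiv> PiM {..<n} (\<lambda>_. Q)"
  shows "measure P {\<omega> \<in> space P. \<exists>t\<in>T. lam * sqrt (n * measure Q {t<..} * (1 - measure Q {t<..}))
             < \<bar>hits n {t<..} \<omega> - n * measure Q {t<..}\<bar>} \<le> 2 * hc_half_err \<epsilon> n lam"
proof -
  interpret Q: prob_space Q by fact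
  interpret P: prob_space P unfolding P_def by (rule prob_PiM_const[OF Q])
  have sp: "space Q = UNIV" using sets_eq_imp_space_eq[OF s] by simp
  define E :: "(real \<Rightarrow> real set) \<Rightarrow> real set \<Rightarrow> (nat \<Rightarrow> real) set" where
    "E A S = {\<omega> \<in> space P. \<exists>t\<in>S. lam * sqrt (n * measure Q (A t) * (1 - measure Q (A t)))
             < \<bar>hits n (A t) \<omega> - n * measure Q (A t)\<bar>}" for A S
  define A1 A2 :: "real \<Rightarrow> real set" where "A1 t = {t<..}" and "A2 t = {..-t}" for t
  have Am: "A1 t \<in> sets Q" "A2 t \<in> sets Q" for t by (auto simp: s A1_def A2_def)
  note [measurable] = Am
  have [measurable]: "hits n (A1 t) \<in> borel_measurable P" "hits n (A2 t) \<in> borel_measurable P" for t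
    unfolding P_def by measurable
  have Em [measurable]: "E A1 S \<in> sets P" "E A2 S \<in> sets P" if "finite S" for S
    unfolding E_def using that by measurable
  define S1 S2 where "S1 = {t\<in>T. measure Q (A1 t) \<le> 1/2}"
    and "S2 = uminus ` {t\<in>T. \<not> measure Q (A1 t) \<le> 1/2}"
  have fin: "finite S1" "finite S2" using T by (auto simp: S1_def S2_def)
  have compl: "measure Q (A2 (- t)) = 1 - measure Q (A1 t)" for t
  proof -
    have "A2 (- t) = space Q - A1 t" by (auto simp: A1_def A2_def sp)
    then show ?thesis using Q.prob_compl[OF Am(1)[of t]] by simp
  qed
  have hc: "hits n (A2 (- t)) \<omega> = n - hits n (A1 t) \<omega>" for t \<omega>
  proof -
    have "hits n (A2 (- t)) \<omega> + hits n (A1 t) \<omega> = (\<Sum>i<n. 1)"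
      unfolding hits_def sum.distrib[symmetric] by (intro sum.cong) (auto simp: A1_def A2_def indicator_def)
    then show ?thesis by simp
  qed
  have "E A1 T \<subseteq> E A1 S1 \<union> E A2 S2"
  proof
    fix \<omega> assume "\<omega> \<in> E A1 T"
    then obtain t where t: "t \<in> T" "\<omega> \<in> E A1 {t}" by (auto simp: E_def)
    show "\<omega> \<in> E A1 S1 \<union> E A2 S2"
    proof (cases "measure Q (A1 t) \<le> 1/2")
      case True then show ?thesis using t by (auto simp: E_def S1_def)
    next
      case False
      have "\<omega> \<in> E A2 {- t}"
        using t(2) by (auto simp: E_def compl hc abs_minus_commute algebra_simps)
      then show ?thesis using t(1) False by (auto simp: E_def S2_def)
    qed
  qed
  then have "measure P (E A1 T) \<le> measure P (E A1 S1 \<union> E A2 S2)"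
    by (rule P.finite_measure_mono) (use fin in auto)
  also have "\<dots> \<le> measure P (E A1 S1) + measure P (E A2 S2)"
    by (rule measure_Un_le) (use fin in auto)
  also have "\<dots> \<le> hc_half_err \<epsilon> n lam + hc_half_err \<epsilon> n lam"
    unfolding E_def P_def
  proof (intro add_mono hc_chain_half[OF Q _ _ _ _ lam n \<epsilon>] fin Am)
    show "antimono A1" "antimono A2" by (auto simp: antimono_def A1_def A2_def)
    show "measure Q (A1 t) \<le> 1/2" if "t \<in> S1" for t using that by (simp add: S1_def)
    show "measure Q (A2 t) \<le> 1/2" if "t \<in> S2" for t using that by (auto simp: S2_def compl)
  qed
  finally show ?thesis by (simp add: E_def A1_def)
qed

lemma hc_empirical_countable:
  fixes Q :: "real measure" and n :: nat and lam \<epsilon> :: real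
  assumes Q: "prob_space Q" and s: "sets Q = sets borel" and T: "countable T"
    and lam: "2 \<le> lam" and n: "1 \<le> n" and \<epsilon>: "0 < \<epsilon>" "\<epsilon> \<le> 1 / 2"
  defines "P \<equiv> PiM {..<n} (\<lambda>_. Q)"
  shows "measure P {\<omega> \<in> space P. \<exists>t\<in>T. lam * sqrt (n * measure Q {t<..} * (1 - measure Q {t<..}))
             < \<bar>hits n {t<..} \<omega> - n * measure Q {t<..}\<bar>} \<le> 2 * hc_half_err \<epsilon> n lam"
proof (cases "T = {}")
  case True
  then show ?thesis using hc_empirical_finite[OF Q s _ lam n \<epsilon>, of "{}"] by (simp add: P_def)
next
  case False
  interpret Q: prob_space Q by fact
  interpret P: prob_space P unfolding P_def by (rule prob_PiM_const[OF Q])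
  have [measurable]: "{t<..} \<in> sets Q" for t :: real by (simp add: s)
  have [measurable]: "hits n {t<..} \<in> borel_measurable P" for t :: real
    unfolding P_def by measurable
  define E where "E S = {\<omega> \<in> space P. \<exists>t\<in>S. lam * sqrt (n * measure Q {t<..} * (1 - measure Q {t<..}))
             < \<bar>hits n {t<..} \<omega> - n * measure Q {t<..}\<bar>}" for S
  define F where "F k = E (from_nat_into T ` {..<k})" for k
  have "F k \<in> sets P" for k unfolding F_def E_def by measurable
  then have "(\<lambda>k. measure P (F k)) \<longlonglongrightarrow> measure P (\<Union>k. F k)"
    by (intro P.finite_Lim_measure_incseq) (auto simp: incseq_def F_def E_def intro: less_le_trans)
  moreover have "(\<Union>k. F k) = E T"
  proof -
    have T_eq: "(\<Union>k. from_nat_into T ` {..<k}) = T"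
      using range_from_nat_into[OF False T] by auto
    have "(\<Union>k. F k) = E (\<Union>k. from_nat_into T ` {..<k})"
      by (auto simp: F_def E_def)
    then show ?thesis unfolding T_eq .
  qed
  moreover have "measure P (F k) \<le> 2 * hc_half_err \<epsilon> n lam" for k
    unfolding F_def E_def P_def by (rule hc_empirical_finite[OF Q s _ lam n \<epsilon>]) simp
  ultimately show ?thesis unfolding E_def[symmetric] by (metis LIMSEQ_le_const2)
qed

text \<open>
  With \<open>lam\<^sup>2 = 2 * (1 + \<delta>) * ln (ln n)\<close> a single block has probability about
  \<open>(ln n) powr (- (1 + \<delta>) * (1 - \<epsilon>) / (1 + \<epsilon>))\<close>. Once \<open>\<epsilon>\<close> is so small that this exponent is
  below \<open>-1\<close>, the \<open>ln n\<close> blocks together are negligible.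
\<close>
lemma hc_half_err_tendsto:
  fixes \<delta> :: real assumes "\<delta> > 0"
  obtains \<epsilon> where "0 < \<epsilon>" "\<epsilon> \<le> 1/2"
    "(\<lambda>n. hc_half_err \<epsilon> (real n) (sqrt (2 * (1 + \<delta>) * ln (ln (real n))))) \<longlonglongrightarrow> 0"
proof -
  \<comment> \<open>Small enough for \<open>(1 + \<delta>) * ((1 - \<epsilon>) / (1 + \<epsilon>)) > 1\<close>.\<close>
  define \<epsilon> where "\<epsilon> = min (1/2) (\<delta> / (8 + 4 * \<delta>))"
  have \<epsilon>: "0 < \<epsilon>" "\<epsilon> \<le> 1/2" using assms by (auto simp: \<epsilon>_def)
  define d where "d = (1 + \<delta>) * ((1 - \<epsilon>) / (1 + \<epsilon>)) - 1"
  have "\<epsilon> * (8 + 4 * \<delta>) \<le> \<delta>" using assms by (simp add: \<epsilon>_def min_def field_simps)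
  then have "d > 0" unfolding d_def using \<epsilon> assms by (simp add: field_simps)
  have "(\<lambda>n. 1 / (sqrt (2 * (1 + \<delta>) * ln (ln (real n))))
     + (ln ((sqrt (2 * (1 + \<delta>) * ln (ln (real n)))) * n) / ln (1 + \<epsilon>) + 1) * (2 * exp (- ((1+d) * ln (ln (real n)) * (1 - 1 / (sqrt (2 * (1 + \<delta>) * ln (ln (real n))))))))
     + (ln (2 * (sqrt (2 * (1 + \<delta>) * ln (ln (real n)))) ^ 5) / ln (1 + \<epsilon>) + 1) * (2 * exp (- (sqrt (sqrt (2 * (1 + \<delta>) * ln (ln (real n)))) / 8)))) \<longlonglongrightarrow> 0"
    (is "?f \<longlonglongrightarrow> 0")
    using \<epsilon> \<open>d > 0\<close> assms by real_asymp
  moreover have "eventually (\<lambda>n. ln (ln (real n)) \<ge> 0) sequentially" by real_asymp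
  then have "eventually (\<lambda>n. (sqrt (2 * (1 + \<delta>) * ln (ln (real n))))\<^sup>2 * ((1 - \<epsilon>) / (1 + \<epsilon>)) / 2 = (1+d) * ln (ln (real n))) sequentially"
    by eventually_elim (use assms \<epsilon>(1) in \<open>simp add: d_def field_simps\<close>)
  then have "eventually (\<lambda>n. ?f n = hc_half_err \<epsilon> (real n) (sqrt (2 * (1 + \<delta>) * ln (ln (real n))))) sequentially"
    by eventually_elim (simp only: hc_half_err_def)
  ultimately have "(\<lambda>n. hc_half_err \<epsilon> (real n) (sqrt (2 * (1 + \<delta>) * ln (ln (real n))))) \<longlonglongrightarrow> 0"
    by (rule Lim_transform_eventually)
  then show ?thesis using that \<epsilon> by blast
qed

section \<open>Gaussian laws\<close>

lemma prob_space_gauss: "prob_space (gauss m)"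
  unfolding gauss_def by (rule prob_space_normal_density) simp

lemma sets_gauss [simp, measurable_cong]: "sets (gauss m) = sets borel"
  by (simp add: gauss_def)

lemma space_gauss [simp]: "space (gauss m) = UNIV"
  by (simp add: gauss_def)

lemma prob_space_gauss_vec: "prob_space (gauss_vec d \<mu>)"
  unfolding gauss_vec_def by (intro prob_space_PiM prob_space_gauss)

lemma sets_gauss_vec [simp, measurable_cong]:
  "sets (gauss_vec d \<mu>) = sets (\<Pi>\<^sub>M j\<in>{..<d}. borel)"
  unfolding gauss_vec_def by (intro sets_PiM_cong) auto

lemma space_gauss_vec: "space (gauss_vec d \<mu>) = space (\<Pi>\<^sub>M j\<in>{..<d}. borel :: real measure)"
  by (rule sets_eq_imp_space_eq) simp

lemma dotp_measurable [measurable]: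
  "dotp d \<theta> \<in> borel_measurable (\<Pi>\<^sub>M j\<in>{..<d}. borel)"
  unfolding dotp_def[abs_def] by measurable

lemma gauss_density: "gauss m = density (gauss 0) (\<lambda>y. ennreal (exp (m * y - m\<^sup>2 / 2)))"
proof -
  have "density (gauss 0) (\<lambda>y. ennreal (exp (m * y - m\<^sup>2 / 2)))
      = density lborel (\<lambda>y. ennreal (normal_density 0 1 y) * ennreal (exp (m * y - m\<^sup>2 / 2)))"
    unfolding gauss_def by (rule density_density_eq) auto
  also have "\<dots> = density lborel (\<lambda>y. ennreal (normal_density m 1 y))"
  proof (intro density_cong AE_I2)
    fix y :: real
    have "normal_density 0 1 y * exp (m * y - m\<^sup>2 / 2) = normal_density m 1 y"
      by (simp add: normal_density_def exp_add[symmetric] power2_eq_square field_simps)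
    then show "ennreal (normal_density 0 1 y) * ennreal (exp (m * y - m\<^sup>2 / 2)) = ennreal (normal_density m 1 y)"
      by (simp add: ennreal_mult[symmetric])
  qed auto
  finally show ?thesis by (simp add: gauss_def)
qed

lemma PiM_density:
  fixes f :: "'i \<Rightarrow> 'a \<Rightarrow> ennreal"
  assumes I: "finite I" and M: "\<And>i. i \<in> I \<Longrightarrow> prob_space (M i)"
    and f: "\<And>i. i \<in> I \<Longrightarrow> f i \<in> borel_measurable (M i)"
    and d: "\<And>i. i \<in> I \<Longrightarrow> prob_space (density (M i) (f i))"
  shows "PiM I (\<lambda>i. density (M i) (f i)) = density (PiM I M) (\<lambda>x. \<Prod>i\<in>I. f i (x i))"
proof -
  \<comment> \<open>Outside \<open>I\<close> the family is replaced by point masses, so that every component is a probability space.\<close>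
  define M' where "M' i = (if i \<in> I then M i else return (count_space UNIV) undefined)" for i
  define f' where "f' i = (if i \<in> I then f i else (\<lambda>_. 1))" for i
  have f'[measurable]: "f' i \<in> borel_measurable (M' i)" for i
    using f by (auto simp: f'_def M'_def)
  interpret M': product_prob_space M' I
    by (intro product_prob_spaceI) (auto simp: M'_def M prob_space_return)
  interpret D: product_prob_space "\<lambda>i. density (M' i) (f' i)" I
    by (intro product_prob_spaceI) (auto simp: M'_def f'_def M prob_space_return d density_1)
  have "PiM I (\<lambda>i. density (M' i) (f' i)) = density (PiM I M') (\<lambda>x. \<Prod>i\<in>I. f' i (x i))"
  proof (rule D.PiM_eqI[symmetric, OF I])
    show "sets (density (PiM I M') (\<lambda>x. \<Prod>i\<in>I. f' i (x i))) = sets (PiM I (\<lambda>i. density (M' i) (f' i)))"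
      by (simp cong: sets_PiM_cong)
    fix A assume A: "\<And>i. i \<in> I \<Longrightarrow> A i \<in> sets (density (M' i) (f' i))"
    then have A'[measurable]: "\<And>i. i \<in> I \<Longrightarrow> A i \<in> sets (M' i)" by simp
    have fm: "(\<lambda>x. \<Prod>i\<in>I. f' i (x i)) \<in> borel_measurable (PiM I M')"
      by (intro borel_measurable_prod_ennreal) (rule measurable_compose[OF _ f'], rule measurable_component_singleton)
    have Pm: "Pi\<^sub>E I A \<in> sets (PiM I M')" using A' I by (intro sets_PiM_I_finite) auto
    have "emeasure (density (PiM I M') (\<lambda>x. \<Prod>i\<in>I. f' i (x i))) (Pi\<^sub>E I A)
       = (\<integral>\<^sup>+x. (\<Prod>i\<in>I. f' i (x i)) * indicator (Pi\<^sub>E I A) x \<partial>PiM I M')"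
      using fm Pm by (rule emeasure_density)
    also have "\<dots> = (\<integral>\<^sup>+x. (\<Prod>i\<in>I. f' i (x i) * indicator (A i) (x i)) \<partial>PiM I M')"
    proof (rule nn_integral_cong)
      fix x assume "x \<in> space (PiM I M')"
      then have "x \<in> extensional I" by (auto simp: space_PiM PiE_def)
      then have "indicator (Pi\<^sub>E I A) x = (\<Prod>i\<in>I. indicator (A i) (x i) :: ennreal)"
        using I by (auto simp: PiE_def Pi_def indicator_def prod.neutral_const prod_zero_iff intro!: prod_zero[symmetric])
      then show "(\<Prod>i\<in>I. f' i (x i)) * indicator (Pi\<^sub>E I A) x = (\<Prod>i\<in>I. f' i (x i) * indicator (A i) (x i))"
        by (simp add: prod.distrib)
    qed
    also have "\<dots> = (\<Prod>i\<in>I. \<integral>\<^sup>+x. f' i x * indicator (A i) x \<partial>M' i)"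
      using I A' by (intro M'.product_nn_integral_prod) auto
    also have "\<dots> = (\<Prod>i\<in>I. emeasure (density (M' i) (f' i)) (A i))"
      using A' by (intro prod.cong refl emeasure_density[symmetric]) auto
    finally show "emeasure (density (PiM I M') (\<lambda>x. \<Prod>i\<in>I. f' i (x i))) (Pi\<^sub>E I A)
       = (\<Prod>i\<in>I. emeasure (density (M' i) (f' i)) (A i))" .
  qed
  moreover have "PiM I (\<lambda>i. density (M' i) (f' i)) = PiM I (\<lambda>i. density (M i) (f i))"
    by (intro PiM_cong) (auto simp: M'_def f'_def)
  moreover have "PiM I M' = PiM I M" by (intro PiM_cong) (auto simp: M'_def)
  moreover have "(\<lambda>x. \<Prod>i\<in>I. f' i (x i)) = (\<lambda>x. \<Prod>i\<in>I. f i (x i))"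
    by (intro ext prod.cong) (auto simp: f'_def)
  ultimately show ?thesis by simp
qed

definition nrm :: "nat \<Rightarrow> (nat \<Rightarrow> real) \<Rightarrow> real" where "nrm d x = L2_set x {..<d}"

lemma nrm_sq: "(nrm d x)\<^sup>2 = (\<Sum>j<d. (x j)\<^sup>2)"
  by (simp add: nrm_def L2_set_def sum_nonneg)

lemma gauss_vec_density:
  assumes "e\<^sup>2 = 1"
  shows "gauss_vec d (\<lambda>j. e * \<theta> j) = density (gauss_vec d (\<lambda>_. 0))
     (\<lambda>x. ennreal (exp (e * dotp d \<theta> x - (nrm d \<theta>)\<^sup>2 / 2)))"
proof -
  have "gauss_vec d (\<lambda>j. e * \<theta> j)
     = PiM {..<d} (\<lambda>j. density (gauss 0) (\<lambda>y. ennreal (exp (e * \<theta> j * y - (e * \<theta> j)\<^sup>2 / 2))))"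
    unfolding gauss_vec_def by (subst gauss_density) simp
  also have "\<dots> = density (PiM {..<d} (\<lambda>_. gauss 0)) (\<lambda>x. \<Prod>j<d. ennreal (exp (e * \<theta> j * x j - (e * \<theta> j)\<^sup>2 / 2)))"
    by (rule PiM_density) (auto simp: prob_space_gauss gauss_density[symmetric])
  also have "(\<lambda>x. \<Prod>j<d. ennreal (exp (e * \<theta> j * x j - (e * \<theta> j)\<^sup>2 / 2)))
     = (\<lambda>x. ennreal (exp (e * dotp d \<theta> x - (nrm d \<theta>)\<^sup>2 / 2)))"
    using assms by (simp add: prod_ennreal exp_sum[symmetric] dotp_def nrm_sq sum_subtractf sum_distrib_left
       power_mult_distrib sum_divide_distrib ac_simps)
  finally show ?thesis by (simp add: gauss_vec_def)
qed

text \<open>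
  Coordinates with \<open>\<theta> j = 0\<close> contribute degenerate summands, which the convolution of normal
  densities does not cover, so the sum is first restricted to the support of \<open>\<theta>\<close>.
\<close>
lemma dotp_distributed:
  assumes pos: "nrm d \<theta> > 0"
  shows "distr (gauss_vec d (\<lambda>j. e * \<theta> j)) borel (dotp d \<theta>)
     = density lborel (normal_density (e * (nrm d \<theta>)\<^sup>2) (nrm d \<theta>))"
proof -
  define M where "M = gauss_vec d (\<lambda>j. e * \<theta> j)"
  interpret prob_space M unfolding M_def by (rule prob_space_gauss_vec)
  interpret P: product_prob_space "\<lambda>j. gauss (e * \<theta> j)" "{..<d}"
    by (intro product_prob_spaceI prob_space_gauss)
  define J where "J = {j\<in>{..<d}. \<theta> j \<noteq> 0}"
  have J: "finite J" by (simp add: J_def)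
  have sq: "(\<Sum>j\<in>J. (\<theta> j)\<^sup>2) = (nrm d \<theta>)\<^sup>2"
    unfolding nrm_sq J_def by (intro sum.mono_neutral_left) auto
  have "J \<noteq> {}" using sq pos by auto
  have comp: "distributed M lborel (\<lambda>x. x j) (normal_density (e * \<theta> j) 1)" if "j \<in> J" for j
  proof -
    have "distr M lborel (\<lambda>x. x j) = distr M (gauss (e * \<theta> j)) (\<lambda>x. x j)"
      by (intro distr_cong) auto
    also have "\<dots> = gauss (e * \<theta> j)"
      unfolding M_def gauss_vec_def using that by (intro P.PiM_component) (auto simp: J_def)
    also have "\<dots> = density lborel (normal_density (e * \<theta> j) 1)" by (simp add: gauss_def)
    finally show ?thesis using that unfolding distributed_def by (auto simp: M_def J_def)
  qed
  have "indep_vars (\<lambda>i. borel) (\<lambda>j x. \<theta> j * x j) {..<d}"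
  proof -
    have "indep_vars (\<lambda>_. borel) (\<lambda>j x. x j) {..<d}"
    proof (subst indep_vars_iff_distr_eq_PiM')
      show "{..<d} \<noteq> {}" using \<open>J \<noteq> {}\<close> by (auto simp: J_def)
      show "(\<lambda>x. x j) \<in> M \<rightarrow>\<^sub>M borel" if "j \<in> {..<d}" for j using that by (simp add: M_def)
      have 1: "distr M (PiM {..<d} (\<lambda>_. borel)) (\<lambda>x. \<lambda>i\<in>{..<d}. x i) = M"
      proof -
        have "distr M (PiM {..<d} (\<lambda>_. borel)) (\<lambda>x. \<lambda>i\<in>{..<d}. x i) = distr M M (\<lambda>x. x)"
          by (rule distr_cong) (auto simp: M_def space_gauss_vec space_PiM)
        then show ?thesis by simp
      qed
      have 2: "distr M borel (\<lambda>x. x i) = gauss (e * \<theta> i)" if "i \<in> {..<d}" for i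
      proof -
        have "distr M borel (\<lambda>x. x i) = distr M (gauss (e * \<theta> i)) (\<lambda>x. x i)" by (rule distr_cong) auto
        also have "\<dots> = gauss (e * \<theta> i)" unfolding M_def gauss_vec_def by (rule P.PiM_component[OF that])
        finally show ?thesis .
      qed
      have "PiM {..<d} (\<lambda>i. distr M borel (\<lambda>x. x i)) = M"
        unfolding M_def gauss_vec_def by (rule PiM_cong) (auto simp: 2[unfolded M_def gauss_vec_def])
      then show "distr M (PiM {..<d} (\<lambda>_. borel)) (\<lambda>x. \<lambda>i\<in>{..<d}. x i) = PiM {..<d} (\<lambda>i. distr M borel (\<lambda>x. x i))"
        using 1 by simp
    qed
    then show ?thesis by (rule indep_vars_compose2) auto
  qed
  then have indep: "indep_vars (\<lambda>i. borel) (\<lambda>j x. \<theta> j * x j) J"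
    by (rule indep_vars_subset) (auto simp: J_def)
  have "distributed M lborel (\<lambda>x. \<Sum>j\<in>J. \<theta> j * x j) (normal_density (\<Sum>j\<in>J. e * (\<theta> j)\<^sup>2) (sqrt (\<Sum>j\<in>J. \<bar>\<theta> j\<bar>\<^sup>2)))"
  proof (rule sum_indep_normal[OF J \<open>J \<noteq> {}\<close> indep])
    fix j assume j: "j \<in> J"
    then show "0 < \<bar>\<theta> j\<bar>" by (simp add: J_def)
    show "distributed M lborel (\<lambda>x. \<theta> j * x j) (normal_density (e * (\<theta> j)\<^sup>2) \<bar>\<theta> j\<bar>)"
      using normal_density_affine[OF comp[OF j], of "\<theta> j" 0] j
      by (simp add: J_def power2_eq_square ac_simps)
  qed
  moreover have "(\<lambda>x. \<Sum>j\<in>J. \<theta> j * x j) = dotp d \<theta>"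
    unfolding dotp_def J_def by (intro ext sum.mono_neutral_left) auto
  moreover have "(\<Sum>j\<in>J. e * (\<theta> j)\<^sup>2) = e * (nrm d \<theta>)\<^sup>2" by (simp add: sq sum_distrib_left[symmetric])
  moreover have "sqrt (\<Sum>j\<in>J. \<bar>\<theta> j\<bar>\<^sup>2) = nrm d \<theta>" using pos by (simp add: sq)
  ultimately have "distr M lborel (dotp d \<theta>) = density lborel (normal_density (e * (nrm d \<theta>)\<^sup>2) (nrm d \<theta>))"
    by (simp add: distributed_def)
  moreover have "distr M lborel (dotp d \<theta>) = distr M borel (dotp d \<theta>)" by (intro distr_cong) auto
  ultimately show ?thesis by (simp add: M_def)
qed

text \<open>
  Rotation invariance of the planar Gaussian law, in the coordinates needed here: if \<open>(x, y)\<close>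
  has means \<open>e * a\<^sup>2\<close>, \<open>e * b\<^sup>2\<close> and standard deviations \<open>a\<close>, \<open>b\<close>, then \<open>v = (x + y) / D\<close> and
  \<open>u = (b / a * x - a / b * y) / D\<close> are independent with unit variance and means \<open>e * D\<close> and
  \<open>0\<close>. The change of variables is done as two one-dimensional affine substitutions, first \<open>y\<close>
  for fixed \<open>x\<close> and then \<open>x\<close> for fixed \<open>v\<close>.
\<close>
lemma nn_integral_normal_rotate:
  fixes a b e :: real and f :: "real \<times> real \<Rightarrow> ennreal"
  assumes a: "0 < a" and b: "0 < b" and [measurable]: "f \<in> borel_measurable (borel \<Otimes>\<^sub>M borel)"
  defines "D \<equiv> sqrt (a\<^sup>2 + b\<^sup>2)"
  shows "(\<integral>\<^sup>+z. f z \<partial>(density lborel (normal_density (e * a\<^sup>2) a) \<Otimes>\<^sub>M density lborel (normal_density (e * b\<^sup>2) b)))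
    = (\<integral>\<^sup>+(u, v). f ((a * b * u + a\<^sup>2 * v) / D, (b\<^sup>2 * v - a * b * u) / D) \<partial>(gauss 0 \<Otimes>\<^sub>M gauss (e * D)))"
proof -
  have D: "0 < D" "D\<^sup>2 = a\<^sup>2 + b\<^sup>2" using a b by (auto simp: D_def sum_pos2 add_pos_pos)
  define g where "g \<mu> s x = ennreal (normal_density \<mu> s x)" for \<mu> s x :: real
  have [measurable]: "g \<mu> s \<in> borel_measurable borel" for \<mu> s unfolding g_def by measurable
  have sf: "sigma_finite_measure (density lborel (g \<mu> s))" if "0 < s" for \<mu> s
    unfolding g_def by (intro prob_space_imp_sigma_finite prob_space_normal_density that)
  have expand: "(\<integral>\<^sup>+z. h z \<partial>(density lborel (g \<mu> s) \<Otimes>\<^sub>M density lborel (g \<mu>' s')))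
     = (\<integral>\<^sup>+x. (\<integral>\<^sup>+y. h (x, y) * (g \<mu> s x * g \<mu>' s' y) \<partial>lborel) \<partial>lborel)"
    if [measurable]: "h \<in> borel_measurable (borel \<Otimes>\<^sub>M borel)" and s: "0 < s" "0 < s'" for h :: "real \<times> real \<Rightarrow> ennreal" and \<mu> s \<mu>' s'
  proof -
    interpret S: sigma_finite_measure "density lborel (g \<mu>' s')" by (rule sf) fact
    have "(\<integral>\<^sup>+z. h z \<partial>(density lborel (g \<mu> s) \<Otimes>\<^sub>M density lborel (g \<mu>' s')))
       = (\<integral>\<^sup>+x. (\<integral>\<^sup>+y. h (x, y) \<partial>density lborel (g \<mu>' s')) \<partial>density lborel (g \<mu> s))"
      by (rule S.nn_integral_fst[symmetric]) measurable
    also have "\<dots> = (\<integral>\<^sup>+x. g \<mu> s x * (\<integral>\<^sup>+y. g \<mu>' s' y * h (x, y) \<partial>lborel) \<partial>lborel)"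
      by (subst nn_integral_density; (measurable)?) (simp add: nn_integral_density)
    also have "\<dots> = (\<integral>\<^sup>+x. (\<integral>\<^sup>+y. h (x, y) * (g \<mu> s x * g \<mu>' s' y) \<partial>lborel) \<partial>lborel)"
      by (intro nn_integral_cong, subst nn_integral_cmult[symmetric]) (auto simp: ac_simps)
    finally show ?thesis .
  qed
  have gauss_g: "gauss m = density lborel (g m 1)" for m by (simp add: gauss_def g_def[abs_def])
  define F where "F x y = f (x, y) * (g (e * a\<^sup>2) a x * g (e * b\<^sup>2) b y)" for x y
  have F[measurable]: "(\<lambda>z. F (fst z) (snd z)) \<in> borel_measurable (borel \<Otimes>\<^sub>M borel)"
    unfolding F_def by measurable
  have Fm: "(\<lambda>z. F (p z) (q z)) \<in> borel_measurable N" if "p \<in> borel_measurable N" "q \<in> borel_measurable N" for p q and N :: "'z measure"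
    using measurable_compose[OF measurable_Pair[OF that] F] by simp
  have "(\<integral>\<^sup>+z. f z \<partial>(density lborel (normal_density (e * a\<^sup>2) a) \<Otimes>\<^sub>M density lborel (normal_density (e * b\<^sup>2) b)))
     = (\<integral>\<^sup>+x. (\<integral>\<^sup>+y. F x y \<partial>lborel) \<partial>lborel)"
    using expand[OF assms(3) a b, of "e * a\<^sup>2" "e * b\<^sup>2"] by (simp add: g_def[abs_def] F_def)
  also have "\<dots> = (\<integral>\<^sup>+x. ennreal D * (\<integral>\<^sup>+v. F x (D * v - x) \<partial>lborel) \<partial>lborel)"
  proof (rule nn_integral_cong)
    fix x :: real
    have "(\<lambda>y. F x y) \<in> borel_measurable borel" by (rule Fm) auto
    from nn_integral_real_affine[OF this, of D "-x"]
    show "(\<integral>\<^sup>+y. F x y \<partial>lborel) = ennreal D * (\<integral>\<^sup>+v. F x (D * v - x) \<partial>lborel)"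
      using D by (simp add: algebra_simps)
  qed
  also have "\<dots> = ennreal D * (\<integral>\<^sup>+x. (\<integral>\<^sup>+v. F x (D * v - x) \<partial>lborel) \<partial>lborel)"
    by (rule nn_integral_cmult) (rule lborel.borel_measurable_nn_integral, simp only: case_prod_beta', rule Fm, measurable)
  also have "(\<integral>\<^sup>+x. (\<integral>\<^sup>+v. F x (D * v - x) \<partial>lborel) \<partial>lborel) = (\<integral>\<^sup>+v. (\<integral>\<^sup>+x. F x (D * v - x) \<partial>lborel) \<partial>lborel)"
    by (rule lborel_pair.Fubini') (auto simp: case_prod_beta' intro!: Fm)
  also have "\<dots> = (\<integral>\<^sup>+v. ennreal (a * b / D) * (\<integral>\<^sup>+u. F ((a * b * u + a\<^sup>2 * v) / D) ((b\<^sup>2 * v - a * b * u) / D) \<partial>lborel) \<partial>lborel)"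
  proof (rule nn_integral_cong)
    fix v :: real
    have "(\<lambda>x. F x (D * v - x)) \<in> borel_measurable borel" by (rule Fm) auto
    from nn_integral_real_affine[OF this, of "a * b / D" "a\<^sup>2 * v / D"]
    have "(\<integral>\<^sup>+x. F x (D * v - x) \<partial>lborel) = ennreal (a * b / D) *
        (\<integral>\<^sup>+u. F (a\<^sup>2 * v / D + a * b / D * u) (D * v - (a\<^sup>2 * v / D + a * b / D * u)) \<partial>lborel)"
      using D a b by simp
    also have "(\<lambda>u. F (a\<^sup>2 * v / D + a * b / D * u) (D * v - (a\<^sup>2 * v / D + a * b / D * u)))
        = (\<lambda>u. F ((a * b * u + a\<^sup>2 * v) / D) ((b\<^sup>2 * v - a * b * u) / D))"
    proof (intro ext arg_cong2[where f=F])
      fix u :: real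
      show "a\<^sup>2 * v / D + a * b / D * u = (a * b * u + a\<^sup>2 * v) / D" by (simp add: add_divide_distrib)
      have "D * v = D\<^sup>2 * v / D" using D(1) by (simp add: power2_eq_square)
      then have "D * v = (a\<^sup>2 + b\<^sup>2) * v / D" unfolding D(2) .
      then show "D * v - (a\<^sup>2 * v / D + a * b / D * u) = (b\<^sup>2 * v - a * b * u) / D"
        by (simp add: add_divide_distrib diff_divide_distrib algebra_simps)
    qed
    finally show "(\<integral>\<^sup>+x. F x (D * v - x) \<partial>lborel) = ennreal (a * b / D) *
        (\<integral>\<^sup>+u. F ((a * b * u + a\<^sup>2 * v) / D) ((b\<^sup>2 * v - a * b * u) / D) \<partial>lborel)" .
  qed
  also have "\<dots> = ennreal (a * b / D) * (\<integral>\<^sup>+v. (\<integral>\<^sup>+u. F ((a * b * u + a\<^sup>2 * v) / D) ((b\<^sup>2 * v - a * b * u) / D) \<partial>lborel) \<partial>lborel)"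
    by (rule nn_integral_cmult) (rule lborel.borel_measurable_nn_integral, simp only: case_prod_beta', rule Fm, measurable)
  also have "(\<integral>\<^sup>+v. (\<integral>\<^sup>+u. F ((a * b * u + a\<^sup>2 * v) / D) ((b\<^sup>2 * v - a * b * u) / D) \<partial>lborel) \<partial>lborel)
      = (\<integral>\<^sup>+u. (\<integral>\<^sup>+v. F ((a * b * u + a\<^sup>2 * v) / D) ((b\<^sup>2 * v - a * b * u) / D) \<partial>lborel) \<partial>lborel)"
    by (rule lborel_pair.Fubini') (auto simp: case_prod_beta' intro!: Fm)
  finally have 1: "(\<integral>\<^sup>+z. f z \<partial>(density lborel (normal_density (e * a\<^sup>2) a) \<Otimes>\<^sub>M density lborel (normal_density (e * b\<^sup>2) b)))
     = ennreal (a * b) * (\<integral>\<^sup>+u. (\<integral>\<^sup>+v. F ((a * b * u + a\<^sup>2 * v) / D) ((b\<^sup>2 * v - a * b * u) / D) \<partial>lborel) \<partial>lborel)"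
    using D a b by (simp add: mult.assoc[symmetric] ennreal_mult[symmetric])
  define G where "G = (\<lambda>(u, v). f ((a * b * u + a\<^sup>2 * v) / D, (b\<^sup>2 * v - a * b * u) / D))"
  have [measurable]: "G \<in> borel_measurable (borel \<Otimes>\<^sub>M borel)" unfolding G_def by measurable
  have jac: "normal_density (e * a\<^sup>2) a ((a * b * u + a\<^sup>2 * v) / D) * normal_density (e * b\<^sup>2) b ((b\<^sup>2 * v - a * b * u) / D) * (a * b)
     = normal_density 0 1 u * normal_density (e * D) 1 v" for u v
  proof -
    define w where "w = v - e * D"
    have p1: "(a * b * u + a\<^sup>2 * v) / D - e * a\<^sup>2 = a * (b * u + a * w) / D"
      using D a b by (simp add: w_def field_simps power2_eq_square)
    have p2: "(b\<^sup>2 * v - a * b * u) / D - e * b\<^sup>2 = b * (b * w - a * u) / D"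
      using D a b by (simp add: w_def field_simps power2_eq_square)
    have s: "(b * u + a * w)\<^sup>2 + (b * w - a * u)\<^sup>2 = D\<^sup>2 * (u\<^sup>2 + w\<^sup>2)"
      unfolding D(2) by (simp add: power2_eq_square algebra_simps)
    have q1: "((a * b * u + a\<^sup>2 * v) / D - e * a\<^sup>2)\<^sup>2 / (2 * a\<^sup>2) = (b * u + a * w)\<^sup>2 / (2 * D\<^sup>2)"
      unfolding p1 using a D(1) by (simp add: power_mult_distrib power_divide)
    have q2: "((b\<^sup>2 * v - a * b * u) / D - e * b\<^sup>2)\<^sup>2 / (2 * b\<^sup>2) = (b * w - a * u)\<^sup>2 / (2 * D\<^sup>2)"
      unfolding p2 using b D(1) by (simp add: power_mult_distrib power_divide)
    have "(b * u + a * w)\<^sup>2 / (2 * D\<^sup>2) + (b * w - a * u)\<^sup>2 / (2 * D\<^sup>2) = (u\<^sup>2 + w\<^sup>2) / 2"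
      unfolding add_divide_distrib[symmetric] s using D(1) by simp
    then have ex: "exp (- ((b * u + a * w)\<^sup>2 / (2 * D\<^sup>2))) * exp (- ((b * w - a * u)\<^sup>2 / (2 * D\<^sup>2))) = exp (- (u\<^sup>2 / 2)) * exp (- (w\<^sup>2 / 2))"
      unfolding exp_add[symmetric] by (simp add: add_divide_distrib)
    have c: "1 / sqrt (2 * pi * a\<^sup>2) * (1 / sqrt (2 * pi * b\<^sup>2)) * (a * b) = 1 / sqrt (2 * pi) * (1 / sqrt (2 * pi))"
      using a b by (simp add: real_sqrt_mult)
    have L1: "normal_density (e * a\<^sup>2) a ((a * b * u + a\<^sup>2 * v) / D) = 1 / sqrt (2 * pi * a\<^sup>2) * exp (- ((b * u + a * w)\<^sup>2 / (2 * D\<^sup>2)))"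
      unfolding normal_density_def minus_divide_left[symmetric] q1 ..
    have L2: "normal_density (e * b\<^sup>2) b ((b\<^sup>2 * v - a * b * u) / D) = 1 / sqrt (2 * pi * b\<^sup>2) * exp (- ((b * w - a * u)\<^sup>2 / (2 * D\<^sup>2)))"
      unfolding normal_density_def minus_divide_left[symmetric] q2 ..
    have R: "normal_density 0 1 u = 1 / sqrt (2 * pi) * exp (- (u\<^sup>2 / 2))"
      "normal_density (e * D) 1 v = 1 / sqrt (2 * pi) * exp (- (w\<^sup>2 / 2))"
      by (simp_all add: normal_density_def w_def)
    have re: "(A * E) * (A' * E') * k = (A * A' * k) * (E * E')" for A E A' E' k :: real
      by (simp only: mult.assoc mult.commute mult.left_commute)
    show ?thesis unfolding L1 L2 R re c ex
      by (simp only: mult.assoc mult.commute mult.left_commute)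
  qed
  have jac': "g 0 1 u * g (e * D) 1 v
      = ennreal (a * b) * (g (e * a\<^sup>2) a ((a * b * u + a\<^sup>2 * v) / D) * g (e * b\<^sup>2) b ((b\<^sup>2 * v - a * b * u) / D))" for u v
    unfolding g_def ennreal_mult[OF normal_density_nonneg normal_density_nonneg, symmetric] jac[symmetric]
    by (subst mult.commute, rule ennreal_mult) (use a b in auto)
  have "(\<integral>\<^sup>+z. G z \<partial>(gauss 0 \<Otimes>\<^sub>M gauss (e * D))) = (\<integral>\<^sup>+u. (\<integral>\<^sup>+v. G (u, v) * (g 0 1 u * g (e * D) 1 v) \<partial>lborel) \<partial>lborel)"
    unfolding gauss_g by (rule expand) auto
  also have "\<dots> = (\<integral>\<^sup>+u. (\<integral>\<^sup>+v. ennreal (a * b) * F ((a * b * u + a\<^sup>2 * v) / D) ((b\<^sup>2 * v - a * b * u) / D) \<partial>lborel) \<partial>lborel)"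
    unfolding G_def F_def case_prod_conv jac' by (simp only: mult.left_commute)
  also have "\<dots> = ennreal (a * b) * (\<integral>\<^sup>+u. (\<integral>\<^sup>+v. F ((a * b * u + a\<^sup>2 * v) / D) ((b\<^sup>2 * v - a * b * u) / D) \<partial>lborel) \<partial>lborel)"
  proof -
    have "(\<integral>\<^sup>+v. ennreal (a * b) * F ((a * b * u + a\<^sup>2 * v) / D) ((b\<^sup>2 * v - a * b * u) / D) \<partial>lborel)
       = ennreal (a * b) * (\<integral>\<^sup>+v. F ((a * b * u + a\<^sup>2 * v) / D) ((b\<^sup>2 * v - a * b * u) / D) \<partial>lborel)" for u
      by (rule nn_integral_cmult) (auto intro!: Fm)
    then show ?thesis
      by (simp only:) (rule nn_integral_cmult, rule lborel.borel_measurable_nn_integral, simp only: case_prod_beta', rule Fm, measurable)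
  qed
  finally show ?thesis unfolding 1 G_def by simp
qed

section \<open>The law of one pair of observations\<close>

definition pair_law :: "nat \<Rightarrow> nat \<Rightarrow> rvec \<Rightarrow> rvec \<Rightarrow> real \<Rightarrow> real \<Rightarrow> (rvec \<times> rvec) measure" where
  "pair_law p q \<theta> \<eta> e f = gauss_vec p (\<lambda>j. e * \<theta> j) \<Otimes>\<^sub>M gauss_vec q (\<lambda>j. f * \<eta> j)"

lemma data_law_eq_PiM: "data_law n p q \<theta> \<eta> z \<sigma> = PiM {..<n} (\<lambda>i. pair_law p q \<theta> \<eta> (z i) (\<sigma> i))"
  by (simp add: data_law_def pair_law_def)

lemma prob_space_pair_law: "prob_space (pair_law p q \<theta> \<eta> e f)"
proof -
  interpret A: prob_space "gauss_vec p (\<lambda>j. e * \<theta> j)" by (rule prob_space_gauss_vec)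
  interpret B: prob_space "gauss_vec q (\<lambda>j. f * \<eta> j)" by (rule prob_space_gauss_vec)
  interpret pair_prob_space "gauss_vec p (\<lambda>j. e * \<theta> j)" "gauss_vec q (\<lambda>j. f * \<eta> j)" by standard
  show ?thesis unfolding pair_law_def by (rule prob_space_axioms)
qed

lemma sets_pair_law [simp, measurable_cong]:
  "sets (pair_law p q \<theta> \<eta> e f) = sets ((\<Pi>\<^sub>M j\<in>{..<p}. borel) \<Otimes>\<^sub>M (\<Pi>\<^sub>M j\<in>{..<q}. borel))"
  unfolding pair_law_def by (intro sets_pair_measure_cong) auto

lemma space_pair_law: "space (pair_law p q \<theta> \<eta> e f) = space (pair_law p q \<theta>' \<eta>' e' f')"
  by (rule sets_eq_imp_space_eq) simp

lemma prob_space_data_law: "prob_space (data_law n p q \<theta> \<eta> z \<sigma>)"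
  unfolding data_law_eq_PiM by (intro prob_space_PiM prob_space_pair_law)

lemma sets_data_law [simp, measurable_cong]: "sets (data_law n p q \<theta> \<eta> z \<sigma>) = sets (data_space n p q)"
  unfolding data_law_eq_PiM data_space_def by (intro sets_PiM_cong) auto

lemma space_data_law: "space (data_law n p q \<theta> \<eta> z \<sigma>) = space (data_space n p q)"
  by (rule sets_eq_imp_space_eq) simp

lemma C_minus_measurable [measurable]:
  "C_minus p q \<theta> \<eta> \<in> borel_measurable ((\<Pi>\<^sub>M j\<in>{..<p}. borel) \<Otimes>\<^sub>M (\<Pi>\<^sub>M j\<in>{..<q}. borel))"
  unfolding C_minus_def by measurable

lemma pair_law_density:
  assumes "e\<^sup>2 = 1" "f\<^sup>2 = 1"
  shows "pair_law p q \<theta> \<eta> e f = density (pair_law p q \<theta> \<eta> 0 0)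
    (\<lambda>w. ennreal (exp (e * dotp p \<theta> (fst w) + f * dotp q \<eta> (snd w) - ((nrm p \<theta>)\<^sup>2 + (nrm q \<eta>)\<^sup>2) / 2)))"
proof -
  have "pair_law p q \<theta> \<eta> e f
     = density (gauss_vec p (\<lambda>_. 0)) (\<lambda>x. ennreal (exp (e * dotp p \<theta> x - (nrm p \<theta>)\<^sup>2 / 2)))
       \<Otimes>\<^sub>M density (gauss_vec q (\<lambda>_. 0)) (\<lambda>y. ennreal (exp (f * dotp q \<eta> y - (nrm q \<eta>)\<^sup>2 / 2)))"
    unfolding pair_law_def gauss_vec_density[OF assms(1)] gauss_vec_density[OF assms(2)] ..
  also have "\<dots> = density (gauss_vec p (\<lambda>_. 0) \<Otimes>\<^sub>M gauss_vec q (\<lambda>_. 0))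
     (\<lambda>(x, y). ennreal (exp (e * dotp p \<theta> x - (nrm p \<theta>)\<^sup>2 / 2)) * ennreal (exp (f * dotp q \<eta> y - (nrm q \<eta>)\<^sup>2 / 2)))"
    by (rule pair_measure_density)
       (auto simp: gauss_vec_density[OF assms(2), symmetric] intro!: prob_space_imp_sigma_finite prob_space_gauss_vec)
  also have "(\<lambda>(x, y). ennreal (exp (e * dotp p \<theta> x - (nrm p \<theta>)\<^sup>2 / 2)) * ennreal (exp (f * dotp q \<eta> y - (nrm q \<eta>)\<^sup>2 / 2)))
     = (\<lambda>w. ennreal (exp (e * dotp p \<theta> (fst w) + f * dotp q \<eta> (snd w) - ((nrm p \<theta>)\<^sup>2 + (nrm q \<eta>)\<^sup>2) / 2)))"
    by (auto simp: fun_eq_iff ennreal_mult[symmetric] exp_add[symmetric] add_divide_distrib algebra_simps)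
  finally show ?thesis by (simp add: pair_law_def)
qed

lemma gauss_uminus: "distr (gauss m) borel uminus = gauss (- m)"
proof (rule measure_eqI)
  fix A :: "real set" assume "A \<in> sets (distr (gauss m) borel uminus)"
  then have [measurable]: "A \<in> sets borel" by simp
  have "emeasure (distr (gauss m) borel uminus) A = (\<integral>\<^sup>+x. indicator A (- x) \<partial>gauss m)"
    by (subst nn_integral_distr[of uminus "gauss m" borel "indicator A", symmetric]) auto
  also have "\<dots> = (\<integral>\<^sup>+x. ennreal (normal_density m 1 x) * indicator A (- x) \<partial>lborel)"
    unfolding gauss_def by (subst nn_integral_density) auto
  also have "\<dots> = (\<integral>\<^sup>+x. ennreal (normal_density m 1 (- x)) * indicator A x \<partial>lborel)"
    by (subst nn_integral_real_affine[where c="-1" and t=0]) auto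
  also have "\<dots> = (\<integral>\<^sup>+x. ennreal (normal_density (- m) 1 x) * indicator A x \<partial>lborel)"
    by (intro nn_integral_cong) (simp add: normal_density_def power2_commute add.commute)
  also have "\<dots> = emeasure (gauss (- m)) A"
    unfolding gauss_def by (subst emeasure_density) auto
  finally show "emeasure (distr (gauss m) borel uminus) A = emeasure (gauss (- m)) A" .
qed simp

lemma gauss_reflect: "i\<^sup>2 = 1 \<Longrightarrow> distr (gauss m) borel (\<lambda>x. i * x) = gauss (i * m)"
  using gauss_uminus[of m] distr_id2[of borel "gauss m"]
  by (auto simp: power2_eq_1_iff distr_id[unfolded id_def])

lemma gauss_pair_reflect:
  assumes i: "i\<^sup>2 = 1" and j: "j\<^sup>2 = 1" and S: "S \<in> sets (borel \<Otimes>\<^sub>M borel)"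
  shows "measure (gauss (i * m) \<Otimes>\<^sub>M gauss (j * m')) S = measure (gauss m \<Otimes>\<^sub>M gauss m') {w. (i * fst w, j * snd w) \<in> S}"
proof -
  have "gauss (i * m) \<Otimes>\<^sub>M gauss (j * m') = distr (gauss m \<Otimes>\<^sub>M gauss m') (borel \<Otimes>\<^sub>M borel) (\<lambda>(x, y). (i * x, j * y))"
    unfolding gauss_reflect[OF i, symmetric] gauss_reflect[OF j, symmetric]
    by (rule pair_measure_distr) (auto simp: gauss_reflect[OF j] intro!: prob_space_imp_sigma_finite prob_space_gauss)
  then show ?thesis using S
    by (auto simp: measure_distr space_pair_measure vimage_def case_prod_beta' intro!: arg_cong2[where f=measure])
qed

lemma square_one_cases: "(e::real)\<^sup>2 = 1 \<Longrightarrow> (e = 1 \<Longrightarrow> P) \<Longrightarrow> (e = -1 \<Longrightarrow> P) \<Longrightarrow> P"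
  by (auto simp: power2_eq_1_iff)

definition null_event :: "real \<Rightarrow> real \<Rightarrow> real \<Rightarrow> (real \<times> real) set" where
  "null_event r s t = {(u, v). \<bar>sqrt r * u + sqrt s * v\<bar> - sqrt (r + s) * \<bar>v\<bar> > t}"

lemma null_event_sets [measurable]: "null_event r s t \<in> sets (borel \<Otimes>\<^sub>M borel)"
proof -
  have "{w \<in> space (borel \<Otimes>\<^sub>M borel). \<bar>sqrt r * fst w + sqrt s * snd w\<bar> - sqrt (r + s) * \<bar>snd w\<bar> > t} \<in> sets (borel \<Otimes>\<^sub>M borel)"
    by measurable
  then show ?thesis by (simp add: null_event_def case_prod_beta' space_pair_measure)
qed

text \<open>
  The event is invariant under \<open>(u, v) \<mapsto> (- u, - v)\<close>, which exchanges the two components of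
  the mixture.
\<close>
lemma null_survival_one_sided:
  assumes "e\<^sup>2 = 1"
  shows "null_survival n r s t = measure (gauss 0 \<Otimes>\<^sub>M gauss (e * sqrt (2 * (r + s) * ln (real n)))) (null_event r s t)"
proof -
  define m where "m = sqrt (2 * (r + s) * ln (real n))"
  have "measure (gauss 0 \<Otimes>\<^sub>M gauss (- m)) (null_event r s t) = measure (gauss 0 \<Otimes>\<^sub>M gauss m) {w. (- fst w, - snd w) \<in> null_event r s t}"
    using gauss_pair_reflect[of "-1" "-1" "null_event r s t" 0 m] by simp
  also have "{w. (- fst w, - snd w) \<in> null_event r s t} = null_event r s t"
  proof -
    have "\<bar>- (sqrt r * u) - sqrt s * v\<bar> = \<bar>sqrt r * u + sqrt s * v\<bar>" for u v
      by (subst abs_minus_cancel[symmetric]) simp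
    then show ?thesis by (auto simp: null_event_def)
  qed
  finally have "measure (gauss 0 \<Otimes>\<^sub>M gauss (- m)) (null_event r s t) = measure (gauss 0 \<Otimes>\<^sub>M gauss m) (null_event r s t)" .
  then show ?thesis using assms
    by (elim square_one_cases) (auto simp: null_survival_def Let_def m_def null_event_def)
qed

section \<open>The null law of the statistic\<close>

text \<open>
  The setting at one sample size. Below, \<open>l\<close> is the common scale of the two signal
  parameters, so that \<open>D = sqrt (r + s) * l\<close>, and \<open>\<rho>\<close> is the quantity whose comparison with
  one half decides the testing problem. \<open>G e f\<close> is the law of one pair whose labels are \<open>e\<close>
  and \<open>f\<close>.
\<close>
locale calibrated =
  fixes n p q :: nat and \<theta> \<eta> :: rvec and r s :: real
  assumes n: "2 \<le> n" and r: "0 < r" and s: "0 \<le> s"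
    and cal_r: "2 * L2_set \<theta> {..<p} * L2_set \<eta> {..<q} / sqrt ((L2_set \<theta> {..<p})\<^sup>2 + (L2_set \<eta> {..<q})\<^sup>2)
        = sqrt (2 * r * ln (real n))"
    and cal_s: "\<bar>(L2_set \<theta> {..<p})\<^sup>2 - (L2_set \<eta> {..<q})\<^sup>2\<bar> / sqrt ((L2_set \<theta> {..<p})\<^sup>2 + (L2_set \<eta> {..<q})\<^sup>2)
        = sqrt (2 * s * ln (real n))"
begin

definition "a = nrm p \<theta>"
definition "b = nrm q \<eta>"
definition "D = sqrt (a\<^sup>2 + b\<^sup>2)"
definition "l = sqrt (2 * ln (real n))"
definition "\<rho> = r + s - sqrt s * sqrt (r + s)"

abbreviation "G \<equiv> pair_law p q \<theta> \<eta>"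
abbreviation "C \<equiv> C_minus p q \<theta> \<eta>"

lemma l_pos: "0 < l" using n by (simp add: l_def)

lemma l_sq: "l\<^sup>2 = 2 * ln (real n)" using n by (simp add: l_def)

lemma cal_r': "2 * a * b / D = sqrt r * l"
  using cal_r by (simp add: a_def b_def D_def nrm_def l_def real_sqrt_mult)

lemma cal_s': "\<bar>a\<^sup>2 - b\<^sup>2\<bar> / D = sqrt s * l"
  using cal_s by (simp add: a_def b_def D_def nrm_def l_def real_sqrt_mult)

lemma ab_pos: "0 < a" "0 < b"
proof -
  have "0 < 2 * a * b / D" unfolding cal_r' using r l_pos by simp
  then have "a \<noteq> 0" "b \<noteq> 0" by auto
  moreover have "0 \<le> a" "0 \<le> b" by (auto simp: a_def b_def nrm_def)
  ultimately show "0 < a" "0 < b" by auto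
qed

lemma D_pos: "0 < D" using ab_pos by (simp add: D_def add_pos_pos)

lemma D_sq: "D\<^sup>2 = a\<^sup>2 + b\<^sup>2" by (simp add: D_def)

text \<open>
  From \<open>(a\<^sup>2 + b\<^sup>2)\<^sup>2 = (2 * a * b)\<^sup>2 + (a\<^sup>2 - b\<^sup>2)\<^sup>2\<close>.
\<close>
lemma D_eq: "D = sqrt (r + s) * l"
proof -
  have "(D\<^sup>2)\<^sup>2 = (2 * a * b)\<^sup>2 + \<bar>a\<^sup>2 - b\<^sup>2\<bar>\<^sup>2"
    unfolding D_sq by (simp add: power2_eq_square algebra_simps)
  also have "2 * a * b = sqrt r * l * D" using cal_r' D_pos by (simp add: field_simps)
  also have "\<bar>a\<^sup>2 - b\<^sup>2\<bar> = sqrt s * l * D" using cal_s' D_pos by (simp add: field_simps)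
  finally have "(D\<^sup>2)\<^sup>2 = (r + s) * l\<^sup>2 * D\<^sup>2"
    using r s by (simp add: power_mult_distrib distrib_right)
  then have "D\<^sup>2 * D\<^sup>2 = (r + s) * l\<^sup>2 * D\<^sup>2" unfolding power2_eq_square[of "D\<^sup>2"] .
  then have "D\<^sup>2 = (r + s) * l\<^sup>2" using D_pos by (metis mult_right_cancel power_not_zero less_irrefl)
  then have "sqrt (D\<^sup>2) = sqrt ((r + s) * l\<^sup>2)" by simp
  then show ?thesis using D_pos l_pos by (simp add: real_sqrt_mult)
qed

lemma gap: "D\<^sup>2 - \<bar>a\<^sup>2 - b\<^sup>2\<bar> = \<rho> * l\<^sup>2"
proof -
  have "\<bar>a\<^sup>2 - b\<^sup>2\<bar> = sqrt s * l * D" using cal_s' D_pos by (simp add: field_simps)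
  moreover have "(sqrt (r + s) * l)\<^sup>2 = (r + s) * l\<^sup>2" using r s by (simp add: power_mult_distrib)
  ultimately show ?thesis unfolding D_eq \<rho>_def by (simp add: power2_eq_square algebra_simps)
qed

lemma joint_scores:
  "distr (G e f) (borel \<Otimes>\<^sub>M borel) (\<lambda>(x, y). (dotp p \<theta> x, dotp q \<eta> y))
    = density lborel (normal_density (e * a\<^sup>2) a) \<Otimes>\<^sub>M density lborel (normal_density (f * b\<^sup>2) b)"
proof -
  have d1: "distr (gauss_vec p (\<lambda>j. e * \<theta> j)) borel (dotp p \<theta>) = density lborel (normal_density (e * a\<^sup>2) a)"
    using dotp_distributed[of p \<theta> e] ab_pos by (simp add: a_def)
  have d2: "distr (gauss_vec q (\<lambda>j. f * \<eta> j)) borel (dotp q \<eta>) = density lborel (normal_density (f * b\<^sup>2) b)"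
    using dotp_distributed[of q \<eta> f] ab_pos by (simp add: b_def)
  show ?thesis
    unfolding pair_law_def d1[symmetric] d2[symmetric]
    by (rule pair_measure_distr[symmetric])
       (auto simp: d2 intro!: prob_space_imp_sigma_finite prob_space_normal_density ab_pos)
qed

text \<open>
  In the rotated coordinates the sum of the two scores is \<open>D * v\<close> and their difference is
  \<open>(2 * a * b / D) * u + ((a\<^sup>2 - b\<^sup>2) / D) * v\<close>; the calibration turns both into the
  combinations that define \<open>null_survival\<close>. The sign of \<open>a\<^sup>2 - b\<^sup>2\<close> is absorbed by a
  reflection of \<open>v\<close>.
\<close>
lemma null_law:
  assumes e: "e\<^sup>2 = 1"
  shows "measure (G e e) {w \<in> space (G e e). t * l < C w} = null_survival n r s t"
proof -
  define X where "X = {(x, y). t * l < \<bar>x - y\<bar> - \<bar>x + y :: real\<bar>}"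
  have X[measurable]: "X \<in> sets (borel \<Otimes>\<^sub>M borel)"
  proof -
    have "{w \<in> space (borel \<Otimes>\<^sub>M borel). t * l < \<bar>fst w - snd w\<bar> - \<bar>fst w + snd w :: real\<bar>} \<in> sets (borel \<Otimes>\<^sub>M borel)"
      by measurable
    then show ?thesis by (simp add: X_def case_prod_beta' space_pair_measure)
  qed
  note dd = joint_scores[of e e]
  obtain c :: real where c: "c\<^sup>2 = 1" "(a\<^sup>2 - b\<^sup>2) / D = c * sqrt s * l"
  proof (cases "a\<^sup>2 - b\<^sup>2 \<ge> 0")
    case True then show ?thesis using cal_s' by (intro that[of 1]) auto
  next
    case False then show ?thesis using cal_s' by (intro that[of "-1"]) (auto simp: divide_simps split: if_splits)
  qed
  have "{w \<in> space (G e e). t * l < C w} = (\<lambda>(x, y). (dotp p \<theta> x, dotp q \<eta> y)) -` X \<inter> space (G e e)"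
    by (auto simp: C_minus_def X_def)
  then have "emeasure (G e e) {w \<in> space (G e e). t * l < C w}
     = emeasure (distr (G e e) (borel \<Otimes>\<^sub>M borel) (\<lambda>(x, y). (dotp p \<theta> x, dotp q \<eta> y))) X"
    by (subst emeasure_distr) auto
  also have "\<dots> = (\<integral>\<^sup>+z. indicator X z \<partial>(density lborel (normal_density (e * a\<^sup>2) a) \<Otimes>\<^sub>M density lborel (normal_density (e * b\<^sup>2) b)))"
    unfolding dd by (rule nn_integral_indicator[symmetric]) (use X in \<open>simp cong: sets_pair_measure_cong\<close>)
  also have "\<dots> = (\<integral>\<^sup>+(u, v). indicator X ((a * b * u + a\<^sup>2 * v) / D, (b\<^sup>2 * v - a * b * u) / D) \<partial>(gauss 0 \<Otimes>\<^sub>M gauss (e * D)))"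
    using nn_integral_normal_rotate[OF ab_pos, of "indicator X" e] by (simp add: D_def)
  also have "\<dots> = (\<integral>\<^sup>+z. indicator {w. (1 * fst w, c * snd w) \<in> null_event r s t} z \<partial>(gauss 0 \<Otimes>\<^sub>M gauss (e * D)))"
  proof (intro nn_integral_cong, clarify)
    fix u v :: real
    have x1: "(a * b * u + a\<^sup>2 * v) / D - (b\<^sup>2 * v - a * b * u) / D = (sqrt r * u + sqrt s * (c * v)) * l"
    proof -
      have "(a * b * u + a\<^sup>2 * v) / D - (b\<^sup>2 * v - a * b * u) / D = (2 * a * b / D) * u + ((a\<^sup>2 - b\<^sup>2) / D) * v"
        by (simp add: add_divide_distrib diff_divide_distrib algebra_simps)
      then show ?thesis unfolding cal_r' c(2) by (simp add: algebra_simps)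
    qed
    have x2: "(a * b * u + a\<^sup>2 * v) / D + (b\<^sup>2 * v - a * b * u) / D = sqrt (r + s) * v * l"
    proof -
      have "(a * b * u + a\<^sup>2 * v) / D + (b\<^sup>2 * v - a * b * u) / D = D\<^sup>2 / D * v"
        unfolding D_sq by (simp add: add_divide_distrib diff_divide_distrib algebra_simps)
      then show ?thesis using D_eq D_pos by (simp add: power2_eq_square)
    qed
    have "((a * b * u + a\<^sup>2 * v) / D, (b\<^sup>2 * v - a * b * u) / D) \<in> X
        \<longleftrightarrow> t * l < (\<bar>sqrt r * u + sqrt s * (c * v)\<bar> - sqrt (r + s) * \<bar>c * v\<bar>) * l"
    proof -
      have "\<bar>x * l\<bar> = \<bar>x\<bar> * l" for x using l_pos by (simp add: abs_mult)
      moreover have "\<bar>sqrt (r + s) * v\<bar> = sqrt (r + s) * \<bar>c * v\<bar>"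
        using c(1) r s by (elim square_one_cases) (auto simp: abs_mult)
      ultimately show ?thesis
        unfolding X_def mem_Collect_eq case_prod_conv x1 x2 by (simp only: left_diff_distrib)
    qed
    also have "\<dots> \<longleftrightarrow> (u, c * v) \<in> null_event r s t"
      using l_pos by (simp add: null_event_def)
    finally show "indicator X ((a * b * u + a\<^sup>2 * v) / D, (b\<^sup>2 * v - a * b * u) / D)
       = indicator {w. (1 * fst w, c * snd w) \<in> null_event r s t} (u, v)"
      by (simp add: indicator_def)
  qed
  also have "\<dots> = emeasure (gauss 0 \<Otimes>\<^sub>M gauss (e * D)) {w. (1 * fst w, c * snd w) \<in> null_event r s t}"
  proof (rule nn_integral_indicator)
    have "{w \<in> space (gauss 0 \<Otimes>\<^sub>M gauss (e * D)). (1 * fst w, c * snd w) \<in> null_event r s t} \<in> sets (gauss 0 \<Otimes>\<^sub>M gauss (e * D))"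
      by measurable
    then show "{w. (1 * fst w, c * snd w) \<in> null_event r s t} \<in> sets (gauss 0 \<Otimes>\<^sub>M gauss (e * D))"
      by (simp add: space_pair_measure)
  qed
  finally have "measure (G e e) {w \<in> space (G e e). t * l < C w}
     = measure (gauss 0 \<Otimes>\<^sub>M gauss (e * D)) {w. (1 * fst w, c * snd w) \<in> null_event r s t}"
    by (simp add: measure_def)
  also have "\<dots> = measure (gauss (1 * 0) \<Otimes>\<^sub>M gauss (c * (e * D))) (null_event r s t)"
    by (rule gauss_pair_reflect[symmetric]) (use c in auto)
  also have "\<dots> = null_survival n r s t"
  proof -
    have "sqrt (2 * (r + s) * ln (real n)) = D"
      unfolding D_eq l_def by (simp only: real_sqrt_mult mult.assoc mult.commute mult.left_commute)
    then show ?thesis using null_survival_one_sided[of "c * e" n r s t] c(1) e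
      by (simp add: power_mult_distrib mult.assoc)
  qed
  finally show ?thesis .
qed

end

section \<open>Signal size, likelihood ratio and null tail\<close>

lemma normal_chebyshev:
  assumes "0 < \<sigma>" "0 < h"
  shows "measure (density lborel (normal_density \<mu> \<sigma>)) {x. h \<le> \<bar>x - \<mu>\<bar>} \<le> \<sigma>\<^sup>2 / h\<^sup>2"
proof -
  interpret N: prob_space "density lborel (normal_density \<mu> \<sigma>)" by (rule prob_space_normal_density) fact
  have "measure (density lborel (normal_density \<mu> \<sigma>)) {x \<in> space (density lborel (normal_density \<mu> \<sigma>)). h \<le> \<bar>x - \<mu>\<bar>}
     \<le> (\<integral>x. (x - \<mu>)\<^sup>2 \<partial>density lborel (normal_density \<mu> \<sigma>)) / h\<^sup>2"
  proof (rule N.second_moment_method)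
    show "integrable (density lborel (normal_density \<mu> \<sigma>)) (\<lambda>x. (x - \<mu>)\<^sup>2)"
      by (subst integrable_real_density) (use integrable_normal_moment[OF assms(1)] in auto)
  qed (use assms in auto)
  also have "(\<integral>x. (x - \<mu>)\<^sup>2 \<partial>density lborel (normal_density \<mu> \<sigma>)) = \<sigma>\<^sup>2"
    by (subst integral_real_density) (use integral_normal_moment_even[OF assms(1), of \<mu> 1] in \<open>auto simp: numeral_2_eq_2\<close>)
  finally show ?thesis by simp
qed

lemma gauss_interval_pos:
  assumes "x < y" shows "0 < measure (gauss m) {x<..<y}"
proof (rule ccontr)
  interpret prob_space "gauss m" by (rule prob_space_gauss)
  assume "\<not> 0 < measure (gauss m) {x<..<y}"
  then have "measure (gauss m) {x<..<y} = 0" using measure_nonneg[of "gauss m" "{x<..<y}"] by linarith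
  then have "emeasure (gauss m) {x<..<y} = 0" by (simp add: emeasure_eq_measure)
  then have "(\<integral>\<^sup>+u. ennreal (normal_density m 1 u) * indicator {x<..<y} u \<partial>lborel) = 0"
    unfolding gauss_def by (subst (asm) emeasure_density) auto
  then have "AE u in lborel. ennreal (normal_density m 1 u) * indicator {x<..<y} u = 0"
    by (subst (asm) nn_integral_0_iff_AE) auto
  then have "AE u in lborel. u \<notin> {x<..<y}"
  proof eventually_elim
    case (elim u)
    have "0 < normal_density m 1 u" by (simp add: normal_density_pos)
    with elim show ?case by (auto simp: ennreal_eq_0_iff split: split_indicator_asm)
  qed
  then have "emeasure lborel {x<..<y} = 0" by (subst (asm) AE_iff_measurable[of "{x<..<y}"]) auto
  then show False using assms by simp
qed

lemma measure_pair_times: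
  assumes "prob_space M" "prob_space N" "A \<in> sets M" "B \<in> sets N"
  shows "measure (M \<Otimes>\<^sub>M N) (A \<times> B) = measure M A * measure N B"
proof -
  interpret N: prob_space N by fact
  show ?thesis using assms by (simp add: measure_def N.emeasure_pair_measure_Times enn2real_mult)
qed

lemma gauss_rectangle_pos:
  assumes "x < y" "x' < y'" shows "0 < measure (gauss m \<Otimes>\<^sub>M gauss m') ({x<..<y} \<times> {x'<..<y'})"
proof -
  interpret A: prob_space "gauss m" by (rule prob_space_gauss)
  interpret B: prob_space "gauss m'" by (rule prob_space_gauss)
  have "measure (gauss m \<Otimes>\<^sub>M gauss m') ({x<..<y} \<times> {x'<..<y'}) = measure (gauss m) {x<..<y} * measure (gauss m') {x'<..<y'}"
    by (rule measure_pair_times) (auto intro: prob_space_gauss)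
  then show ?thesis using gauss_interval_pos assms by simp
qed

text \<open>
  Both the event and its complement contain a rectangle of positive probability: large \<open>u\<close>
  with bounded \<open>v\<close>, and large \<open>v\<close> with bounded \<open>u\<close>. The second uses \<open>sqrt s < sqrt (r + s)\<close>.
\<close>
lemma null_survival_strict:
  assumes r: "0 < r" and s: "0 \<le> s"
  shows "0 < null_survival n r s t" "null_survival n r s t < 1"
proof -
  define m where "m = sqrt (2 * (r + s) * ln (real n))"
  interpret A: prob_space "gauss 0" by (rule prob_space_gauss)
  interpret B: prob_space "gauss m" by (rule prob_space_gauss)
  interpret pair_prob_space "gauss 0" "gauss m" by standard
  have S: "null_survival n r s t = measure (gauss 0 \<Otimes>\<^sub>M gauss m) (null_event r s t)"
    using null_survival_one_sided[of 1 n r s t] by (simp add: m_def)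
  have ne: "null_event r s t \<in> sets (gauss 0 \<Otimes>\<^sub>M gauss m)" by measurable
  have rs: "sqrt s < sqrt (r + s)" using r by simp
  define K where "K = max 0 ((t + sqrt (r + s)) / sqrt r)"
  have K: "0 \<le> K" "t + sqrt (r + s) \<le> sqrt r * K"
    using r by (auto simp: K_def max_def field_simps not_le)
  have "{K<..<K+1} \<times> {0<..<1} \<subseteq> null_event r s t"
  proof clarify
    fix u v :: real assume u: "u \<in> {K<..<K+1}" and v: "v \<in> {0<..<1}"
    have "sqrt r * K < sqrt r * u" using u r by simp
    moreover have "0 \<le> sqrt s * v" using v s by simp
    moreover have "sqrt (r + s) * v \<le> sqrt (r + s) * 1" using v r s by (intro mult_left_mono) auto
    moreover have "sqrt r * u + sqrt s * v \<le> \<bar>sqrt r * u + sqrt s * v\<bar>" by simp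
    ultimately have "t < \<bar>sqrt r * u + sqrt s * v\<bar> - sqrt (r + s) * v" using K by linarith
    then show "(u, v) \<in> null_event r s t" using v by (simp add: null_event_def)
  qed
  from finite_measure_mono[OF this ne] gauss_rectangle_pos[of K "K+1" 0 1 0 m]
  show "0 < null_survival n r s t" unfolding S by simp
  define L where "L = max 0 ((sqrt r - t) / (sqrt (r + s) - sqrt s))"
  have L: "0 \<le> L" "sqrt r - t \<le> (sqrt (r + s) - sqrt s) * L"
    using rs by (auto simp: L_def max_def field_simps not_le)
  have sub: "{0<..<1} \<times> {L<..<L+1} \<subseteq> space (gauss 0 \<Otimes>\<^sub>M gauss m) - null_event r s t"
  proof (clarsimp simp: space_pair_measure)
    fix u v :: real assume u: "0 < u" "u < 1" and v: "L < v" "v < L + 1" and uv: "(u, v) \<in> null_event r s t"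
    have "sqrt r * u \<le> sqrt r * 1" using u r by (intro mult_left_mono) auto
    moreover have "(sqrt (r + s) - sqrt s) * L \<le> (sqrt (r + s) - sqrt s) * v" using v rs by (intro mult_left_mono) auto
    moreover have "0 \<le> sqrt r * u" "0 \<le> sqrt s * v" "0 < v" using u v L r s by (auto intro!: mult_nonneg_nonneg)
    ultimately have "\<bar>sqrt r * u + sqrt s * v\<bar> - sqrt (r + s) * \<bar>v\<bar> \<le> t" using L(2)
      by (simp add: left_diff_distrib)
    then show False using uv by (simp add: null_event_def)
  qed
  from finite_measure_mono[OF sub sets.compl_sets[OF ne]] gauss_rectangle_pos[of 0 1 L "L+1" 0 m]
  have "0 < prob (space (gauss 0 \<Otimes>\<^sub>M gauss m) - null_event r s t)" by auto
  then show "null_survival n r s t < 1" unfolding S using prob_compl[OF ne] by simp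
qed

context calibrated
begin

definition "S t = null_survival n r s t"

lemma S_strict: "0 < S t" "S t < 1"
  using null_survival_strict[OF r s] by (auto simp: S_def)

text \<open>
  For opposite labels the difference of the two scores has mean \<open>e * D\<^sup>2\<close> and the sum has
  mean \<open>e * (a\<^sup>2 - b\<^sup>2)\<close>, so \<open>C\<close> is centred near \<open>D\<^sup>2 - \<bar>a\<^sup>2 - b\<^sup>2\<bar> = \<rho> * l\<^sup>2\<close>, while its
  fluctuations are of the smaller order \<open>l\<close>. Chebyshev's inequality is enough.
\<close>
lemma flipped_concentration:
  assumes e: "e\<^sup>2 = 1" and \<kappa>: "0 < \<kappa>"
  shows "measure (G e (- e)) {w \<in> space (G e (- e)). \<kappa> * l\<^sup>2 \<le> \<bar>C w - \<rho> * l\<^sup>2\<bar>} \<le> 16 * (r + s) / (\<kappa>\<^sup>2 * l\<^sup>2)"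
proof -
  interpret prob_space "G e (- e)" by (rule prob_space_pair_law)
  define h where "h = \<kappa> * l\<^sup>2 / 4"
  have h: "0 < h" using \<kappa> l_pos by (simp add: h_def)
  let ?N1 = "density lborel (normal_density (e * a\<^sup>2) a)" and ?N2 = "density lborel (normal_density (- e * b\<^sup>2) b)"
  let ?T = "\<lambda>(x, y). (dotp p \<theta> x, dotp q \<eta> y)"
  interpret N1: prob_space ?N1 by (rule prob_space_normal_density[OF ab_pos(1)])
  interpret N2: prob_space ?N2 by (rule prob_space_normal_density[OF ab_pos(2)])
  define E1 where "E1 = {x :: real. h \<le> \<bar>x - e * a\<^sup>2\<bar>} \<times> (UNIV :: real set)"
  define E2 where "E2 = (UNIV :: real set) \<times> {y :: real. h \<le> \<bar>y - (- e * b\<^sup>2)\<bar>}"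
  have [measurable]: "E1 \<in> sets (borel \<Otimes>\<^sub>M borel)" "E2 \<in> sets (borel \<Otimes>\<^sub>M borel)"
    unfolding E1_def E2_def by (auto intro!: pair_measureI)
  define F where "F E = ?T -` E \<inter> space (G e (- e))" for E :: "(real \<times> real) set"
  have Fm: "F E \<in> sets (G e (- e))" if "E \<in> sets (borel \<Otimes>\<^sub>M borel)" for E
    unfolding F_def by (rule measurable_sets[OF _ that]) measurable
  have FE: "prob (F E) = measure (?N1 \<Otimes>\<^sub>M ?N2) E" if "E \<in> sets (borel \<Otimes>\<^sub>M borel)" for E
    unfolding F_def joint_scores[of e "- e", symmetric] by (rule measure_distr[symmetric]) (use that in auto)
  have m1: "measure (?N1 \<Otimes>\<^sub>M ?N2) E1 \<le> a\<^sup>2 / h\<^sup>2"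
  proof -
    have "measure (?N1 \<Otimes>\<^sub>M ?N2) E1 = measure ?N1 {x. h \<le> \<bar>x - e * a\<^sup>2\<bar>} * measure ?N2 UNIV"
      unfolding E1_def by (rule measure_pair_times[OF N1.prob_space_axioms N2.prob_space_axioms]) auto
    then show ?thesis using normal_chebyshev[OF ab_pos(1) h] N2.prob_space by simp
  qed
  have m2: "measure (?N1 \<Otimes>\<^sub>M ?N2) E2 \<le> b\<^sup>2 / h\<^sup>2"
  proof -
    have "measure (?N1 \<Otimes>\<^sub>M ?N2) E2 = measure ?N1 UNIV * measure ?N2 {y. h \<le> \<bar>y - (- e * b\<^sup>2)\<bar>}"
      unfolding E2_def by (rule measure_pair_times[OF N1.prob_space_axioms N2.prob_space_axioms]) auto
    then show ?thesis using normal_chebyshev[OF ab_pos(2) h, of "- e * b\<^sup>2"] N1.prob_space by simp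
  qed
  have "{w \<in> space (G e (- e)). \<kappa> * l\<^sup>2 \<le> \<bar>C w - \<rho> * l\<^sup>2\<bar>} \<subseteq> F E1 \<union> F E2"
  proof
    fix w assume w: "w \<in> {w \<in> space (G e (- e)). \<kappa> * l\<^sup>2 \<le> \<bar>C w - \<rho> * l\<^sup>2\<bar>}"
    obtain x y where xy: "w = (x, y)" by (cases w)
    define X Y where "X = dotp p \<theta> x" and "Y = dotp q \<eta> y"
    show "w \<in> F E1 \<union> F E2"
    proof (rule ccontr)
      assume "w \<notin> F E1 \<union> F E2"
      then have n: "\<bar>X - e * a\<^sup>2\<bar> < h" "\<bar>Y - (- e * b\<^sup>2)\<bar> < h"
        using w by (auto simp: F_def E1_def E2_def xy X_def Y_def)
      have i: "\<bar>e * z\<bar> = \<bar>z\<bar>" for z using e by (elim square_one_cases) auto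
      have p1: "\<bar>\<bar>X - Y\<bar> - D\<^sup>2\<bar> \<le> \<bar>X - e * a\<^sup>2\<bar> + \<bar>Y - (- e * b\<^sup>2)\<bar>"
      proof -
        have "D\<^sup>2 = \<bar>e * (a\<^sup>2 + b\<^sup>2)\<bar>" unfolding i D_sq by simp
        then have "\<bar>\<bar>X - Y\<bar> - D\<^sup>2\<bar> \<le> \<bar>(X - Y) - e * (a\<^sup>2 + b\<^sup>2)\<bar>" by (simp only: abs_triangle_ineq3)
        also have "(X - Y) - e * (a\<^sup>2 + b\<^sup>2) = (X - e * a\<^sup>2) - (Y - (- e * b\<^sup>2))" by (simp add: algebra_simps)
        also have "\<bar>\<dots>\<bar> \<le> \<bar>X - e * a\<^sup>2\<bar> + \<bar>Y - (- e * b\<^sup>2)\<bar>" by (rule abs_triangle_ineq4)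
        finally show ?thesis .
      qed
      have p2: "\<bar>\<bar>X + Y\<bar> - \<bar>a\<^sup>2 - b\<^sup>2\<bar>\<bar> \<le> \<bar>X - e * a\<^sup>2\<bar> + \<bar>Y - (- e * b\<^sup>2)\<bar>"
      proof -
        have "\<bar>a\<^sup>2 - b\<^sup>2\<bar> = \<bar>e * (a\<^sup>2 - b\<^sup>2)\<bar>" unfolding i ..
        then have "\<bar>\<bar>X + Y\<bar> - \<bar>a\<^sup>2 - b\<^sup>2\<bar>\<bar> \<le> \<bar>(X + Y) - e * (a\<^sup>2 - b\<^sup>2)\<bar>" by (simp only: abs_triangle_ineq3)
        also have "(X + Y) - e * (a\<^sup>2 - b\<^sup>2) = (X - e * a\<^sup>2) + (Y - (- e * b\<^sup>2))" by (simp add: algebra_simps)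
        also have "\<bar>\<dots>\<bar> \<le> \<bar>X - e * a\<^sup>2\<bar> + \<bar>Y - (- e * b\<^sup>2)\<bar>" by (rule abs_triangle_ineq)
        finally show ?thesis .
      qed
      have Cw: "C w = \<bar>X - Y\<bar> - \<bar>X + Y\<bar>" by (simp add: xy C_minus_def X_def Y_def)
      have q1: "\<bar>\<bar>X - Y\<bar> - D\<^sup>2\<bar> < 2 * h" using p1 n by linarith
      have q2: "\<bar>\<bar>X + Y\<bar> - \<bar>a\<^sup>2 - b\<^sup>2\<bar>\<bar> < 2 * h" using p2 n by linarith
      have "\<bar>C w - \<rho> * l\<^sup>2\<bar> < 4 * h"
        unfolding Cw gap[symmetric] using q1 q2 unfolding abs_less_iff by linarith
      then show False using w by (simp add: h_def)
    qed
  qed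
  then have "prob {w \<in> space (G e (- e)). \<kappa> * l\<^sup>2 \<le> \<bar>C w - \<rho> * l\<^sup>2\<bar>} \<le> prob (F E1 \<union> F E2)"
    by (rule finite_measure_mono) (use Fm in auto)
  also have "\<dots> \<le> prob (F E1) + prob (F E2)"
    by (rule measure_Un_le) (use Fm in auto)
  also have "\<dots> \<le> a\<^sup>2 / h\<^sup>2 + b\<^sup>2 / h\<^sup>2"
    using m1 m2 by (simp add: FE add_mono)
  also have "\<dots> = D\<^sup>2 / h\<^sup>2" by (simp add: D_sq add_divide_distrib)
  also have "\<dots> = 16 * (r + s) / (\<kappa>\<^sup>2 * l\<^sup>2)"
  proof -
    have "D\<^sup>2 = (r + s) * l\<^sup>2" unfolding D_eq using r s by (simp add: power_mult_distrib)
    then show ?thesis using l_pos \<kappa> by (simp add: h_def power2_eq_square field_simps)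
  qed
  finally show ?thesis .
qed

text \<open>
  The likelihood ratio of \<open>G e f\<close> against pure noise, for \<open>e\<close> and \<open>f\<close> in \<open>{-1, 1}\<close>. The
  functions \<open>g0\<close> and \<open>g1\<close> below are the corresponding densities when the two labels are
  equal, respectively opposite, and the first of them is uniform.
\<close>
definition dens :: "real \<Rightarrow> real \<Rightarrow> rvec \<times> rvec \<Rightarrow> real" where
  "dens e f w = exp (e * dotp p \<theta> (fst w) + f * dotp q \<eta> (snd w) - D\<^sup>2 / 2)"

definition "g0 w = (dens 1 1 w + dens (-1) (-1) w) / 2"
definition "g1 w = (dens 1 (-1) w + dens (-1) 1 w) / 2"

lemma dens_pos: "0 < dens e f w" by (simp add: dens_def)

lemma dens_measurable [measurable]:
  "dens e f \<in> borel_measurable ((\<Pi>\<^sub>M j\<in>{..<p}. borel) \<Otimes>\<^sub>M (\<Pi>\<^sub>M j\<in>{..<q}. borel))"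
  unfolding dens_def[abs_def] by measurable

lemma g0_pos: "0 < g0 w" and g1_pos: "0 < g1 w"
  using dens_pos by (auto simp: g0_def g1_def add_pos_pos)

lemma g_measurable [measurable]:
  "g0 \<in> borel_measurable ((\<Pi>\<^sub>M j\<in>{..<p}. borel) \<Otimes>\<^sub>M (\<Pi>\<^sub>M j\<in>{..<q}. borel))"
  "g1 \<in> borel_measurable ((\<Pi>\<^sub>M j\<in>{..<p}. borel) \<Otimes>\<^sub>M (\<Pi>\<^sub>M j\<in>{..<q}. borel))"
  unfolding g0_def[abs_def] g1_def[abs_def] by measurable

lemma G_dens: "e\<^sup>2 = 1 \<Longrightarrow> f\<^sup>2 = 1 \<Longrightarrow> G e f = density (G 0 0) (\<lambda>w. ennreal (dens e f w))"
  using pair_law_density[of e f p q \<theta> \<eta>] by (simp add: dens_def D_sq a_def b_def)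

lemma cosh_bounds: "exp \<bar>x\<bar> \<le> exp x + exp (- x)" "exp x + exp (- x) \<le> 2 * exp \<bar>x\<bar>" for x :: real
proof -
  show "exp \<bar>x\<bar> \<le> exp x + exp (- x)" by (cases "0 \<le> x") auto
  have "exp x \<le> exp \<bar>x\<bar>" "exp (- x) \<le> exp \<bar>x\<bar>" by auto
  then show "exp x + exp (- x) \<le> 2 * exp \<bar>x\<bar>" by linarith
qed

lemma g_formulas:
  "g0 w = exp (- D\<^sup>2 / 2) * (exp (dotp p \<theta> (fst w) + dotp q \<eta> (snd w)) + exp (- (dotp p \<theta> (fst w) + dotp q \<eta> (snd w)))) / 2"
  "g1 w = exp (- D\<^sup>2 / 2) * (exp (dotp p \<theta> (fst w) - dotp q \<eta> (snd w)) + exp (- (dotp p \<theta> (fst w) - dotp q \<eta> (snd w)))) / 2"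
  by (simp_all add: g0_def g1_def dens_def exp_add[symmetric] distrib_left algebra_simps)

lemma C_exp: "exp (C w) * exp \<bar>dotp p \<theta> (fst w) + dotp q \<eta> (snd w)\<bar> = exp \<bar>dotp p \<theta> (fst w) - dotp q \<eta> (snd w)\<bar>"
  by (simp add: C_minus_def case_prod_beta' exp_add[symmetric])

lemma scale_upper: "K / 2 * x \<le> K / 2 * (2 * E * y) \<Longrightarrow> K * x / 2 \<le> 2 * E * (K * y / 2)" for K E x y :: real
  by (simp add: mult.assoc mult.left_commute)

lemma scale_lower: "K / 2 * (E * y) \<le> K / 2 * (2 * x) \<Longrightarrow> E * (K * y / 2) \<le> 2 * (K * x / 2)" for K E x y :: real
  by (simp add: mult.assoc mult.left_commute)

text \<open>
  The ratio \<open>g1 / g0\<close> is a quotient of two hyperbolic cosines, taken at the difference and at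
  the sum of the scores; hence \<open>C\<close> is its logarithm up to \<open>ln 2\<close>.
\<close>
lemma likelihood_ratio_upper: "g1 w \<le> 2 * exp (C w) * g0 w"
proof -
  let ?X = "dotp p \<theta> (fst w)" and ?Y = "dotp q \<eta> (snd w)"
  have "exp (?X - ?Y) + exp (- (?X - ?Y)) \<le> 2 * exp \<bar>?X - ?Y\<bar>" by (rule cosh_bounds)
  also have "\<dots> = 2 * exp (C w) * exp \<bar>?X + ?Y\<bar>" using C_exp[of w] by simp
  also have "\<dots> \<le> 2 * exp (C w) * (exp (?X + ?Y) + exp (- (?X + ?Y)))"
    by (intro mult_left_mono cosh_bounds) auto
  finally have "exp (- D\<^sup>2 / 2) / 2 * (exp (?X - ?Y) + exp (- (?X - ?Y)))
     \<le> exp (- D\<^sup>2 / 2) / 2 * (2 * exp (C w) * (exp (?X + ?Y) + exp (- (?X + ?Y))))"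
    by (intro mult_left_mono) auto
  then show ?thesis unfolding g_formulas by (rule scale_upper)
qed

lemma likelihood_ratio_lower: "exp (C w) * g0 w \<le> 2 * g1 w"
proof -
  let ?X = "dotp p \<theta> (fst w)" and ?Y = "dotp q \<eta> (snd w)"
  have "exp (C w) * (exp (?X + ?Y) + exp (- (?X + ?Y))) \<le> exp (C w) * (2 * exp \<bar>?X + ?Y\<bar>)"
    by (intro mult_left_mono cosh_bounds) auto
  also have "\<dots> = 2 * exp \<bar>?X - ?Y\<bar>" using C_exp[of w] by simp
  also have "\<dots> \<le> 2 * (exp (?X - ?Y) + exp (- (?X - ?Y)))"
    by (intro mult_left_mono cosh_bounds) auto
  finally have "exp (- D\<^sup>2 / 2) / 2 * (exp (C w) * (exp (?X + ?Y) + exp (- (?X + ?Y))))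
     \<le> exp (- D\<^sup>2 / 2) / 2 * (2 * (exp (?X - ?Y) + exp (- (?X - ?Y))))"
    by (intro mult_left_mono) auto
  then show ?thesis unfolding g_formulas by (rule scale_lower)
qed

lemma ennreal_average:
  assumes "0 \<le> x" "0 \<le> y"
  shows "ennreal ((x + y) / 2) = ennreal (1/2) * (ennreal x + ennreal y)"
proof -
  have "ennreal (1/2) * (ennreal x + ennreal y) = ennreal (1/2) * ennreal (x + y)"
    using assms by (subst ennreal_plus) auto
  also have "\<dots> = ennreal (1/2 * (x + y))" using assms by (intro ennreal_mult[symmetric]) auto
  finally show ?thesis by simp
qed

lemma mixture_measure:
  assumes e: "e\<^sup>2 = 1" "f\<^sup>2 = 1" and X: "X \<in> sets (G 0 0)"
  shows "(\<integral>\<^sup>+w. ennreal ((dens e f w + dens (- e) (- f) w) / 2) * indicator X w \<partial>G 0 0)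
    = ennreal ((measure (G e f) X + measure (G (- e) (- f)) X) / 2)"
proof -
  interpret A: prob_space "G e f" by (rule prob_space_pair_law)
  interpret B: prob_space "G (- e) (- f)" by (rule prob_space_pair_law)
  have X': "X \<in> sets ((\<Pi>\<^sub>M j\<in>{..<p}. borel) \<Otimes>\<^sub>M (\<Pi>\<^sub>M j\<in>{..<q}. borel))" using X by simp
  note [measurable] = X'
  have 1: "emeasure (G e f) X = (\<integral>\<^sup>+w. ennreal (dens e f w) * indicator X w \<partial>G 0 0)"
    using e by (subst G_dens) (auto intro!: emeasure_density)
  have 2: "emeasure (G (- e) (- f)) X = (\<integral>\<^sup>+w. ennreal (dens (- e) (- f) w) * indicator X w \<partial>G 0 0)"
    using e by (subst G_dens) (auto intro!: emeasure_density)
  have "(\<integral>\<^sup>+w. ennreal ((dens e f w + dens (- e) (- f) w) / 2) * indicator X w \<partial>G 0 0)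
     = (\<integral>\<^sup>+w. ennreal (1/2) * (ennreal (dens e f w) * indicator X w + ennreal (dens (- e) (- f) w) * indicator X w) \<partial>G 0 0)"
  proof (rule nn_integral_cong)
    fix w
    have "ennreal ((dens e f w + dens (- e) (- f) w) / 2) = ennreal (1/2) * (ennreal (dens e f w) + ennreal (dens (- e) (- f) w))"
      by (intro ennreal_average less_imp_le dens_pos)
    then show "ennreal ((dens e f w + dens (- e) (- f) w) / 2) * indicator X w
      = ennreal (1/2) * (ennreal (dens e f w) * indicator X w + ennreal (dens (- e) (- f) w) * indicator X w)"
      by (simp only: distrib_right mult.assoc)
  qed
  also have "\<dots> = ennreal (1/2) * (emeasure (G e f) X + emeasure (G (- e) (- f)) X)"
    unfolding 1 2 by (subst nn_integral_cmult, measurable, subst nn_integral_add, measurable)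
  also have "\<dots> = ennreal ((measure (G e f) X + measure (G (- e) (- f)) X) / 2)"
    unfolding A.emeasure_eq_measure B.emeasure_eq_measure
    by (rule ennreal_average[symmetric]) auto
  finally show ?thesis .
qed

text \<open>
  A change of measure: on the event, \<open>g0\<close> is at most \<open>2 * exp (- t * l) * g1\<close>, and \<open>g1\<close>
  integrates to one.
\<close>
lemma S_tail: "S t \<le> 2 * exp (- (t * l))"
proof -
  define X where "X = {w \<in> space (G 0 0). t * l < C w}"
  have X[measurable]: "X \<in> sets (G 0 0)" unfolding X_def by measurable
  have sp: "space (G e f) = space (G 0 0)" for e f by (rule space_pair_law)
  have "ennreal (S t) = (\<integral>\<^sup>+w. ennreal (g0 w) * indicator X w \<partial>G 0 0)"
    using mixture_measure[of 1 1 X] null_law[of 1 t] null_law[of "-1" t] X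
    by (simp add: sp[of 1 1] sp[of "-1" "-1"] X_def S_def g0_def)
  also have "\<dots> \<le> (\<integral>\<^sup>+w. ennreal (2 * exp (- (t * l))) * ennreal (g1 w) \<partial>G 0 0)"
  proof (rule nn_integral_mono)
    fix w
    show "ennreal (g0 w) * indicator X w \<le> ennreal (2 * exp (- (t * l))) * ennreal (g1 w)"
    proof (cases "w \<in> X")
      case True
      then have "exp (t * l) * g0 w \<le> exp (C w) * g0 w"
        using g0_pos[of w] by (intro mult_right_mono) (auto simp: X_def)
      also note likelihood_ratio_lower
      finally have "exp (- (t * l)) * (exp (t * l) * g0 w) \<le> exp (- (t * l)) * (2 * g1 w)"
        by (intro mult_left_mono) auto
      moreover have "exp (- (t * l)) * (exp (t * l) * g0 w) = g0 w" by (simp add: exp_minus)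
      ultimately have "g0 w \<le> 2 * exp (- (t * l)) * g1 w" by simp
      then show ?thesis using True g1_pos[of w] by (simp add: ennreal_mult[symmetric] ennreal_leI)
    qed simp
  qed
  also have "\<dots> = ennreal (2 * exp (- (t * l))) * (\<integral>\<^sup>+w. ennreal (g1 w) * indicator (space (G 0 0)) w \<partial>G 0 0)"
    by (subst nn_integral_cmult[symmetric], measurable) (auto intro!: nn_integral_cong)
  also have "(\<integral>\<^sup>+w. ennreal (g1 w) * indicator (space (G 0 0)) w \<partial>G 0 0) = 1"
  proof -
    have "measure (G e f) (space (G 0 0)) = 1" for e f
      unfolding sp[of e f, symmetric] by (rule prob_space.prob_space[OF prob_space_pair_law])
    then show ?thesis using mixture_measure[of 1 "-1" "space (G 0 0)", OF _ _ sets.top] by (simp add: g1_def)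
  qed
  finally show ?thesis by simp
qed

end

section \<open>Error bounds for the higher criticism statistic\<close>

lemma eventually_at_right_rational:
  assumes "eventually P (at_right (t :: real))" shows "\<exists>x\<in>\<rat>. P x"
proof -
  obtain b where b: "b > t" "\<And>y. y > t \<Longrightarrow> y < b \<Longrightarrow> P y"
    using assms by (auto simp: eventually_at_right_field)
  obtain x where "x \<in> \<rat>" "t < x" "x < b" using Rats_dense_in_real[OF b(1)] by auto
  with b(2) show ?thesis by blast
qed

text \<open>
  For a right-continuous family this reduces the supremum over all thresholds to a countable
  one. This gives both the measurability of the statistic and access to finite subfamilies of
  thresholds.
\<close>
lemma SUP_ereal_rational:
  fixes f :: "real \<Rightarrow> real"
  assumes "\<And>t. (f \<longlongrightarrow> f t) (at_right t)"
  shows "(SUP t. ereal (f t)) = (SUP t\<in>\<rat>. ereal (f t))"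
proof (rule antisym)
  show "(SUP t. ereal (f t)) \<le> (SUP t\<in>\<rat>. ereal (f t))"
  proof (rule SUP_least)
    fix t :: real
    show "ereal (f t) \<le> (SUP t\<in>\<rat>. ereal (f t))"
    proof (rule ccontr)
      assume "\<not> ereal (f t) \<le> (SUP t\<in>\<rat>. ereal (f t))"
      then have "(SUP t\<in>\<rat>. ereal (f t)) < ereal (f t)" by simp
      moreover have "((\<lambda>x. ereal (f x)) \<longlongrightarrow> ereal (f t)) (at_right t)"
        using assms by (intro tendsto_ereal)
      ultimately have "eventually (\<lambda>x. (SUP t\<in>\<rat>. ereal (f t)) < ereal (f x)) (at_right t)"
        by (rule order_tendstoD(1)[rotated])
      then obtain x where "x \<in> \<rat>" "(SUP t\<in>\<rat>. ereal (f t)) < ereal (f x)"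
        using eventually_at_right_rational by blast
      then show False by (metis SUP_upper not_le)
    qed
  qed
qed (rule SUP_subset_mono, auto)

context calibrated
begin

definition "Q = distr (G 1 1) borel (\<lambda>w. C w / l)"

lemma scaled_measurable: "(\<lambda>w. C w / l) \<in> borel_measurable (G e f)"
  by measurable

lemma survival_scaled:
  assumes "e\<^sup>2 = 1" shows "measure (distr (G e e) borel (\<lambda>w. C w / l)) {t<..} = S t"
proof -
  have "measure (distr (G e e) borel (\<lambda>w. C w / l)) {t<..} = measure (G e e) ((\<lambda>w. C w / l) -` {t<..} \<inter> space (G e e))"
    by (rule measure_distr[OF scaled_measurable]) simp
  also have "(\<lambda>w. C w / l) -` {t<..} \<inter> space (G e e) = {w \<in> space (G e e). t * l < C w}"
    using l_pos by (auto simp: field_simps)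
  finally show ?thesis using null_law[OF assms] by (simp add: S_def)
qed

lemma prob_scaled: "prob_space (distr (G e f) borel (\<lambda>w. C w / l))"
  by (rule prob_space.prob_space_distr[OF prob_space_pair_law scaled_measurable])

lemma real_distribution_scaled: "real_distribution (distr (G e f) borel (\<lambda>w. C w / l))"
  using prob_scaled by (auto simp: real_distribution_def real_distribution_axioms_def)

lemma cdf_scaled: "e\<^sup>2 = 1 \<Longrightarrow> cdf (distr (G e e) borel (\<lambda>w. C w / l)) t = 1 - S t"
proof -
  assume e: "e\<^sup>2 = 1"
  interpret D: prob_space "distr (G e e) borel (\<lambda>w. C w / l)" by (rule prob_scaled)
  have "{..t} = space (distr (G e e) borel (\<lambda>w. C w / l)) - {t<..}" by auto
  then show ?thesis using D.prob_compl[of "{t<..}"] survival_scaled[OF e, of t] by (simp add: cdf_def)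
qed

lemma distr_scaled: "e\<^sup>2 = 1 \<Longrightarrow> distr (G e e) borel (\<lambda>w. C w / l) = Q"
  unfolding Q_def by (rule cdf_unique[OF real_distribution_scaled real_distribution_scaled])
    (simp add: fun_eq_iff cdf_scaled)

lemma Q_props: "prob_space Q" "sets Q = sets borel" "measure Q {t<..} = S t"
  using prob_scaled survival_scaled[of 1] by (auto simp: Q_def)

lemma S_right_continuous: "(S \<longlongrightarrow> S t) (at_right t)"
proof -
  interpret real_distribution Q unfolding Q_def by (rule real_distribution_scaled)
  have "continuous (at_right t) (cdf Q)" by (rule cdf_is_right_cont)
  then have "((\<lambda>x. 1 - cdf Q x) \<longlongrightarrow> 1 - cdf Q t) (at_right t)"
    by (intro tendsto_intros) (simp add: continuous_within)
  then show ?thesis using cdf_scaled[of 1] by (simp add: Q_def)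
qed

definition "hc_ratio \<omega> t = \<bar>(\<Sum>i<n. of_bool (C (\<omega> i) > t * l)) - real n * S t\<bar> / sqrt (real n * S t * (1 - S t))"

lemma HC_stat_eq: "HC_stat n r s C \<omega> = (SUP t. ereal (hc_ratio \<omega> t))"
  by (simp add: HC_stat_def hc_ratio_def S_def l_def)

lemma hc_ratio_right_continuous: "(hc_ratio \<omega> \<longlongrightarrow> hc_ratio \<omega> t) (at_right t)"
proof -
  have ind: "((\<lambda>x. of_bool (c > x * l) :: real) \<longlongrightarrow> of_bool (c > t * l)) (at_right t)" for c :: real
  proof (rule tendsto_eventually)
    show "eventually (\<lambda>x. (of_bool (c > x * l) :: real) = of_bool (c > t * l)) (at_right t)"
    proof (cases "c > t * l")
      case True
      then have "t < c / l" using l_pos by (simp add: field_simps)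
      then have "eventually (\<lambda>x. x \<in> {t<..<c / l}) (at_right t)" by (rule eventually_at_right_real)
      then show ?thesis by eventually_elim (use True l_pos in \<open>auto simp: field_simps\<close>)
    next
      case False
      have "eventually (\<lambda>x. t < x) (at_right t)" by (rule eventually_at_right_less)
      then show ?thesis
      proof eventually_elim
        case (elim x)
        then have "t * l < x * l" using l_pos by simp
        then show ?case using False by auto
      qed
    qed
  qed
  have "real n * S t * (1 - S t) \<noteq> 0" using S_strict[of t] n by auto
  then show ?thesis unfolding hc_ratio_def
    by (intro tendsto_intros ind S_right_continuous) auto
qed

lemma HC_stat_rational: "HC_stat n r s C \<omega> = (SUP t\<in>\<rat>. ereal (hc_ratio \<omega> t))"
  unfolding HC_stat_eq by (rule SUP_ereal_rational[OF hc_ratio_right_continuous])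

lemma hc_ratio_measurable [measurable]: "(\<lambda>\<omega>. hc_ratio \<omega> t) \<in> borel_measurable (data_space n p q)"
  unfolding hc_ratio_def data_space_def by measurable

lemma HC_stat_measurable [measurable]: "HC_stat n r s C \<in> borel_measurable (data_space n p q)"
  unfolding HC_stat_rational[abs_def] by (intro borel_measurable_SUP countable_rat) measurable

lemma HC_stat_gt_iff: "ereal lam < HC_stat n r s C \<omega> \<longleftrightarrow>
   (\<exists>t\<in>\<rat>. lam * sqrt (real n * S t * (1 - S t)) < \<bar>(\<Sum>i<n. of_bool (C (\<omega> i) > t * l)) - real n * S t\<bar>)"
proof -
  have "0 < sqrt (real n * S t * (1 - S t))" for t using S_strict[of t] n by auto
  then show ?thesis unfolding HC_stat_rational less_SUP_iff hc_ratio_def by (simp add: pos_less_divide_eq)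
qed

text \<open>
  When the labels agree, all \<open>n\<close> values of \<open>C / l\<close> have the same law \<open>Q\<close>, whatever the labels
  are, and the statistic is the standardised empirical process of a sample from \<open>Q\<close>.
\<close>
lemma type_I_bound:
  assumes z: "\<And>i. i < n \<Longrightarrow> (z i)\<^sup>2 = 1" and zs: "\<And>i. i < n \<Longrightarrow> \<sigma> i = z i"
    and lam: "2 \<le> lam" and \<epsilon>: "0 < \<epsilon>" "\<epsilon> \<le> 1 / 2"
  shows "measure (data_law n p q \<theta> \<eta> z \<sigma>) {\<omega> \<in> space (data_space n p q). ereal lam < HC_stat n r s C \<omega>}
    \<le> 2 * hc_half_err \<epsilon> n lam"
proof -
  define M where "M i = G (z i) (\<sigma> i)" for i
  define \<Phi> where "\<Phi> = compose {..<n} (\<lambda>w. C w / l)"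
  have PM: "data_law n p q \<theta> \<eta> z \<sigma> = PiM {..<n} M" by (simp add: data_law_eq_PiM M_def[abs_def])
  have dPhi: "distr (PiM {..<n} M) (PiM {..<n} (\<lambda>_. Q)) \<Phi> = PiM {..<n} (\<lambda>_. Q)"
  proof -
    have "distr (PiM {..<n} M) (PiM {..<n} (\<lambda>_. Q)) \<Phi> = PiM {..<n} (\<lambda>i. distr (M i) Q (\<lambda>w. C w / l))"
      unfolding \<Phi>_def
      by (rule distr_PiM_finite_prob_space') (auto simp: M_def prob_space_pair_law Q_props measurable_cong_sets[OF _ Q_props(2)])
    also have "\<dots> = PiM {..<n} (\<lambda>_. Q)"
    proof (rule PiM_cong[OF refl])
      fix i assume "i \<in> {..<n}"
      then have i: "i < n" by simp
      have "distr (M i) Q (\<lambda>w. C w / l) = distr (G (z i) (z i)) borel (\<lambda>w. C w / l)"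
        using zs[OF i] by (intro distr_cong) (auto simp: M_def Q_props)
      then show "distr (M i) Q (\<lambda>w. C w / l) = Q" using distr_scaled[OF z[OF i]] by simp
    qed
    finally show ?thesis .
  qed
  have Phim: "\<Phi> \<in> measurable (PiM {..<n} M) (PiM {..<n} (\<lambda>_. Q))"
    unfolding \<Phi>_def compose_def
    by (intro measurable_restrict measurable_compose[OF measurable_component_singleton])
       (auto simp: M_def measurable_cong_sets[OF _ Q_props(2)])
  define X where "X = {x \<in> space (PiM {..<n} (\<lambda>_. Q)). \<exists>t\<in>\<rat>. lam * sqrt (n * measure Q {t<..} * (1 - measure Q {t<..}))
             < \<bar>hits n {t<..} x - n * measure Q {t<..}\<bar>}"
  have Xm: "X \<in> sets (PiM {..<n} (\<lambda>_. Q))"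
  proof -
    have h[measurable]: "hits n {t<..} \<in> borel_measurable (PiM {..<n} (\<lambda>_. Q))" for t :: real
      by (rule hits_measurable) (simp add: Q_props)
    have "countable (\<rat> :: real set)" by (rule countable_rat)
    then show ?thesis unfolding X_def by measurable
  qed
  have "{\<omega> \<in> space (data_space n p q). ereal lam < HC_stat n r s C \<omega>} = \<Phi> -` X \<inter> space (PiM {..<n} M)"
  proof -
    have sp: "space (data_space n p q) = space (PiM {..<n} M)"
      unfolding PM[symmetric] space_data_law ..
    have hits_eq: "hits n {t<..} (\<Phi> \<omega>) = (\<Sum>i<n. of_bool (C (\<omega> i) > t * l))" for t \<omega>
      unfolding hits_def \<Phi>_def compose_def using l_pos
      by (intro sum.cong) (auto simp: indicator_def field_simps)
    show ?thesis
      using measurable_space[OF Phim]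
      by (auto simp: HC_stat_gt_iff X_def sp hits_eq Q_props)
  qed
  then have "measure (data_law n p q \<theta> \<eta> z \<sigma>) {\<omega> \<in> space (data_space n p q). ereal lam < HC_stat n r s C \<omega>}
     = measure (distr (PiM {..<n} M) (PiM {..<n} (\<lambda>_. Q)) \<Phi>) X"
    unfolding PM using measure_distr[OF Phim Xm] by simp
  also have "\<dots> \<le> 2 * hc_half_err \<epsilon> n lam"
    unfolding dPhi X_def by (rule hc_empirical_countable[OF Q_props(1,2) countable_rat lam _ \<epsilon>]) (use n in simp)
  finally show ?thesis .
qed

text \<open>
  A single mismatched pair suffices. At the threshold \<open>(\<rho> - \<kappa>) * l\<close> at most
  \<open>2 * n * exp (- (\<rho> - \<kappa>) * l\<^sup>2)\<close> exceedances are expected under the null law, and this is a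
  negative power of \<open>n\<close> if \<open>\<rho> - \<kappa> > 1 / 2\<close>. The mismatched pair exceeds the threshold with
  high probability, and one exceedance already makes the standardised deviation polynomially
  large.
\<close>
lemma type_II_bound:
  assumes i: "i < n" and z: "(z i)\<^sup>2 = 1" and zs: "\<sigma> i = - z i" and \<kappa>: "0 < \<kappa>" and lam: "0 \<le> lam"
    and y: "lam * sqrt (2 * real n * exp (- ((\<rho> - \<kappa>) * l\<^sup>2))) < 1 - 2 * real n * exp (- ((\<rho> - \<kappa>) * l\<^sup>2))"
  shows "measure (data_law n p q \<theta> \<eta> z \<sigma>) {\<omega> \<in> space (data_space n p q). \<not> ereal lam < HC_stat n r s C \<omega>}
    \<le> 16 * (r + s) / (\<kappa>\<^sup>2 * l\<^sup>2)"
proof -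
  define M where "M i = G (z i) (\<sigma> i)" for i
  have PM: "data_law n p q \<theta> \<eta> z \<sigma> = PiM {..<n} M" by (simp add: data_law_eq_PiM M_def[abs_def])
  interpret product_prob_space M "{..<n}"
    by (rule product_prob_spaceI) (simp add: M_def prob_space_pair_law)
  interpret P: prob_space "PiM {..<n} M" by (rule prob_space_PiM) (simp add: M_def prob_space_pair_law)
  define t where "t = (\<rho> - \<kappa>) * l"
  define Y where "Y = 2 * real n * exp (- ((\<rho> - \<kappa>) * l\<^sup>2))"
  have nS: "n * S t \<le> Y"
  proof -
    have "n * S t \<le> n * (2 * exp (- (t * l)))" by (intro mult_left_mono S_tail) auto
    then show ?thesis by (simp add: Y_def t_def power2_eq_square mult.assoc)
  qed
  define X where "X = {w \<in> space (M i). \<kappa> * l\<^sup>2 \<le> \<bar>C w - \<rho> * l\<^sup>2\<bar>}"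
  have Xm: "X \<in> sets (M i)" unfolding X_def M_def by measurable
  have sp: "space (data_space n p q) = space (PiM {..<n} M)"
    unfolding PM[symmetric] space_data_law ..
  have sub: "{\<omega> \<in> space (data_space n p q). \<not> ereal lam < HC_stat n r s C \<omega>} \<subseteq> (\<lambda>\<omega>. \<omega> i) -` X \<inter> space (PiM {..<n} M)"
  proof
    fix \<omega> assume w: "\<omega> \<in> {\<omega> \<in> space (data_space n p q). \<not> ereal lam < HC_stat n r s C \<omega>}"
    have "C (\<omega> i) \<le> t * l"
    proof (rule ccontr)
      assume c: "\<not> C (\<omega> i) \<le> t * l"
      define N where "N = (\<Sum>j<n. of_bool (C (\<omega> j) > t * l) :: real)"
      have "1 \<le> N" unfolding N_def using i c by (subst sum.remove[of _ i]) (auto intro!: sum_nonneg)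
      have "n * S t * (1 - S t) \<le> Y"
        using nS S_strict[of t] by (smt (verit) mult_left_le mult_nonneg_nonneg of_nat_0_le_iff)
      then have "lam * sqrt (n * S t * (1 - S t)) \<le> lam * sqrt Y" using lam by (intro mult_left_mono) auto
      also have "\<dots> < 1 - Y" using y by (simp add: Y_def)
      also have "\<dots> \<le> N - n * S t" using \<open>1 \<le> N\<close> nS by linarith
      also have "\<dots> \<le> \<bar>N - n * S t\<bar>" by simp
      finally have "lam < hc_ratio \<omega> t" unfolding hc_ratio_def N_def
        using S_strict[of t] n by (subst pos_less_divide_eq) auto
      moreover have "ereal (hc_ratio \<omega> t) \<le> HC_stat n r s C \<omega>" unfolding HC_stat_eq by (rule SUP_upper) simp
      ultimately have "ereal lam < HC_stat n r s C \<omega>" by (metis ereal_less_eq(3) less_le_trans less_ereal.simps(1))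
      then show False using w by simp
    qed
    then have "\<kappa> * l\<^sup>2 \<le> \<rho> * l\<^sup>2 - C (\<omega> i)" by (simp add: t_def power2_eq_square algebra_simps)
    moreover have "\<omega> i \<in> space (M i)" using w i by (auto simp: sp space_PiM PiE_def Pi_def)
    ultimately show "\<omega> \<in> (\<lambda>\<omega>. \<omega> i) -` X \<inter> space (PiM {..<n} M)" using w by (auto simp: X_def sp)
  qed
  have "measure (data_law n p q \<theta> \<eta> z \<sigma>) {\<omega> \<in> space (data_space n p q). \<not> ereal lam < HC_stat n r s C \<omega>}
     \<le> measure (PiM {..<n} M) ((\<lambda>\<omega>. \<omega> i) -` X \<inter> space (PiM {..<n} M))"
    unfolding PM by (rule P.finite_measure_mono[OF sub]) (rule measurable_sets[where A = "M i"], rule measurable_component_singleton, use i in simp, rule Xm)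
  also have "\<dots> = measure (distr (PiM {..<n} M) (M i) (\<lambda>\<omega>. \<omega> i)) X"
    using i Xm by (intro measure_distr[symmetric]) auto
  also have "distr (PiM {..<n} M) (M i) (\<lambda>\<omega>. \<omega> i) = M i" by (rule PiM_component) (use i in simp)
  also have "measure (M i) X \<le> 16 * (r + s) / (\<kappa>\<^sup>2 * l\<^sup>2)"
    unfolding X_def M_def zs by (rule flipped_concentration[OF z \<kappa>])
  finally show ?thesis .
qed

end

section \<open>A lower bound for the risk of every test\<close>

text \<open>
  A Chernoff bound for the lower tail. Nonnegativity makes it depend on the range only
  through \<open>n / K\<close>, so it stays below one even for \<open>K\<close> as large as \<open>n\<close>.
\<close>
lemma PiM_lower_tail:
  fixes X :: "'a \<Rightarrow> real" and n :: nat
  assumes M: "prob_space M" and X[measurable]: "X \<in> borel_measurable M"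
    and b: "\<And>x. x \<in> space M \<Longrightarrow> 0 \<le> X x \<and> X x \<le> K" and K: "0 < K"
    and m: "3 / 4 \<le> (\<integral>x. X x \<partial>M)"
  defines "P \<equiv> PiM {..<n} (\<lambda>_. M)"
  shows "measure P {\<omega> \<in> space P. (\<Sum>i<n. X (\<omega> i)) < n / 4} \<le> exp (- (n / (8 * K)))"
proof -
  interpret M: prob_space M by fact
  interpret P: prob_space P unfolding P_def by (rule prob_PiM_const[OF M])
  interpret PS: product_sigma_finite "\<lambda>_. M" by standard
  have ex: "exp (- x) \<le> 1 - x / 2" if "0 \<le> x" "x \<le> 1" for x :: real
  proof -
    have "exp ((1 - x) *\<^sub>R 0 + x *\<^sub>R (-1)) \<le> (1 - x) * exp 0 + x * exp (-1 :: real)"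
      using that by (intro convex_onD[OF exp_convex]) auto
    moreover have "(2::real) \<le> exp 1" using exp_ge_add_one_self[of 1] by simp
    then have "exp (-1 :: real) \<le> 1 / 2" by (simp add: exp_minus field_simps)
    then have "x * exp (-1 :: real) \<le> x * (1 / 2)" using that by (intro mult_left_mono) auto
    ultimately show ?thesis by simp
  qed
  have iX: "integrable M X"
    by (rule M.integrable_const_bound[of _ K]) (use b in auto)
  have "(\<integral>x. exp (- (X x / K)) \<partial>M) \<le> (\<integral>x. 1 - X x / K / 2 \<partial>M)"
  proof (rule integral_mono)
    show "integrable M (\<lambda>x. exp (- (X x / K)))"
      by (rule M.integrable_const_bound[of _ 1]) (use b K in auto)
    show "integrable M (\<lambda>x. 1 - X x / K / 2)" using iX by simp
    show "exp (- (X x / K)) \<le> 1 - X x / K / 2" if "x \<in> space M" for x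
      using b[OF that] K by (intro ex) auto
  qed
  also have "\<dots> = 1 - (\<integral>x. X x \<partial>M) / K / 2" using iX by (simp add: M.prob_space)
  also have "\<dots> \<le> 1 + - (3 / (8 * K))"
  proof -
    have "(3 / 4) / K \<le> (\<integral>x. X x \<partial>M) / K" using m K by (intro divide_right_mono) auto
    then show ?thesis by simp
  qed
  also have "\<dots> \<le> exp (- (3 / (8 * K)))" by (rule exp_ge_add_one_self)
  finally have mgf: "(\<integral>x. exp (- (X x / K)) \<partial>M) \<le> exp (- (3 / (8 * K)))" .
  define m' where "m' = (\<integral>x. exp (- (X x / K)) \<partial>M)"
  have m': "0 \<le> m'" "m' \<le> exp (- (3 / (8 * K)))"
    using mgf by (auto simp: m'_def intro!: integral_nonneg)
  have mgf': "(\<integral>\<^sup>+x. ennreal (exp (- (X x / K))) \<partial>M) = ennreal m'"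
    unfolding m'_def by (rule nn_integral_eq_integral)
      (use b K in \<open>auto intro!: M.integrable_const_bound[of _ 1]\<close>)
  define E where "E = {\<omega> \<in> space P. (\<Sum>i<n. X (\<omega> i)) < n / 4}"
  have sm[measurable]: "(\<lambda>\<omega>. \<Sum>i<n. X (\<omega> i)) \<in> borel_measurable P"
    unfolding P_def by measurable
  have [measurable]: "E \<in> sets P" unfolding E_def by measurable
  have "emeasure P E = (\<integral>\<^sup>+\<omega>. indicator E \<omega> \<partial>P)" by simp
  also have "\<dots> \<le> (\<integral>\<^sup>+\<omega>. ennreal (exp (n / (4 * K))) * (\<Prod>i<n. ennreal (exp (- (X (\<omega> i) / K)))) \<partial>P)"
  proof (rule nn_integral_mono)
    fix \<omega> assume "\<omega> \<in> space P"
    have pe: "(\<Prod>i<n. ennreal (exp (- (X (\<omega> i) / K)))) = ennreal (exp (- ((\<Sum>i<n. X (\<omega> i)) / K)))"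
      by (subst prod_ennreal) (auto simp: exp_sum[symmetric] sum_negf sum_divide_distrib)
    show "indicator E \<omega> \<le> ennreal (exp (n / (4 * K))) * (\<Prod>i<n. ennreal (exp (- (X (\<omega> i) / K))))"
    proof (cases "\<omega> \<in> E")
      case True
      then have "(\<Sum>i<n. X (\<omega> i)) / K \<le> n / 4 / K" using K by (intro divide_right_mono) (auto simp: E_def)
      then have "1 \<le> exp (n / (4 * K) + - ((\<Sum>i<n. X (\<omega> i)) / K))" by simp
      then show ?thesis using True unfolding pe by (simp add: ennreal_mult[symmetric] exp_add[symmetric] del: one_le_exp_iff)
    qed simp
  qed
  also have "\<dots> = ennreal (exp (n / (4 * K))) * (\<Prod>i<n. \<integral>\<^sup>+x. ennreal (exp (- (X x / K))) \<partial>M)"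
    unfolding P_def
    by (subst nn_integral_cmult, measurable,
        subst PS.product_nn_integral_prod[of "{..<n}" "\<lambda>_ x. ennreal (exp (- (X x / K)))"]) auto
  also have "\<dots> = ennreal (exp (n / (4 * K)) * m' ^ n)"
    unfolding mgf' using m' by (simp add: ennreal_power ennreal_mult)
  also have "\<dots> \<le> ennreal (exp (n / (4 * K)) * exp (- (3 / (8 * K))) ^ n)"
    using m' by (intro ennreal_leI mult_left_mono power_mono) auto
  also have "exp (n / (4 * K)) * exp (- (3 / (8 * K))) ^ n = exp (- (n / (8 * K)))"
    unfolding exp_of_nat_mult[symmetric] exp_add[symmetric] using K by (simp add: field_simps)
  finally show ?thesis by (simp add: P.emeasure_eq_measure E_def)
qed

lemma labelsD: "z \<in> labels n \<Longrightarrow> i < n \<Longrightarrow> z i = 1 \<or> z i = -1"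
  unfolding labels_def by (auto dest!: PiE_mem[of _ _ _ i])

lemma labels_sq: "z \<in> labels n \<Longrightarrow> i < n \<Longrightarrow> (z i)\<^sup>2 = 1"
  using labelsD by fastforce

lemma finite_labels: "finite (labels n)"
  unfolding labels_def by (intro finite_PiE) auto

lemma card_labels: "card (labels n) = 2 ^ n"
  unfolding labels_def by (subst card_PiE) (auto simp: numeral_2_eq_2)

context calibrated
begin

definition "\<nu> = PiM {..<n} (\<lambda>_. G 0 0)"

lemma sets_nu [simp, measurable_cong]: "sets \<nu> = sets (data_space n p q)"
  unfolding \<nu>_def data_space_def by (intro sets_PiM_cong) auto

lemma nn_integral_data_law:
  assumes z: "\<And>i. i < n \<Longrightarrow> (z i)\<^sup>2 = 1" "\<And>i. i < n \<Longrightarrow> (\<sigma> i)\<^sup>2 = 1"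
    and f: "f \<in> borel_measurable (data_space n p q)"
  shows "(\<integral>\<^sup>+\<omega>. f \<omega> \<partial>data_law n p q \<theta> \<eta> z \<sigma>)
    = (\<integral>\<^sup>+\<omega>. (\<Prod>i<n. ennreal (dens (z i) (\<sigma> i) (\<omega> i))) * f \<omega> \<partial>\<nu>)"
proof -
  have "data_law n p q \<theta> \<eta> z \<sigma> = PiM {..<n} (\<lambda>i. density (G 0 0) (\<lambda>w. ennreal (dens (z i) (\<sigma> i) w)))"
    unfolding data_law_eq_PiM by (rule PiM_cong) (use z in \<open>auto intro!: G_dens\<close>)
  also have "\<dots> = density \<nu> (\<lambda>\<omega>. \<Prod>i<n. ennreal (dens (z i) (\<sigma> i) (\<omega> i)))"
    unfolding \<nu>_def
    by (rule PiM_density) (use z in \<open>auto simp: prob_space_pair_law G_dens[symmetric]\<close>)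
  finally show ?thesis
  proof (simp, intro nn_integral_density)
    show "(\<lambda>\<omega>. \<Prod>i<n. ennreal (dens (z i) (\<sigma> i) (\<omega> i))) \<in> borel_measurable \<nu>"
      unfolding \<nu>_def by measurable
    show "f \<in> borel_measurable \<nu>" using f by simp
  qed
qed

definition "mix c w = (dens 1 c w + dens (-1) (- c) w) / 2"

lemma mix_eq: "mix 1 = g0" "mix (-1) = g1"
  by (auto simp: mix_def g0_def g1_def fun_eq_iff)

text \<open>
  If \<open>R\<close> bounds the integral for every labelling, it bounds the integral for a uniformly
  random labelling. The sign pattern \<open>c\<close> tells which pairs are mismatched; for fixed \<open>c\<close> the
  average over the first labels factorises over the pairs.
\<close>
lemma average_over_labels:
  assumes c: "\<And>i. i < n \<Longrightarrow> (c i)\<^sup>2 = 1" and f[measurable]: "f \<in> borel_measurable (data_space n p q)"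
    and \<sigma>: "\<And>z i. z \<in> labels n \<Longrightarrow> i < n \<Longrightarrow> \<sigma> z i = c i * z i"
    and R: "\<And>z. z \<in> labels n \<Longrightarrow> (\<integral>\<^sup>+\<omega>. f \<omega> \<partial>data_law n p q \<theta> \<eta> z (\<sigma> z)) \<le> ennreal R" and R0: "0 \<le> R"
  shows "(\<integral>\<^sup>+\<omega>. ennreal (\<Prod>i<n. mix (c i) (\<omega> i)) * f \<omega> \<partial>\<nu>) \<le> ennreal R"
proof -
  have prodm: "(\<lambda>\<omega>. \<Prod>i<n. ennreal (dens (z i) (c i * z i) (\<omega> i))) \<in> borel_measurable \<nu>" for z
    unfolding \<nu>_def by measurable
  have sq: "(c i * z i)\<^sup>2 = 1" if "z \<in> labels n" "i < n" for z i
    using c labels_sq that by (simp add: power_mult_distrib)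
  have pt: "ennreal (\<Prod>i<n. mix (c i) (\<omega> i)) = ennreal (1 / 2 ^ n) * (\<Sum>z\<in>labels n. \<Prod>i<n. ennreal (dens (z i) (c i * z i) (\<omega> i)))" for \<omega>
  proof -
    have "(\<Prod>i<n. mix (c i) (\<omega> i)) = (\<Prod>i<n. (1 / 2) * (\<Sum>e\<in>{-1, 1}. dens e (c i * e) (\<omega> i)))"
      by (intro prod.cong) (auto simp: mix_def)
    also have "\<dots> = 1 / 2 ^ n * (\<Sum>z\<in>labels n. \<Prod>i<n. dens (z i) (c i * z i) (\<omega> i))"
      unfolding labels_def by (subst prod_sum_PiE[symmetric]) (auto simp: prod.distrib power_one_over prod_dividef)
    finally have fac: "(\<Prod>i<n. mix (c i) (\<omega> i)) = 1 / 2 ^ n * (\<Sum>z\<in>labels n. \<Prod>i<n. dens (z i) (c i * z i) (\<omega> i))" .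
    have "ennreal (\<Prod>i<n. mix (c i) (\<omega> i)) = ennreal (1 / 2 ^ n) * ennreal (\<Sum>z\<in>labels n. \<Prod>i<n. dens (z i) (c i * z i) (\<omega> i))"
    proof -
      have "0 \<le> (\<Sum>z\<in>labels n. \<Prod>i<n. dens (z i) (c i * z i) (\<omega> i))"
        by (intro sum_nonneg prod_nonneg less_imp_le dens_pos)
      then show ?thesis unfolding fac by (intro ennreal_mult) auto
    qed
    also have "ennreal (\<Sum>z\<in>labels n. \<Prod>i<n. dens (z i) (c i * z i) (\<omega> i)) = (\<Sum>z\<in>labels n. \<Prod>i<n. ennreal (dens (z i) (c i * z i) (\<omega> i)))"
      by (subst sum_ennreal[symmetric], rule prod_nonneg, rule less_imp_le, rule dens_pos,
          rule sum.cong[OF refl], rule prod_ennreal[symmetric], rule less_imp_le, rule dens_pos)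
    finally show ?thesis .
  qed
  have "(\<integral>\<^sup>+\<omega>. ennreal (\<Prod>i<n. mix (c i) (\<omega> i)) * f \<omega> \<partial>\<nu>)
     = (\<integral>\<^sup>+\<omega>. ennreal (1 / 2 ^ n) * (\<Sum>z\<in>labels n. (\<Prod>i<n. ennreal (dens (z i) (c i * z i) (\<omega> i))) * f \<omega>) \<partial>\<nu>)"
    unfolding pt by (simp only: sum_distrib_right mult.assoc)
  also have "\<dots> = ennreal (1 / 2 ^ n) * (\<Sum>z\<in>labels n. \<integral>\<^sup>+\<omega>. (\<Prod>i<n. ennreal (dens (z i) (c i * z i) (\<omega> i))) * f \<omega> \<partial>\<nu>)"
    using prodm f by (subst nn_integral_cmult, measurable, subst nn_integral_sum) auto
  also have "\<dots> = ennreal (1 / 2 ^ n) * (\<Sum>z\<in>labels n. \<integral>\<^sup>+\<omega>. f \<omega> \<partial>data_law n p q \<theta> \<eta> z (\<sigma> z))"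
    by (intro arg_cong2[where f="(*)"] sum.cong refl, subst nn_integral_data_law)
       (use labels_sq sq \<sigma> in \<open>auto intro!: nn_integral_cong prod.cong arg_cong2[where f="(*)"]\<close>)
  also have "\<dots> \<le> ennreal (1 / 2 ^ n) * (\<Sum>z\<in>labels n. ennreal R)"
    by (intro mult_left_mono sum_mono R) auto
  also have "\<dots> = ennreal (1 / 2 ^ n) * ennreal (2 ^ n * R)"
    using R0 by (simp add: card_labels ennreal_mult ennreal_power[symmetric])
  also have "\<dots> = ennreal R" using R0 by (simp add: ennreal_mult[symmetric])
  finally show ?thesis .
qed

definition "LR w = g1 w / g0 w"

lemma LR_measurable [measurable]:
  "LR \<in> borel_measurable ((\<Pi>\<^sub>M j\<in>{..<p}. borel) \<Otimes>\<^sub>M (\<Pi>\<^sub>M j\<in>{..<q}. borel))"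
  unfolding LR_def[abs_def] by measurable

text \<open>
  The law of one pair with equal, uniformly random labels.
\<close>
definition "null_mix = density (G 0 0) (\<lambda>w. ennreal (g0 w))"

lemma sets_null_mix [simp, measurable_cong]:
  "sets null_mix = sets ((\<Pi>\<^sub>M j\<in>{..<p}. borel) \<Otimes>\<^sub>M (\<Pi>\<^sub>M j\<in>{..<q}. borel))"
  by (simp add: null_mix_def)

lemma measure_G_space: "measure (G e f) (space (G 0 0)) = 1"
  unfolding space_pair_law[of p q \<theta> \<eta> 0 0 \<theta> \<eta> e f] by (rule prob_space.prob_space[OF prob_space_pair_law])

lemma prob_null_mix: "prob_space null_mix"
proof
  have "emeasure null_mix (space null_mix) = (\<integral>\<^sup>+w. ennreal (g0 w) * indicator (space (G 0 0)) w \<partial>G 0 0)"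
    unfolding null_mix_def space_density by (rule emeasure_density[OF _ sets.top]) measurable
  also have "\<dots> = 1"
    using mixture_measure[of 1 1 "space (G 0 0)", OF _ _ sets.top] by (simp add: g0_def measure_G_space)
  finally show "emeasure null_mix (space null_mix) = 1" .
qed

definition "trunc K w = LR w * indicator {w. LR w \<le> K} w"

text \<open>
  Under \<open>null_mix\<close> the likelihood ratio integrates to the mismatched law, so the truncation
  costs exactly the mass that the mismatched law puts on large values of \<open>LR\<close>.
\<close>
lemma truncated_mean:
  assumes "0 < K"
  shows "(\<integral>w. trunc K w \<partial>null_mix)
    = (measure (G 1 (-1)) {w \<in> space (G 0 0). LR w \<le> K} + measure (G (-1) 1) {w \<in> space (G 0 0). LR w \<le> K}) / 2"
proof -
  define X where "X = {w \<in> space (G 0 0). LR w \<le> K}"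
  have X[measurable]: "X \<in> sets (G 0 0)" unfolding X_def by measurable
  have tm[measurable]: "trunc K \<in> borel_measurable ((\<Pi>\<^sub>M j\<in>{..<p}. borel) \<Otimes>\<^sub>M (\<Pi>\<^sub>M j\<in>{..<q}. borel))"
    unfolding trunc_def[abs_def] by measurable
  have pos: "0 \<le> trunc K w" for w
    using g0_pos[of w] g1_pos[of w] by (auto simp: trunc_def LR_def split: split_indicator)
  have "(\<integral>\<^sup>+w. ennreal (trunc K w) \<partial>null_mix) = (\<integral>\<^sup>+w. ennreal (g0 w) * ennreal (trunc K w) \<partial>G 0 0)"
    unfolding null_mix_def by (rule nn_integral_density) auto
  also have "\<dots> = (\<integral>\<^sup>+w. ennreal ((dens 1 (-1) w + dens (-1) (- (-1)) w) / 2) * indicator X w \<partial>G 0 0)"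
  proof (rule nn_integral_cong)
    fix w assume w: "w \<in> space (G 0 0)"
    have "g0 w * trunc K w = g1 w * indicator {w. LR w \<le> K} w"
      using g0_pos[of w] by (simp add: trunc_def LR_def)
    then have "ennreal (g0 w) * ennreal (trunc K w) = ennreal (g1 w * indicator {w. LR w \<le> K} w)"
      using g0_pos[of w] pos by (simp add: ennreal_mult[symmetric])
    then show "ennreal (g0 w) * ennreal (trunc K w) = ennreal ((dens 1 (-1) w + dens (-1) (- (-1)) w) / 2) * indicator X w"
      using w by (simp add: X_def g1_def split: split_indicator)
  qed
  also have "\<dots> = ennreal ((measure (G 1 (-1)) X + measure (G (-1) (- (-1))) X) / 2)"
    by (rule mixture_measure) (use X in auto)
  finally have "(\<integral>\<^sup>+w. ennreal (trunc K w) \<partial>null_mix) = ennreal ((measure (G 1 (-1)) X + measure (G (-1) 1) X) / 2)"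
    by simp
  then show ?thesis
    by (subst integral_eq_nn_integral) (auto simp: pos X_def)
qed

text \<open>
  Whatever value \<open>x\<close> the test takes, one of the two errors is paid: \<open>x\<close> under the null law,
  or \<open>(1 - x) * L\<close> under an alternative with likelihood ratio \<open>L\<close>.
\<close>
lemma test_dichotomy:
  fixes x L T :: real
  assumes "0 \<le> x" "x \<le> 1" "T \<le> L" "0 \<le> L"
  shows "(if 1/4 \<le> T then 1/4 else 0) \<le> x + (1 - x) * L"
proof (cases "1/4 \<le> T")
  case True
  then have "(1 - x) * (1/4) \<le> (1 - x) * L" using assms by (intro mult_left_mono) auto
  then show ?thesis using True assms by simp
qed (use assms in auto)

text \<open>
  Two priors are compared: uniformly random labels that agree everywhere, and the same with
  one uniformly random mismatch. The likelihood ratio of the second against the first is the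
  average \<open>Lbar\<close> of \<open>n\<close> independent copies of \<open>LR\<close>. Truncation at \<open>n\<close> makes the one-sided
  tail bound applicable, and it shows that \<open>Lbar\<close> is at least one quarter with probability
  bounded away from zero under the first prior.
\<close>
lemma mixture_lower_bound:
  assumes \<psi>: "\<psi> \<in> tests n p q"
    and A: "\<And>z. z \<in> labels n \<Longrightarrow> (\<integral>\<^sup>+\<omega>. ennreal (\<psi> \<omega>) \<partial>data_law n p q \<theta> \<eta> z z) \<le> ennreal RA" "0 \<le> RA"
    and B: "\<And>z i. z \<in> labels n \<Longrightarrow> i < n \<Longrightarrow> (\<integral>\<^sup>+\<omega>. ennreal (1 - \<psi> \<omega>) \<partial>data_law n p q \<theta> \<eta> z (z(i := - z i))) \<le> ennreal RB" "0 \<le> RB"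
    and m: "3 / 4 \<le> (\<integral>w. trunc n w \<partial>null_mix)"
  shows "(1 - exp (- 1 / 8)) / 4 \<le> RA + RB"
proof -
  have \<psi>m[measurable]: "\<psi> \<in> borel_measurable (data_space n p q)"
    and \<psi>b: "\<And>\<omega>. \<omega> \<in> space (data_space n p q) \<Longrightarrow> 0 \<le> \<psi> \<omega> \<and> \<psi> \<omega> \<le> 1"
    using \<psi> by (auto simp: tests_def)
  have spn: "space \<nu> = space (data_space n p q)" by (rule sets_eq_imp_space_eq) simp
  define \<Pi>0 where "\<Pi>0 \<omega> = (\<Prod>i<n. g0 (\<omega> i))" for \<omega>
  have \<Pi>0_pos: "0 < \<Pi>0 \<omega>" for \<omega> unfolding \<Pi>0_def by (intro prod_pos) (simp add: g0_pos)
  \<comment> \<open>The sign pattern with its only mismatch at \<open>i\<close>.\<close>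
  define cc where "cc i = (\<lambda>k. if k = i then -1 else 1 :: real)" for i :: nat
  have mixc: "(\<Prod>k<n. mix (cc i k) (\<omega> k)) = \<Pi>0 \<omega> * LR (\<omega> i)" if "i < n" for i \<omega>
  proof -
    have "(\<Prod>k<n. mix (cc i k) (\<omega> k)) = mix (-1) (\<omega> i) * (\<Prod>k\<in>{..<n}-{i}. mix (cc i k) (\<omega> k))"
      using that by (subst prod.remove[of _ i]) (auto simp: cc_def)
    also have "(\<Prod>k\<in>{..<n}-{i}. mix (cc i k) (\<omega> k)) = (\<Prod>k\<in>{..<n}-{i}. g0 (\<omega> k))"
      by (intro prod.cong) (auto simp: cc_def mix_eq)
    also have "mix (-1) (\<omega> i) = g0 (\<omega> i) * LR (\<omega> i)" using g0_pos[of "\<omega> i"] by (simp add: mix_eq LR_def)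
    also have "g0 (\<omega> i) * LR (\<omega> i) * (\<Prod>k\<in>{..<n}-{i}. g0 (\<omega> k)) = \<Pi>0 \<omega> * LR (\<omega> i)"
      unfolding \<Pi>0_def using that by (subst prod.remove[of _ i "\<lambda>k. g0 (\<omega> k)"]) auto
    finally show ?thesis .
  qed
  have \<Pi>0m[measurable]: "\<Pi>0 \<in> borel_measurable \<nu>" unfolding \<Pi>0_def[abs_def] \<nu>_def by measurable
  have LRm[measurable]: "(\<lambda>\<omega>. LR (\<omega> i)) \<in> borel_measurable \<nu>" if "i \<in> {..<n}" for i
    unfolding \<nu>_def using that by measurable
  have IA: "(\<integral>\<^sup>+\<omega>. ennreal (\<Pi>0 \<omega>) * ennreal (\<psi> \<omega>) \<partial>\<nu>) \<le> ennreal RA"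
    using average_over_labels[of "\<lambda>_. 1" "\<lambda>\<omega>. ennreal (\<psi> \<omega>)" "\<lambda>z. z" RA] A
    by (simp add: mix_eq \<Pi>0_def)
  have IB: "(\<integral>\<^sup>+\<omega>. ennreal (\<Pi>0 \<omega> * LR (\<omega> i)) * ennreal (1 - \<psi> \<omega>) \<partial>\<nu>) \<le> ennreal RB" if i: "i < n" for i
    unfolding mixc[OF i, symmetric]
    by (rule average_over_labels[where \<sigma> = "\<lambda>z. z(i := - z i)"]) (use B i in \<open>auto simp: cc_def\<close>)
  define Lbar where "Lbar \<omega> = (\<Sum>i<n. LR (\<omega> i)) / n" for \<omega>
  have LRpos: "0 < LR w" for w using g0_pos g1_pos by (simp add: LR_def)
  have Lpos: "0 \<le> Lbar \<omega>" for \<omega> unfolding Lbar_def by (auto intro!: divide_nonneg_nonneg sum_nonneg simp: less_imp_le[OF LRpos])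
  have [measurable]: "Lbar \<in> borel_measurable \<nu>" unfolding Lbar_def[abs_def] by measurable
  have IB': "(\<integral>\<^sup>+\<omega>. ennreal (\<Pi>0 \<omega> * Lbar \<omega>) * ennreal (1 - \<psi> \<omega>) \<partial>\<nu>) \<le> ennreal RB"
  proof -
    have "(\<integral>\<^sup>+\<omega>. ennreal (\<Pi>0 \<omega> * Lbar \<omega>) * ennreal (1 - \<psi> \<omega>) \<partial>\<nu>)
       = (\<integral>\<^sup>+\<omega>. ennreal (1 / n) * (\<Sum>i<n. ennreal (\<Pi>0 \<omega> * LR (\<omega> i)) * ennreal (1 - \<psi> \<omega>)) \<partial>\<nu>)"
    proof (rule nn_integral_cong)
      fix \<omega>
      have nn: "0 \<le> \<Pi>0 \<omega> * LR (\<omega> i)" for i using \<Pi>0_pos[of \<omega>] LRpos[of "\<omega> i"] by simp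
      have "\<Pi>0 \<omega> * Lbar \<omega> = 1 / n * (\<Sum>i<n. \<Pi>0 \<omega> * LR (\<omega> i))"
        by (simp add: Lbar_def sum_distrib_left[symmetric])
      then have "ennreal (\<Pi>0 \<omega> * Lbar \<omega>) = ennreal (1 / n) * ennreal (\<Sum>i<n. \<Pi>0 \<omega> * LR (\<omega> i))"
        by (simp only:) (rule ennreal_mult, auto intro!: sum_nonneg nn)
      also have "ennreal (\<Sum>i<n. \<Pi>0 \<omega> * LR (\<omega> i)) = (\<Sum>i<n. ennreal (\<Pi>0 \<omega> * LR (\<omega> i)))"
        by (rule sum_ennreal[symmetric]) (rule nn)
      finally show "ennreal (\<Pi>0 \<omega> * Lbar \<omega>) * ennreal (1 - \<psi> \<omega>)
         = ennreal (1 / n) * (\<Sum>i<n. ennreal (\<Pi>0 \<omega> * LR (\<omega> i)) * ennreal (1 - \<psi> \<omega>))"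
        by (simp only: sum_distrib_right mult.assoc)
    qed
    also have "\<dots> = ennreal (1 / n) * (\<Sum>i<n. \<integral>\<^sup>+\<omega>. ennreal (\<Pi>0 \<omega> * LR (\<omega> i)) * ennreal (1 - \<psi> \<omega>) \<partial>\<nu>)"
    proof -
      have mm: "(\<lambda>\<omega>. ennreal (\<Pi>0 \<omega> * LR (\<omega> i)) * ennreal (1 - \<psi> \<omega>)) \<in> borel_measurable \<nu>" if "i \<in> {..<n}" for i
        using that by measurable
      have sm: "(\<lambda>\<omega>. \<Sum>i<n. ennreal (\<Pi>0 \<omega> * LR (\<omega> i)) * ennreal (1 - \<psi> \<omega>)) \<in> borel_measurable \<nu>"
        by (rule borel_measurable_sum) (rule mm)
      show ?thesis unfolding nn_integral_cmult[OF sm] by (subst nn_integral_sum) (use mm in auto)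
    qed
    also have "\<dots> \<le> ennreal (1 / n) * (\<Sum>i<n. ennreal RB)"
      by (intro mult_left_mono sum_mono IB) auto
    also have "\<dots> = ennreal (1 / n) * ennreal (n * RB)"
      using B(2) by (simp add: ennreal_mult ennreal_of_nat_eq_real_of_nat)
    also have "\<dots> = ennreal RB" using B(2) n by (simp add: ennreal_mult[symmetric])
    finally show ?thesis .
  qed
  define T where "T \<omega> = (\<Sum>i<n. trunc n (\<omega> i)) / n" for \<omega>
  have tm[measurable]: "trunc n \<in> borel_measurable ((\<Pi>\<^sub>M j\<in>{..<p}. borel) \<Otimes>\<^sub>M (\<Pi>\<^sub>M j\<in>{..<q}. borel))"
    unfolding trunc_def[abs_def] by measurable
  have Tm[measurable]: "T \<in> borel_measurable \<nu>" unfolding T_def[abs_def] \<nu>_def by measurable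
  have TL: "T \<omega> \<le> Lbar \<omega>" for \<omega> unfolding T_def Lbar_def
    by (intro divide_right_mono sum_mono) (use less_imp_le[OF LRpos] in \<open>auto simp: trunc_def split: split_indicator\<close>)
  define P0 where "P0 = PiM {..<n} (\<lambda>_. null_mix)"
  interpret P0: prob_space P0 unfolding P0_def by (rule prob_PiM_const[OF prob_null_mix])
  have P0_dens: "P0 = density \<nu> (\<lambda>\<omega>. ennreal (\<Pi>0 \<omega>))"
  proof -
    have "P0 = density \<nu> (\<lambda>\<omega>. \<Prod>i<n. ennreal (g0 (\<omega> i)))"
      unfolding P0_def \<nu>_def null_mix_def
      by (rule PiM_density) (auto simp: prob_space_pair_law prob_null_mix null_mix_def[symmetric])
    also have "(\<lambda>\<omega>. \<Prod>i<n. ennreal (g0 (\<omega> i))) = (\<lambda>\<omega>. ennreal (\<Pi>0 \<omega>))"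
      unfolding \<Pi>0_def by (intro ext prod_ennreal) (simp add: less_imp_le g0_pos)
    finally show ?thesis .
  qed
  define E where "E = {\<omega> \<in> space P0. 1 / 4 \<le> T \<omega>}"
  have spP: "space P0 = space \<nu>" by (simp add: P0_dens)
  have Em: "E \<in> sets \<nu>" unfolding E_def spP by measurable
  have Em': "E \<in> sets P0" using Em by (simp add: P0_dens)
  have "P0.prob (space P0 - E) \<le> exp (- (real n / (8 * real n)))"
  proof -
    have "space P0 - E = {\<omega> \<in> space P0. (\<Sum>i<n. trunc n (\<omega> i)) < n / 4}"
      using n by (auto simp: E_def T_def field_simps)
    moreover have "P0.prob {\<omega> \<in> space P0. (\<Sum>i<n. trunc n (\<omega> i)) < n / 4} \<le> exp (- (real n / (8 * real n)))"
      unfolding P0_def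
      by (rule PiM_lower_tail[OF prob_null_mix]) (use n m less_imp_le[OF LRpos] in \<open>auto simp: trunc_def split: split_indicator\<close>)
    ultimately show ?thesis by simp
  qed
  then have E_lb: "1 - exp (- 1 / 8) \<le> P0.prob E" using P0.prob_compl[OF Em'] n by simp
  have "ennreal (1/4 * P0.prob E) = (\<integral>\<^sup>+\<omega>. ennreal (\<Pi>0 \<omega>) * (ennreal (1/4) * indicator E \<omega>) \<partial>\<nu>)"
  proof -
    have "(\<integral>\<^sup>+\<omega>. ennreal (\<Pi>0 \<omega>) * (ennreal (1/4) * indicator E \<omega>) \<partial>\<nu>) = (\<integral>\<^sup>+\<omega>. ennreal (1/4) * indicator E \<omega> \<partial>P0)"
      unfolding P0_dens using Em by (intro nn_integral_density[symmetric]) auto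
    also have "\<dots> = ennreal (1/4) * emeasure P0 E" using Em' by (rule nn_integral_cmult_indicator)
    also have "\<dots> = ennreal (1/4 * P0.prob E)" unfolding P0.emeasure_eq_measure by (rule ennreal_mult[symmetric]) auto
    finally show ?thesis ..
  qed
  also have "\<dots> \<le> (\<integral>\<^sup>+\<omega>. ennreal (\<Pi>0 \<omega>) * ennreal (\<psi> \<omega>) + ennreal (\<Pi>0 \<omega> * Lbar \<omega>) * ennreal (1 - \<psi> \<omega>) \<partial>\<nu>)"
  proof (rule nn_integral_mono)
    fix \<omega> assume w: "\<omega> \<in> space \<nu>"
    then have x: "0 \<le> \<psi> \<omega>" "\<psi> \<omega> \<le> 1" using \<psi>b spn by auto
    define P where "P = \<Pi>0 \<omega>"
    have P: "0 \<le> P" using \<Pi>0_pos[of \<omega>] by (simp add: P_def)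
    have "(if 1/4 \<le> T \<omega> then 1/4 else 0) \<le> \<psi> \<omega> + (1 - \<psi> \<omega>) * Lbar \<omega>"
      using x TL Lpos by (rule test_dichotomy)
    then have "P * (if 1/4 \<le> T \<omega> then 1/4 else 0) \<le> P * (\<psi> \<omega> + (1 - \<psi> \<omega>) * Lbar \<omega>)" using P by (rule mult_left_mono)
    also have "\<dots> = P * \<psi> \<omega> + P * Lbar \<omega> * (1 - \<psi> \<omega>)" by (simp add: algebra_simps)
    finally have "ennreal (P * (if 1/4 \<le> T \<omega> then 1/4 else 0)) \<le> ennreal (P * \<psi> \<omega> + P * Lbar \<omega> * (1 - \<psi> \<omega>))"
      by (rule ennreal_leI)
    also have "\<dots> = ennreal P * ennreal (\<psi> \<omega>) + ennreal (P * Lbar \<omega>) * ennreal (1 - \<psi> \<omega>)"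
      using P x Lpos[of \<omega>] by (subst ennreal_plus) (auto simp: ennreal_mult)
    also have "ennreal (P * (if 1/4 \<le> T \<omega> then 1/4 else 0)) = ennreal P * (ennreal (1/4) * indicator E \<omega>)"
      using P w spP by (subst ennreal_mult) (auto simp: E_def split: split_indicator)
    finally show "ennreal (\<Pi>0 \<omega>) * (ennreal (1/4) * indicator E \<omega>)
       \<le> ennreal (\<Pi>0 \<omega>) * ennreal (\<psi> \<omega>) + ennreal (\<Pi>0 \<omega> * Lbar \<omega>) * ennreal (1 - \<psi> \<omega>)"
      by (simp only: P_def)
  qed
  also have "\<dots> = (\<integral>\<^sup>+\<omega>. ennreal (\<Pi>0 \<omega>) * ennreal (\<psi> \<omega>) \<partial>\<nu>) + (\<integral>\<^sup>+\<omega>. ennreal (\<Pi>0 \<omega> * Lbar \<omega>) * ennreal (1 - \<psi> \<omega>) \<partial>\<nu>)"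
    by (rule nn_integral_add) measurable
  also have "\<dots> \<le> ennreal RA + ennreal RB" by (intro add_mono IA IB')
  also have "\<dots> = ennreal (RA + RB)" using A(2) B(2) by simp
  finally have "1/4 * P0.prob E \<le> RA + RB" using A(2) B(2) by (subst (asm) ennreal_le_iff) auto
  then show ?thesis using E_lb by simp
qed

end

section \<open>The risk of the test and of the best test\<close>

lemma calibrated_reflect:
  "calibrated n p q \<theta> \<eta> r s \<Longrightarrow> calibrated n p q \<theta> (\<lambda>j. - \<eta> j) r s"
  by (simp add: calibrated_def L2_set_def)

text \<open>
  Replacing \<open>\<eta>\<close> by its negative exchanges the two statistics and the roles of \<open>\<sigma>\<close> and \<open>- \<sigma>\<close>,
  so every result for \<open>C_minus\<close> yields one for \<open>C_plus\<close>.
\<close>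
lemma C_plus_reflect: "C_plus p q \<theta> \<eta> = C_minus p q \<theta> (\<lambda>j. - \<eta> j)"
  by (simp add: C_plus_def C_minus_def dotp_def sum_negf)

lemma data_law_reflect:
  "data_law n p q \<theta> (\<lambda>j. - \<eta> j) z \<sigma> = data_law n p q \<theta> \<eta> z (\<lambda>i. - \<sigma> i)"
  by (simp add: data_law_def)

text \<open>
  For labels in \<open>{-1, 1}\<close> a positive loss means that \<open>\<sigma>\<close> differs from \<open>z\<close> somewhere and
  agrees with it somewhere: the first is seen by \<open>C_minus\<close>, the second by \<open>C_plus\<close>.
\<close>
lemma label_loss_pos_iff:
  assumes "0 < n"
  shows "0 < label_loss n z \<sigma> \<longleftrightarrow> (\<exists>i<n. z i \<noteq> \<sigma> i) \<and> (\<exists>i<n. z i \<noteq> - \<sigma> i)"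
proof -
  have "0 < (1 / real n) * (\<Sum>i<n. of_bool (P i)) \<longleftrightarrow> (\<exists>i<n. P i)" for P :: "nat \<Rightarrow> bool"
  proof
    assume "0 < (1 / real n) * (\<Sum>i<n. of_bool (P i))"
    then show "\<exists>i<n. P i" by (rule contrapos_pp) (auto intro: sum.neutral)
  next
    assume "\<exists>i<n. P i"
    then obtain i where i: "i < n" "P i" by auto
    have "0 < (\<Sum>i<n. of_bool (P i) :: real)"
      by (rule sum_pos2[of _ i]) (use i in auto)
    then show "0 < (1 / real n) * (\<Sum>i<n. of_bool (P i))" using assms by simp
  qed
  then show ?thesis unfolding label_loss_def by simp
qed

lemma neg_labels_in: "z \<in> labels n \<Longrightarrow> neg_labels n z \<in> labels n"
  unfolding labels_def neg_labels_def by (auto simp: PiE_iff)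

lemma flip_in_labels: "z \<in> labels n \<Longrightarrow> i < n \<Longrightarrow> z(i := - z i) \<in> labels n"
  unfolding labels_def by (auto simp: PiE_iff extensional_def)

lemma flip_loss_pos:
  assumes n: "2 \<le> n" and z: "z \<in> labels n" and i: "i < n"
  shows "0 < label_loss n z (z(i := - z i))"
proof -
  define j where "j = (if i = 0 then 1 else 0 :: nat)"
  have j: "j < n" "j \<noteq> i" using n by (auto simp: j_def)
  have "z i \<noteq> 0" "z j \<noteq> 0" using labels_sq[OF z i] labels_sq[OF z j(1)] by auto
  then have "z i \<noteq> (z(i := - z i)) i" "z j \<noteq> - (z(i := - z i)) j" using j by auto
  then show ?thesis using i j n by (subst label_loss_pos_iff) auto
qed

lemma labels_nonempty: "(\<lambda>i\<in>{..<n}. 1) \<in> labels n"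
  unfolding labels_def by auto

definition null_pairs where "null_pairs n = {(z, \<sigma>). z \<in> labels n \<and> \<sigma> \<in> {z, neg_labels n z}}"
definition alt_pairs where "alt_pairs n = {(z, \<sigma>). z \<in> labels n \<and> \<sigma> \<in> labels n \<and> label_loss n z \<sigma> > 0}"

lemma finite_pairs: "finite (null_pairs n)" "finite (alt_pairs n)"
  by (rule finite_subset[of _ "labels n \<times> labels n"]; auto simp: null_pairs_def alt_pairs_def finite_labels neg_labels_in)+

lemma pairs_nonempty: "null_pairs n \<noteq> {}" "2 \<le> n \<Longrightarrow> alt_pairs n \<noteq> {}"
proof -
  let ?z = "\<lambda>i\<in>{..<n}. 1"
  have "(?z, ?z) \<in> null_pairs n" using labels_nonempty by (simp add: null_pairs_def)
  then show "null_pairs n \<noteq> {}" by blast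
  assume n: "2 \<le> n"
  have "(?z, ?z(0 := - ?z 0)) \<in> alt_pairs n"
    unfolding alt_pairs_def mem_Collect_eq case_prod_conv
    using n by (intro conjI labels_nonempty flip_in_labels flip_loss_pos) auto
  then show "alt_pairs n \<noteq> {}" by blast
qed

lemma exact_risk_of_alt: "exact_risk_of n p q \<theta> \<eta> \<psi> =
   (SUP (z, \<sigma>)\<in>null_pairs n. integral\<^sup>L (data_law n p q \<theta> \<eta> z \<sigma>) \<psi>)
   + (SUP (z, \<sigma>)\<in>alt_pairs n. integral\<^sup>L (data_law n p q \<theta> \<eta> z \<sigma>) (\<lambda>\<omega>. 1 - \<psi> \<omega>))"
  by (simp add: exact_risk_of_def null_pairs_def alt_pairs_def)

lemma tests_integral:
  assumes \<psi>: "\<psi> \<in> tests n p q"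
  shows "(\<integral>\<^sup>+\<omega>. ennreal (\<psi> \<omega>) \<partial>data_law n p q \<theta> \<eta> z \<sigma>) = ennreal (integral\<^sup>L (data_law n p q \<theta> \<eta> z \<sigma>) \<psi>)"
    "0 \<le> integral\<^sup>L (data_law n p q \<theta> \<eta> z \<sigma>) \<psi>"
proof -
  interpret prob_space "data_law n p q \<theta> \<eta> z \<sigma>" by (rule prob_space_data_law)
  have m: "\<psi> \<in> borel_measurable (data_law n p q \<theta> \<eta> z \<sigma>)"
    and b: "\<And>\<omega>. \<omega> \<in> space (data_law n p q \<theta> \<eta> z \<sigma>) \<Longrightarrow> 0 \<le> \<psi> \<omega> \<and> \<psi> \<omega> \<le> 1"
    using \<psi> by (auto simp: tests_def space_data_law)
  have i: "integrable (data_law n p q \<theta> \<eta> z \<sigma>) \<psi>"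
    by (rule integrable_const_bound[of _ 1]) (use m b in auto)
  show "(\<integral>\<^sup>+\<omega>. ennreal (\<psi> \<omega>) \<partial>data_law n p q \<theta> \<eta> z \<sigma>) = ennreal (integral\<^sup>L (data_law n p q \<theta> \<eta> z \<sigma>) \<psi>)"
    by (rule nn_integral_eq_integral[OF i]) (use b in auto)
  show "0 \<le> integral\<^sup>L (data_law n p q \<theta> \<eta> z \<sigma>) \<psi>"
    by (rule integral_nonneg_AE) (use b in auto)
qed

lemma tests_complement: "\<psi> \<in> tests n p q \<Longrightarrow> (\<lambda>\<omega>. 1 - \<psi> \<omega>) \<in> tests n p q"
  by (auto simp: tests_def)

lemma integral_indicator_test:
  assumes "{\<omega> \<in> space (data_space n p q). P \<omega>} \<in> sets (data_space n p q)"
  shows "integral\<^sup>L (data_law n p q \<theta> \<eta> z \<sigma>) (\<lambda>\<omega>. of_bool (P \<omega>))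
    = measure (data_law n p q \<theta> \<eta> z \<sigma>) {\<omega> \<in> space (data_space n p q). P \<omega>}"
proof -
  have "integral\<^sup>L (data_law n p q \<theta> \<eta> z \<sigma>) (\<lambda>\<omega>. of_bool (P \<omega>) :: real)
     = integral\<^sup>L (data_law n p q \<theta> \<eta> z \<sigma>) (indicator {\<omega> \<in> space (data_space n p q). P \<omega>})"
    by (rule Bochner_Integration.integral_cong) (auto simp: space_data_law indicator_def)
  then show ?thesis using assms
    by (simp add: space_data_law Int_absorb2)
qed

context calibrated
begin

interpretation reflected: calibrated n p q \<theta> "\<lambda>j. - \<eta> j" r s
  by (rule calibrated_reflect) (rule calibrated_axioms)

abbreviation "Hm \<equiv> HC_stat n r s (C_minus p q \<theta> \<eta>)"
abbreviation "Hp \<equiv> HC_stat n r s (C_plus p q \<theta> \<eta>)"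

lemma Hp_measurable [measurable]: "Hp \<in> borel_measurable (data_space n p q)"
  unfolding C_plus_reflect by (rule reflected.HC_stat_measurable)

lemma HC_test_in_tests: "HC_test n p q r s \<delta> \<theta> \<eta> \<in> tests n p q"
  unfolding tests_def HC_test_def[abs_def] by measurable

text \<open>
  Under the null hypothesis one of the two statistics is a standardised empirical process;
  under every alternative both are large.
\<close>
lemma HC_risk_bound:
  fixes \<delta> \<epsilon> \<kappa> :: real
  defines "lam \<equiv> sqrt (2 * (1 + \<delta>) * ln (ln (real n)))"
  assumes lam: "2 \<le> lam" and \<epsilon>: "0 < \<epsilon>" "\<epsilon> \<le> 1 / 2" and \<kappa>: "0 < \<kappa>"
    and y: "lam * sqrt (2 * real n * exp (- ((\<rho> - \<kappa>) * l\<^sup>2))) < 1 - 2 * real n * exp (- ((\<rho> - \<kappa>) * l\<^sup>2))"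
  shows "exact_risk_of n p q \<theta> \<eta> (HC_test n p q r s \<delta> \<theta> \<eta>)
     \<le> 2 * hc_half_err \<epsilon> n lam + 2 * (16 * (r + s) / (\<kappa>\<^sup>2 * l\<^sup>2))"
proof -
  have test: "HC_test n p q r s \<delta> \<theta> \<eta> = (\<lambda>\<omega>. of_bool (ereal lam < Hm \<omega> \<and> ereal lam < Hp \<omega>))"
    by (auto simp: HC_test_def lam_def fun_eq_iff)
  have test': "(\<lambda>\<omega>. 1 - HC_test n p q r s \<delta> \<theta> \<eta> \<omega>) = (\<lambda>\<omega>. of_bool (\<not> (ereal lam < Hm \<omega> \<and> ereal lam < Hp \<omega>)))"
    unfolding test by auto
  define Em where "Em = {\<omega> \<in> space (data_space n p q). ereal lam < Hm \<omega>}"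
  define Ep where "Ep = {\<omega> \<in> space (data_space n p q). ereal lam < Hp \<omega>}"
  define Fm where "Fm = {\<omega> \<in> space (data_space n p q). \<not> ereal lam < Hm \<omega>}"
  define Fp where "Fp = {\<omega> \<in> space (data_space n p q). \<not> ereal lam < Hp \<omega>}"
  have [measurable]: "Em \<in> sets (data_space n p q)" "Ep \<in> sets (data_space n p q)"
    "Fm \<in> sets (data_space n p q)" "Fp \<in> sets (data_space n p q)"
    unfolding Em_def Ep_def Fm_def Fp_def by measurable
  have m1: "{\<omega> \<in> space (data_space n p q). ereal lam < Hm \<omega> \<and> ereal lam < Hp \<omega>} \<in> sets (data_space n p q)"
    by measurable
  have m2: "{\<omega> \<in> space (data_space n p q). \<not> (ereal lam < Hm \<omega> \<and> ereal lam < Hp \<omega>)} \<in> sets (data_space n p q)"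
    by measurable
  have I: "integral\<^sup>L (data_law n p q \<theta> \<eta> z \<sigma>) (HC_test n p q r s \<delta> \<theta> \<eta>) \<le> 2 * hc_half_err \<epsilon> n lam"
    if zs: "(z, \<sigma>) \<in> null_pairs n" for z \<sigma>
  proof -
    interpret prob_space "data_law n p q \<theta> \<eta> z \<sigma>" by (rule prob_space_data_law)
    have z: "z \<in> labels n" and \<sigma>: "\<sigma> = z \<or> \<sigma> = neg_labels n z" using zs by (auto simp: null_pairs_def)
    have "integral\<^sup>L (data_law n p q \<theta> \<eta> z \<sigma>) (HC_test n p q r s \<delta> \<theta> \<eta>)
      = prob {\<omega> \<in> space (data_space n p q). ereal lam < Hm \<omega> \<and> ereal lam < Hp \<omega>}"
      unfolding test by (rule integral_indicator_test[OF m1])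
    also have "\<dots> \<le> 2 * hc_half_err \<epsilon> n lam"
      using \<sigma>
    proof
      assume e: "\<sigma> = z"
      have "prob {\<omega> \<in> space (data_space n p q). ereal lam < Hm \<omega> \<and> ereal lam < Hp \<omega>} \<le> prob Em"
        by (intro finite_measure_mono) (auto simp: Em_def)
      also have "prob Em \<le> 2 * hc_half_err \<epsilon> n lam"
        unfolding Em_def by (rule type_I_bound[OF _ _ lam \<epsilon>]) (simp_all add: e labels_sq[OF z])
      finally show ?thesis .
    next
      assume e: "\<sigma> = neg_labels n z"
      have "prob {\<omega> \<in> space (data_space n p q). ereal lam < Hm \<omega> \<and> ereal lam < Hp \<omega>} \<le> prob Ep"
        by (intro finite_measure_mono) (auto simp: Ep_def)
      also have "prob Ep = measure (data_law n p q \<theta> (\<lambda>j. - \<eta> j) z (\<lambda>i. - \<sigma> i)) Ep"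
        unfolding data_law_reflect by simp
      also have "\<dots> \<le> 2 * hc_half_err \<epsilon> n lam"
        unfolding Ep_def C_plus_reflect
        by (rule reflected.type_I_bound[OF _ _ lam \<epsilon>]) (simp_all add: e labels_sq[OF z] neg_labels_def)
      finally show ?thesis .
    qed
    finally show ?thesis .
  qed
  have II: "integral\<^sup>L (data_law n p q \<theta> \<eta> z \<sigma>) (\<lambda>\<omega>. 1 - HC_test n p q r s \<delta> \<theta> \<eta> \<omega>) \<le> 2 * (16 * (r + s) / (\<kappa>\<^sup>2 * l\<^sup>2))"
    if zs: "(z, \<sigma>) \<in> alt_pairs n" for z \<sigma>
  proof -
    interpret prob_space "data_law n p q \<theta> \<eta> z \<sigma>" by (rule prob_space_data_law)
    have z: "z \<in> labels n" "\<sigma> \<in> labels n" and loss: "0 < label_loss n z \<sigma>" using zs by (auto simp: alt_pairs_def)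
    obtain i j where i: "i < n" "z i \<noteq> \<sigma> i" and j: "j < n" "z j \<noteq> - \<sigma> j"
      using loss n by (auto simp: label_loss_pos_iff)
    have zi: "\<sigma> i = - z i" using i labelsD[OF z(1) i(1)] labelsD[OF z(2) i(1)] by auto
    have zj: "\<sigma> j = z j" using j labelsD[OF z(1) j(1)] labelsD[OF z(2) j(1)] by auto
    have lam0: "0 \<le> lam" using lam by simp
    have "integral\<^sup>L (data_law n p q \<theta> \<eta> z \<sigma>) (\<lambda>\<omega>. 1 - HC_test n p q r s \<delta> \<theta> \<eta> \<omega>)
      = prob {\<omega> \<in> space (data_space n p q). \<not> (ereal lam < Hm \<omega> \<and> ereal lam < Hp \<omega>)}"
      unfolding test' by (rule integral_indicator_test[OF m2])
    also have "\<dots> = prob (Fm \<union> Fp)" by (rule arg_cong[where f=prob]) (auto simp: Fm_def Fp_def)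
    also have "\<dots> \<le> prob Fm + prob Fp" by (rule measure_Un_le) auto
    also have "prob Fm \<le> 16 * (r + s) / (\<kappa>\<^sup>2 * l\<^sup>2)"
      unfolding Fm_def
    proof (rule type_II_bound[where i = i and \<kappa> = \<kappa>])
      show "(z i)\<^sup>2 = 1" by (rule labels_sq[OF z(1) i(1)])
    qed (fact i(1) zi \<kappa> lam0 y)+
    also have "prob Fp = measure (data_law n p q \<theta> (\<lambda>j. - \<eta> j) z (\<lambda>i. - \<sigma> i)) Fp"
      unfolding data_law_reflect by simp
    also have "\<dots> \<le> 16 * (r + s) / (\<kappa>\<^sup>2 * l\<^sup>2)"
      unfolding Fp_def C_plus_reflect
    proof (rule reflected.type_II_bound[where i = j and \<kappa> = \<kappa>])
      show "(z j)\<^sup>2 = 1" by (rule labels_sq[OF z(1) j(1)])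
      show "- \<sigma> j = - z j" by (simp add: zj)
      show "lam * sqrt (2 * real n * exp (- ((\<rho> - \<kappa>) * l\<^sup>2)))
         < 1 - 2 * real n * exp (- ((\<rho> - \<kappa>) * l\<^sup>2))"
        by (rule y)
    qed (fact j(1) \<kappa> lam0)+
    finally show ?thesis by simp
  qed
  show ?thesis unfolding exact_risk_of_alt
  proof (intro add_mono cSUP_least pairs_nonempty n)
    fix x assume "x \<in> null_pairs n"
    then show "(case x of (z, \<sigma>) \<Rightarrow> integral\<^sup>L (data_law n p q \<theta> \<eta> z \<sigma>) (HC_test n p q r s \<delta> \<theta> \<eta>)) \<le> 2 * hc_half_err \<epsilon> n lam"
      by (cases x) (simp only: case_prod_conv, rule I)
  next
    fix x assume "x \<in> alt_pairs n"
    then show "(case x of (z, \<sigma>) \<Rightarrow> integral\<^sup>L (data_law n p q \<theta> \<eta> z \<sigma>) (\<lambda>\<omega>. 1 - HC_test n p q r s \<delta> \<theta> \<eta> \<omega>)) \<le> 2 * (16 * (r + s) / (\<kappa>\<^sup>2 * l\<^sup>2))"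
      by (cases x) (simp only: case_prod_conv, rule II)
  qed
qed

lemma exact_risk_of_nonneg:
  assumes "\<psi> \<in> tests n p q" shows "0 \<le> exact_risk_of n p q \<theta> \<eta> \<psi>"
proof -
  have "0 \<le> (SUP (z, \<sigma>)\<in>null_pairs n. integral\<^sup>L (data_law n p q \<theta> \<eta> z \<sigma>) \<psi>)"
    using pairs_nonempty(1)[of n] finite_pairs(1)[of n] tests_integral(2)[OF assms]
    by (auto intro!: cSUP_upper2 bdd_above_finite)
  moreover have "0 \<le> (SUP (z, \<sigma>)\<in>alt_pairs n. integral\<^sup>L (data_law n p q \<theta> \<eta> z \<sigma>) (\<lambda>\<omega>. 1 - \<psi> \<omega>))"
    using pairs_nonempty(2)[OF n] finite_pairs(2)[of n] tests_integral(2)[OF tests_complement[OF assms]]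
    by (auto intro!: cSUP_upper2 bdd_above_finite)
  ultimately show ?thesis unfolding exact_risk_of_alt by simp
qed

text \<open>
  For mismatched labels \<open>LR\<close> is at most \<open>2 * exp C\<close> with \<open>C\<close> close to
  \<open>\<rho> * l\<^sup>2 = 2 * \<rho> * ln n\<close>, so it stays below \<open>n\<close> when \<open>\<rho> < 1 / 2\<close>.
\<close>
lemma truncated_mean_large:
  assumes \<kappa>: "0 < \<kappa>" "\<rho> + 2 * \<kappa> = 1 / 2" and l2: "ln 2 \<le> \<kappa> * l\<^sup>2" and small: "16 * (r + s) / (\<kappa>\<^sup>2 * l\<^sup>2) \<le> 1 / 4"
  shows "3 / 4 \<le> (\<integral>w. trunc n w \<partial>null_mix)"
proof -
  have one: "3 / 4 \<le> measure (G e (- e)) {w \<in> space (G 0 0). LR w \<le> n}" if e: "e\<^sup>2 = 1" for e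
  proof -
    interpret prob_space "G e (- e)" by (rule prob_space_pair_law)
    have sp: "space (G 0 0) = space (G e (- e))" by (rule space_pair_law)
    define B where "B = {w \<in> space (G e (- e)). \<kappa> * l\<^sup>2 \<le> \<bar>C w - \<rho> * l\<^sup>2\<bar>}"
    have B[measurable]: "B \<in> sets (G e (- e))" unfolding B_def by measurable
    have "space (G e (- e)) - B \<subseteq> {w \<in> space (G 0 0). LR w \<le> n}"
    proof (clarsimp simp: sp B_def not_le)
      fix x y assume c: "\<bar>C (x, y) - \<rho> * l\<^sup>2\<bar> < \<kappa> * l\<^sup>2"
      then have "C (x, y) < (\<rho> + 2 * \<kappa>) * l\<^sup>2 - \<kappa> * l\<^sup>2" by (simp add: algebra_simps abs_less_iff)
      also have "\<dots> \<le> ln (n / 2)" using l2 n by (simp add: \<kappa>(2) l_sq ln_div)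
      finally have "exp (C (x, y)) \<le> exp (ln (n / 2))" by simp
      also have "\<dots> = n / 2" using n by simp
      finally have "2 * exp (C (x, y)) * g0 (x, y) \<le> n * g0 (x, y)"
        using g0_pos[of "(x, y)"] by (intro mult_right_mono) auto
      then have "g1 (x, y) \<le> n * g0 (x, y)" using likelihood_ratio_upper[of "(x, y)"] by linarith
      then show "LR (x, y) \<le> n" using g0_pos[of "(x, y)"] by (simp add: LR_def field_simps)
    qed
    moreover have "{w \<in> space (G 0 0). LR w \<le> n} \<in> sets (G e (- e))" unfolding sp by measurable
    ultimately have "prob (space (G e (- e)) - B) \<le> prob {w \<in> space (G 0 0). LR w \<le> n}"
      by (rule finite_measure_mono)
    moreover have "prob B \<le> 1 / 4" unfolding B_def by (rule order_trans[OF flipped_concentration[OF e \<kappa>(1)] small])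
    ultimately show ?thesis using prob_compl[OF B] by simp
  qed
  show ?thesis using truncated_mean[of n] one[of 1] one[of "-1"] n by simp
qed

lemma exact_risk_lower:
  assumes "3 / 4 \<le> (\<integral>w. trunc n w \<partial>null_mix)"
  shows "(1 - exp (- 1 / 8)) / 4 \<le> exact_risk n p q \<theta> \<eta>"
  unfolding exact_risk_def
proof (rule cINF_greatest)
  have "(\<lambda>_. 0) \<in> tests n p q" by (simp add: tests_def)
  then show "tests n p q \<noteq> {}" by blast
next
  fix \<psi> assume \<psi>: "\<psi> \<in> tests n p q"
  define RA where "RA = (SUP (z, \<sigma>)\<in>null_pairs n. integral\<^sup>L (data_law n p q \<theta> \<eta> z \<sigma>) \<psi>)"
  define RB where "RB = (SUP (z, \<sigma>)\<in>alt_pairs n. integral\<^sup>L (data_law n p q \<theta> \<eta> z \<sigma>) (\<lambda>\<omega>. 1 - \<psi> \<omega>))"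
  have A: "integral\<^sup>L (data_law n p q \<theta> \<eta> z \<sigma>) \<psi> \<le> RA" if "(z, \<sigma>) \<in> null_pairs n" for z \<sigma>
    unfolding RA_def using cSUP_upper[OF that, of "\<lambda>(z, \<sigma>). integral\<^sup>L (data_law n p q \<theta> \<eta> z \<sigma>) \<psi>"] finite_pairs(1)[of n]
    by (simp add: bdd_above_finite)
  have B: "integral\<^sup>L (data_law n p q \<theta> \<eta> z \<sigma>) (\<lambda>\<omega>. 1 - \<psi> \<omega>) \<le> RB" if "(z, \<sigma>) \<in> alt_pairs n" for z \<sigma>
    unfolding RB_def using cSUP_upper[OF that, of "\<lambda>(z, \<sigma>). integral\<^sup>L (data_law n p q \<theta> \<eta> z \<sigma>) (\<lambda>\<omega>. 1 - \<psi> \<omega>)"] finite_pairs(2)[of n]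
    by (simp add: bdd_above_finite)
  have RA0: "0 \<le> RA"
  proof -
    obtain z \<sigma> where "(z, \<sigma>) \<in> null_pairs n" using pairs_nonempty(1)[of n] by auto
    from A[OF this] tests_integral(2)[OF \<psi>] show ?thesis by (rule order_trans[rotated])
  qed
  have RB0: "0 \<le> RB"
  proof -
    obtain z \<sigma> where "(z, \<sigma>) \<in> alt_pairs n" using pairs_nonempty(2)[OF n] by auto
    from B[OF this] tests_integral(2)[OF tests_complement[OF \<psi>]] show ?thesis by (rule order_trans[rotated])
  qed
  have "(1 - exp (- 1 / 8)) / 4 \<le> RA + RB"
  proof (rule mixture_lower_bound[OF \<psi> _ RA0 _ RB0 assms])
    fix z assume z: "z \<in> labels n"
    show "(\<integral>\<^sup>+\<omega>. ennreal (\<psi> \<omega>) \<partial>data_law n p q \<theta> \<eta> z z) \<le> ennreal RA"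
      unfolding tests_integral(1)[OF \<psi>] by (intro ennreal_leI A) (simp add: null_pairs_def z)
    fix i assume i: "i < n"
    show "(\<integral>\<^sup>+\<omega>. ennreal (1 - \<psi> \<omega>) \<partial>data_law n p q \<theta> \<eta> z (z(i := - z i))) \<le> ennreal RB"
      unfolding tests_integral(1)[OF tests_complement[OF \<psi>]]
      by (intro ennreal_leI B) (simp add: alt_pairs_def z flip_in_labels flip_loss_pos n i)
  qed
  then show "(1 - exp (- 1 / 8)) / 4 \<le> exact_risk_of n p q \<theta> \<eta> \<psi>"
    unfolding exact_risk_of_alt RA_def RB_def .
qed

end

theorem theorem4p1:
  fixes r s \<delta> :: real
    and p q :: "nat \<Rightarrow> nat"
    and \<theta> \<eta> :: "nat \<Rightarrow> nat \<Rightarrow> real"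
  assumes "r > 0" and "s \<ge> 0" and "\<delta> > 0"
    and "\<And>n. n \<ge> 2 \<Longrightarrow>
      2 * L2_set (\<theta> n) {..<p n} * L2_set (\<eta> n) {..<q n} /
        sqrt ((L2_set (\<theta> n) {..<p n})\<^sup>2 + (L2_set (\<eta> n) {..<q n})\<^sup>2)
      = sqrt (2 * r * ln (real n))"
    and "\<And>n. n \<ge> 2 \<Longrightarrow>
      \<bar>(L2_set (\<theta> n) {..<p n})\<^sup>2 - (L2_set (\<eta> n) {..<q n})\<^sup>2\<bar> /
        sqrt ((L2_set (\<theta> n) {..<p n})\<^sup>2 + (L2_set (\<eta> n) {..<q n})\<^sup>2)
      = sqrt (2 * s * ln (real n))"
  shows "(r + s - sqrt s * sqrt (r + s) < 1 / 2 \<longrightarrow>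
            liminf (\<lambda>n. ereal (exact_risk n (p n) (q n) (\<theta> n) (\<eta> n))) > 0) \<and>
         (r + s - sqrt s * sqrt (r + s) > 1 / 2 \<longrightarrow>
            (\<forall>n\<ge>2. HC_test n (p n) (q n) r s \<delta> (\<theta> n) (\<eta> n) \<in> tests n (p n) (q n)) \<and>
            (\<lambda>n. exact_risk_of n (p n) (q n) (\<theta> n) (\<eta> n)
                   (HC_test n (p n) (q n) r s \<delta> (\<theta> n) (\<eta> n))) \<longlonglongrightarrow> 0)"
proof (intro conjI impI)
  define rho where "rho = r + s - sqrt s * sqrt (r + s)"
  have cal: "calibrated n (p n) (q n) (\<theta> n) (\<eta> n) r s" if "2 \<le> n" for n
    using that assms by (simp add: calibrated_def)
  have rs: "0 < r + s" using assms by simp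
  have ev2: "eventually (\<lambda>n. 2 \<le> n) sequentially" by (rule eventually_ge_at_top)
  {
    assume "r + s - sqrt s * sqrt (r + s) < 1 / 2"
    then have lt: "rho < 1 / 2" by (simp add: rho_def)
    \<comment> \<open>One \<open>\<kappa>\<close> absorbs the fluctuations of the log-likelihood ratio, the other the additive \<open>ln 2\<close>.\<close>
    define \<kappa> where "\<kappa> = (1 / 2 - rho) / 2"
    have \<kappa>: "0 < \<kappa>" "rho + 2 * \<kappa> = 1 / 2" using lt by (auto simp: \<kappa>_def field_simps)
    have "eventually (\<lambda>n. ln 2 \<le> \<kappa> * (2 * ln (real n))) sequentially"
      using \<kappa>(1) by real_asymp
    moreover have "((\<lambda>n. 16 * (r + s) / (\<kappa>\<^sup>2 * (2 * ln (real n)))) \<longlonglongrightarrow> 0)"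
      using \<kappa>(1) by real_asymp
    then have "eventually (\<lambda>n. 16 * (r + s) / (\<kappa>\<^sup>2 * (2 * ln (real n))) < 1 / 4) sequentially"
      by (rule order_tendstoD(2)) simp
    ultimately have "eventually (\<lambda>n. ereal ((1 - exp (- 1 / 8)) / 4) \<le> ereal (exact_risk n (p n) (q n) (\<theta> n) (\<eta> n))) sequentially"
      using ev2
    proof eventually_elim
      case (elim n)
      interpret calibrated n "p n" "q n" "\<theta> n" "\<eta> n" r s by (rule cal) fact
      have "3 / 4 \<le> (\<integral>w. trunc n w \<partial>null_mix)"
        by (rule truncated_mean_large[of \<kappa>]) (use \<kappa> elim in \<open>auto simp: l_sq \<rho>_def rho_def\<close>)
      then show ?case unfolding ereal_less_eq(3) by (rule exact_risk_lower)
    qed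
    then have "ereal ((1 - exp (- 1 / 8)) / 4) \<le> liminf (\<lambda>n. ereal (exact_risk n (p n) (q n) (\<theta> n) (\<eta> n)))"
      by (rule Liminf_bounded)
    moreover have "0 < ereal ((1 - exp (- 1 / 8)) / 4)" by simp
    ultimately show "0 < liminf (\<lambda>n. ereal (exact_risk n (p n) (q n) (\<theta> n) (\<eta> n)))" by (rule less_le_trans[rotated])
  }
  show "\<forall>n\<ge>2. HC_test n (p n) (q n) r s \<delta> (\<theta> n) (\<eta> n) \<in> tests n (p n) (q n)"
    using calibrated.HC_test_in_tests[OF cal] by blast
  {
    assume "r + s - sqrt s * sqrt (r + s) > 1 / 2"
    then have gt: "rho > 1 / 2" by (simp add: rho_def)
    \<comment> \<open>The threshold is placed halfway between \<open>1 / 2\<close> and \<open>rho\<close>.\<close>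
    define \<kappa> where "\<kappa> = (rho - 1 / 2) / 2"
    have \<kappa>: "0 < \<kappa>" "rho - \<kappa> = 1 / 2 + \<kappa>" using gt by (auto simp: \<kappa>_def field_simps)
    define lam where "lam n = sqrt (2 * (1 + \<delta>) * ln (ln (real n)))" for n
    obtain \<epsilon> where \<epsilon>: "0 < \<epsilon>" "\<epsilon> \<le> 1/2" "(\<lambda>n. hc_half_err \<epsilon> (real n) (lam n)) \<longlonglongrightarrow> 0"
      using hc_half_err_tendsto[OF \<open>\<delta> > 0\<close>] unfolding lam_def by blast
    have lam2: "eventually (\<lambda>n. 2 \<le> lam n) sequentially"
      unfolding lam_def using \<open>\<delta> > 0\<close> by real_asymp
    define Y where "Y n = 2 * exp (- (2 * \<kappa> * ln (real n)))" for n :: nat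
    have "(\<lambda>n. lam n * sqrt (Y n) + Y n) \<longlonglongrightarrow> 0"
      unfolding lam_def Y_def using \<open>\<delta> > 0\<close> \<kappa>(1) by real_asymp
    then have "eventually (\<lambda>n. lam n * sqrt (Y n) + Y n < 1) sequentially"
      by (rule order_tendstoD(2)) simp
    then have ub: "eventually (\<lambda>n. exact_risk_of n (p n) (q n) (\<theta> n) (\<eta> n) (HC_test n (p n) (q n) r s \<delta> (\<theta> n) (\<eta> n))
        \<le> 2 * hc_half_err \<epsilon> n (lam n) + 2 * (16 * (r + s) / (\<kappa>\<^sup>2 * (2 * ln (real n))))) sequentially"
      using ev2 lam2
    proof eventually_elim
      case (elim n)
      interpret calibrated n "p n" "q n" "\<theta> n" "\<eta> n" r s by (rule cal) fact
      have "\<rho> - \<kappa> = 1 / 2 + \<kappa>" using \<kappa>(2) by (simp add: \<rho>_def rho_def)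
      then have "(\<rho> - \<kappa>) * l\<^sup>2 = ln n + 2 * \<kappa> * ln n" by (simp only: l_sq) (simp add: algebra_simps)
      then have "exp (- ((\<rho> - \<kappa>) * l\<^sup>2)) = exp (- ln n) * exp (- (2 * \<kappa> * ln n))"
        by (simp only: exp_add[symmetric]) simp
      then have "2 * real n * exp (- ((\<rho> - \<kappa>) * l\<^sup>2)) = Y n"
        using elim(2) by (simp add: Y_def exp_minus)
      then show ?case
        using HC_risk_bound[of \<delta> \<epsilon> \<kappa>] elim \<epsilon> \<kappa>(1) by (simp add: lam_def l_sq)
    qed
    have lb: "eventually (\<lambda>n. 0 \<le> exact_risk_of n (p n) (q n) (\<theta> n) (\<eta> n) (HC_test n (p n) (q n) r s \<delta> (\<theta> n) (\<eta> n))) sequentially"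
      using ev2 by eventually_elim (rule calibrated.exact_risk_of_nonneg[OF cal calibrated.HC_test_in_tests[OF cal]])
    have "(\<lambda>n. 2 * (16 * (r + s) / (\<kappa>\<^sup>2 * (2 * ln (real n))))) \<longlonglongrightarrow> 0"
      using \<kappa>(1) by real_asymp
    from tendsto_add[OF tendsto_mult[OF tendsto_const[of 2] \<epsilon>(3)] this]
    have "(\<lambda>n. 2 * hc_half_err \<epsilon> n (lam n) + 2 * (16 * (r + s) / (\<kappa>\<^sup>2 * (2 * ln (real n))))) \<longlonglongrightarrow> 0"
      by simp
    from tendsto_sandwich[OF lb ub tendsto_const this]
    show "(\<lambda>n. exact_risk_of n (p n) (q n) (\<theta> n) (\<eta> n) (HC_test n (p n) (q n) r s \<delta> (\<theta> n) (\<eta> n))) \<longlonglongrightarrow> 0" .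
  }
qed

end
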